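(* Let $K$ be a field, let $\beta$ be a faithful linear representation of a finite group $G$ on $K[X_1,\ldots,X_d]$ with invariant ring $R=K[X_1,\ldots,X_d]^G$, and let $\rho_1$ and $\rho_2$ be linear representations of $G$, giving rise to the quotient schemes $Z_{\rho_1}$ and $Z_{\rho_2}$. Then the normalization of $Z_{\rho_1}\times_{\operatorname{Spec}R}Z_{\rho_2}$ is $Z_{\rho_1\times\rho_2}$.
   Context: For an $m$-dimensional $K$-linear representation $\rho$ of $G$, $Z_\rho=(\mathbb A^d\times\mathbb A^m)/(\beta\times\rho)=\operatorname{Spec}\big(K[X_1,\ldots,X_d,W_1,\ldots,W_m]^{\beta\times\rho}\big)$, where $G$ acts on both factors; it is a scheme over $\operatorname{Spec}R$. $\rho_1\times\rho_2$ denotes the direct sum representation. The normalization is realized by the natural morphism $Z_{\rho_1\times\rho_2}\to Z_{\rho_1}\times_{\operatorname{Spec}R}Z_{\rho_2}$ induced by the projections $\mathbb A^d\times\mathbb A^{m_1}\times\mathbb A^{m_2}\to\mathbb A^d\times\mathbb A^{m_i}$ on the quotients. By normalization is meant: first pass to the reduction and then take the integral closure within the total ring of fractions. *)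

theory Defs
  imports
    "Jordan_Normal_Form.Matrix"
    "HOL-Algebra.QuotRing"
    "HOL-Algebra.Polynomials"
    "HOL-Algebra.Free_Abelian_Groups"
    "HOL-Library.Poly_Mapping"
    "HOL-Library.FuncSet"
    "HOL-Analysis.Abstract_Topology"
begin

section \<open>Rings of fractions, reduction and normalization\<close>

text \<open>All rings are commutative. Throughout, a ring of fractions is formed with respect to a
  multiplicatively closed set \<open>S\<close> of denominators; its elements are equivalence classes of pairs
  (numerator, denominator).\<close>

definition fraction_rel :: "('a, 'b) ring_scheme \<Rightarrow> 'a set \<Rightarrow> (('a \<times> 'a) \<times> ('a \<times> 'a)) set" where
  "fraction_rel A S = {((a, s), (b, t)).
     a \<in> carrier A \<and> s \<in> S \<and> b \<in> carrier A \<and> t \<in> S \<and>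
     (\<exists>u\<in>S. u \<otimes>\<^bsub>A\<^esub> (t \<otimes>\<^bsub>A\<^esub> a) = u \<otimes>\<^bsub>A\<^esub> (s \<otimes>\<^bsub>A\<^esub> b))}"

definition fraction :: "('a, 'b) ring_scheme \<Rightarrow> 'a set \<Rightarrow> 'a \<Rightarrow> 'a \<Rightarrow> ('a \<times> 'a) set" where
  "fraction A S a s = fraction_rel A S `` {(a, s)}"

text \<open>In the operations the unions range over equal classes, one for each choice of
  representatives.\<close>

definition localization :: "('a, 'b) ring_scheme \<Rightarrow> 'a set \<Rightarrow> ('a \<times> 'a) set ring" where
  "localization A S = \<lparr>
     carrier = (carrier A \<times> S) // fraction_rel A S,
     monoid.mult = (\<lambda>x y. \<Union>(a, s)\<in>x. \<Union>(b, t)\<in>y. fraction A S (a \<otimes>\<^bsub>A\<^esub> b) (s \<otimes>\<^bsub>A\<^esub> t)),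
     one = fraction A S \<one>\<^bsub>A\<^esub> \<one>\<^bsub>A\<^esub>,
     ring.zero = fraction A S \<zero>\<^bsub>A\<^esub> \<one>\<^bsub>A\<^esub>,
     ring.add = (\<lambda>x y. \<Union>(a, s)\<in>x. \<Union>(b, t)\<in>y.
       fraction A S ((a \<otimes>\<^bsub>A\<^esub> t) \<oplus>\<^bsub>A\<^esub> (b \<otimes>\<^bsub>A\<^esub> s)) (s \<otimes>\<^bsub>A\<^esub> t))\<rparr>"

definition regular_elements :: "('a, 'b) ring_scheme \<Rightarrow> 'a set" where
  "regular_elements A =
     {s \<in> carrier A. \<forall>a\<in>carrier A. s \<otimes>\<^bsub>A\<^esub> a = \<zero>\<^bsub>A\<^esub> \<longrightarrow> a = \<zero>\<^bsub>A\<^esub>}"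

definition total_fractions :: "('a, 'b) ring_scheme \<Rightarrow> ('a \<times> 'a) set ring" where
  "total_fractions A = localization A (regular_elements A)"

definition nilradical :: "('a, 'b) ring_scheme \<Rightarrow> 'a set" where
  "nilradical A = {a \<in> carrier A. \<exists>n::nat. a [^]\<^bsub>A\<^esub> n = \<zero>\<^bsub>A\<^esub>}"

definition reduction :: "('a, 'b) ring_scheme \<Rightarrow> 'a set ring" where
  "reduction A = A Quot (nilradical A)"

text \<open>Polynomials in \<open>HOL-Algebra\<close> are coefficient lists with the leading coefficient first, so
  \<open>\<one> # p\<close> is monic.\<close>

definition integral_closure :: "('a, 'b) ring_scheme \<Rightarrow> 'a set \<Rightarrow> 'a set" where
  "integral_closure Q A =
     {x \<in> carrier Q. \<exists>p. set p \<subseteq> A \<and> ring.eval Q (\<one>\<^bsub>Q\<^esub> # p) x = \<zero>\<^bsub>Q\<^esub>}"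

definition to_total_fractions :: "('a, 'b) ring_scheme \<Rightarrow> 'a \<Rightarrow> ('a \<times> 'a) set" where
  "to_total_fractions A a = fraction A (regular_elements A) a \<one>\<^bsub>A\<^esub>"

definition normalization_ring :: "('a, 'b) ring_scheme \<Rightarrow> ('a set \<times> 'a set) set ring" where
  "normalization_ring A =
     (total_fractions (reduction A))
       \<lparr>carrier := integral_closure (total_fractions (reduction A))
          (to_total_fractions (reduction A) ` carrier (reduction A))\<rparr>"

definition to_normalization :: "('a, 'b) ring_scheme \<Rightarrow> 'a \<Rightarrow> ('a set \<times> 'a set) set" where
  "to_normalization A a = to_total_fractions (reduction A) (nilradical A +>\<^bsub>A\<^esub> a)"


section \<open>Tensor products of commutative algebras\<close>

text \<open>\<open>\<int>[A \<times> B]\<close>, the monoid ring of the multiplicative monoid \<open>A \<times> B\<close>: the free abelian group on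
  the symbols \<open>(a, b)\<close> with the biadditive product such that \<open>(a, b) (a', b') = (a a', b b')\<close>.\<close>

definition pair_ring ::
    "('a, 'c) ring_scheme \<Rightarrow> ('b, 'd) ring_scheme \<Rightarrow> (('a \<times> 'b) \<Rightarrow>\<^sub>0 int) ring" where
  "pair_ring A B = \<lparr>
     carrier = {p. Poly_Mapping.keys p \<subseteq> carrier A \<times> carrier B},
     monoid.mult = (\<lambda>p q. frag_extend (\<lambda>(a, b). frag_extend (\<lambda>(a', b').
               frag_of (a \<otimes>\<^bsub>A\<^esub> a', b \<otimes>\<^bsub>B\<^esub> b')) q) p),
     one = frag_of (\<one>\<^bsub>A\<^esub>, \<one>\<^bsub>B\<^esub>),
     ring.zero = 0,
     ring.add = (+)\<rparr>"

text \<open>\<open>A\<close> and \<open>B\<close> are regarded as \<open>R\<close>-algebras by means of ring homomorphisms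
  \<open>\<phi> : R \<rightarrow> A\<close> and \<open>\<psi> : R \<rightarrow> B\<close>.\<close>

definition tensor_relations ::
    "('r, 'e) ring_scheme \<Rightarrow> ('a, 'c) ring_scheme \<Rightarrow> ('r \<Rightarrow> 'a)
      \<Rightarrow> ('b, 'd) ring_scheme \<Rightarrow> ('r \<Rightarrow> 'b) \<Rightarrow> (('a \<times> 'b) \<Rightarrow>\<^sub>0 int) set" where
  "tensor_relations R A \<phi> B \<psi> =
     {frag_of (a \<oplus>\<^bsub>A\<^esub> a', b) - frag_of (a, b) - frag_of (a', b) | a a' b.
        a \<in> carrier A \<and> a' \<in> carrier A \<and> b \<in> carrier B} \<union>
     {frag_of (a, b \<oplus>\<^bsub>B\<^esub> b') - frag_of (a, b) - frag_of (a, b') | a b b'.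
        a \<in> carrier A \<and> b \<in> carrier B \<and> b' \<in> carrier B} \<union>
     {frag_of (\<phi> r \<otimes>\<^bsub>A\<^esub> a, b) - frag_of (a, \<psi> r \<otimes>\<^bsub>B\<^esub> b) | r a b.
        r \<in> carrier R \<and> a \<in> carrier A \<and> b \<in> carrier B}"

definition tensor_ring ::
    "('r, 'e) ring_scheme \<Rightarrow> ('a, 'c) ring_scheme \<Rightarrow> ('r \<Rightarrow> 'a)
      \<Rightarrow> ('b, 'd) ring_scheme \<Rightarrow> ('r \<Rightarrow> 'b) \<Rightarrow> (('a \<times> 'b) \<Rightarrow>\<^sub>0 int) set ring" where
  "tensor_ring R A \<phi> B \<psi> =
     pair_ring A B Quot (Idl\<^bsub>pair_ring A B\<^esub> (tensor_relations R A \<phi> B \<psi>))"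

text \<open>The map \<open>A \<otimes> B \<rightarrow> C\<close> sending \<open>a \<otimes> b\<close> to \<open>f a \<cdot> g b\<close>, for ring homomorphisms \<open>f : A \<rightarrow> C\<close> and
  \<open>g : B \<rightarrow> C\<close> that agree on \<open>R\<close>. An element \<open>c\<close> of the tensor product is a coset, on all
  representatives of which the sum takes the same value.\<close>

definition tensor_lift ::
    "('c, 'm) ring_scheme \<Rightarrow> ('a \<Rightarrow> 'c) \<Rightarrow> ('b \<Rightarrow> 'c) \<Rightarrow> (('a \<times> 'b) \<Rightarrow>\<^sub>0 int) set \<Rightarrow> 'c" where
  "tensor_lift C f g c = the_elem
     ((\<lambda>p. \<Oplus>\<^bsub>C\<^esub>x\<in>Poly_Mapping.keys p.
        [Poly_Mapping.lookup p x] \<cdot>\<^bsub>C\<^esub> (f (fst x) \<otimes>\<^bsub>C\<^esub> g (snd x))) ` c)"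


section \<open>Ringed spaces and affine schemes\<close>

record ('p, 's) ringed_space =
  points :: "'p topology"
  sections :: "'p set \<Rightarrow> 's ring"
  restriction :: "'p set \<Rightarrow> 'p set \<Rightarrow> 's \<Rightarrow> 's"

text \<open>A morphism \<open>M \<rightarrow> N\<close> consists of a map \<open>h\<close> on points and, for every open \<open>U\<close> in \<open>N\<close>, of a map
  \<open>H U\<close> from the sections of \<open>N\<close> over \<open>U\<close> to the sections of \<open>M\<close> over \<open>h\<inverse>(U)\<close>.\<close>

type_synonym ('p, 's, 'q, 't) rs_map = "('p \<Rightarrow> 'q) \<times> ('q set \<Rightarrow> 't \<Rightarrow> 's)"

definition open_preimage :: "('p, 's) ringed_space \<Rightarrow> ('p \<Rightarrow> 'q) \<Rightarrow> 'q set \<Rightarrow> 'p set" where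
  "open_preimage M h U = {x \<in> topspace (points M). h x \<in> U}"

definition rs_comp ::
    "('q, 't) ringed_space \<Rightarrow> ('q, 't, 'r, 'u) rs_map \<Rightarrow> ('p, 's, 'q, 't) rs_map
      \<Rightarrow> ('p, 's, 'r, 'u) rs_map" where
  "rs_comp Y k h = (fst k \<circ> fst h, \<lambda>U s. snd h (open_preimage Y (fst k) U) (snd k U s))"

definition rs_map_eq ::
    "('p, 's) ringed_space \<Rightarrow> ('q, 't) ringed_space
      \<Rightarrow> ('p, 's, 'q, 't) rs_map \<Rightarrow> ('p, 's, 'q, 't) rs_map \<Rightarrow> bool" where
  "rs_map_eq M N h k \<longleftrightarrow>
     (\<forall>x\<in>topspace (points M). fst h x = fst k x) \<and>
     (\<forall>U s. openin (points N) U \<and> s \<in> carrier (sections N U) \<longrightarrow> snd h U s = snd k U s)"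

text \<open>An isomorphism of schemes is the same as an isomorphism of the underlying ringed spaces: the
  induced maps on stalks are then isomorphisms, hence automatically local.\<close>

definition rs_iso ::
    "('p, 's) ringed_space \<Rightarrow> ('q, 't) ringed_space \<Rightarrow> ('p, 's, 'q, 't) rs_map \<Rightarrow> bool" where
  "rs_iso M N h \<longleftrightarrow>
     homeomorphic_map (points M) (points N) (fst h) \<and>
     (\<forall>U. openin (points N) U \<longrightarrow>
        snd h U \<in> ring_iso (sections N U) (sections M (open_preimage M (fst h) U))) \<and>
     (\<forall>U V s. openin (points N) U \<and> openin (points N) V \<and> V \<subseteq> U \<and> s \<in> carrier (sections N U) \<longrightarrow>
        restriction M (open_preimage M (fst h) U) (open_preimage M (fst h) V) (snd h U s) =
        snd h V (restriction N U V s))"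

definition prime_spectrum :: "('a, 'b) ring_scheme \<Rightarrow> 'a set set" where
  "prime_spectrum A = {p. primeideal p A}"

definition zariski_topology :: "('a, 'b) ring_scheme \<Rightarrow> 'a set topology" where
  "zariski_topology A =
     topology (\<lambda>U. \<exists>S\<subseteq>carrier A. U = {p \<in> prime_spectrum A. \<not> S \<subseteq> p})"

abbreviation stalk :: "('a, 'b) ring_scheme \<Rightarrow> 'a set \<Rightarrow> ('a \<times> 'a) set ring" where
  "stalk A p \<equiv> localization A (carrier A - p)"

abbreviation germ :: "('a, 'b) ring_scheme \<Rightarrow> 'a set \<Rightarrow> 'a \<Rightarrow> 'a \<Rightarrow> ('a \<times> 'a) set" where
  "germ A p a f \<equiv> fraction A (carrier A - p) a f"

text \<open>Sections of the structure sheaf over \<open>U\<close>: families of elements of the local rings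
  \<open>A\<^sub>p\<close>, for \<open>p\<close> in \<open>U\<close>, that are locally given by a single fraction.\<close>

definition structure_sheaf ::
    "('a, 'b) ring_scheme \<Rightarrow> 'a set set \<Rightarrow> ('a set \<Rightarrow> ('a \<times> 'a) set) ring" where
  "structure_sheaf A U = \<lparr>
     carrier = {s \<in> (\<Pi>\<^sub>E p\<in>U. carrier (stalk A p)).
       \<forall>p\<in>U. \<exists>V a f. openin (zariski_topology A) V \<and> p \<in> V \<and> V \<subseteq> U \<and>
         a \<in> carrier A \<and> f \<in> carrier A \<and> (\<forall>q\<in>V. f \<notin> q \<and> s q = germ A q a f)},
     monoid.mult = (\<lambda>s t. \<lambda>p\<in>U. s p \<otimes>\<^bsub>stalk A p\<^esub> t p),
     one = (\<lambda>p\<in>U. \<one>\<^bsub>stalk A p\<^esub>),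
     ring.zero = (\<lambda>p\<in>U. \<zero>\<^bsub>stalk A p\<^esub>),
     ring.add = (\<lambda>s t. \<lambda>p\<in>U. s p \<oplus>\<^bsub>stalk A p\<^esub> t p)\<rparr>"

definition Spec ::
    "('a, 'b) ring_scheme \<Rightarrow> ('a set, 'a set \<Rightarrow> ('a \<times> 'a) set) ringed_space" where
  "Spec A = \<lparr>
     points = zariski_topology A,
     sections = structure_sheaf A,
     restriction = (\<lambda>U V s. restrict s V)\<rparr>"

text \<open>The morphism \<open>Spec B \<rightarrow> Spec A\<close> given by a ring homomorphism \<open>\<phi> : A \<rightarrow> B\<close>. On sections it is
  induced by the maps \<open>A\<^sub>p \<rightarrow> B\<^sub>q\<close>, \<open>a/t \<mapsto> \<phi>(a)/\<phi>(t)\<close>, where \<open>p = \<phi>\<inverse>(q)\<close>.\<close>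

definition prime_preimage :: "('a, 'c) ring_scheme \<Rightarrow> ('a \<Rightarrow> 'b) \<Rightarrow> 'b set \<Rightarrow> 'a set" where
  "prime_preimage A \<phi> q = {a \<in> carrier A. \<phi> a \<in> q}"

definition stalk_map ::
    "('b, 'd) ring_scheme \<Rightarrow> ('a \<Rightarrow> 'b) \<Rightarrow> 'b set \<Rightarrow> ('a \<times> 'a) set \<Rightarrow> ('b \<times> 'b) set" where
  "stalk_map B \<phi> q x = (\<Union>(a, t)\<in>x. germ B q (\<phi> a) (\<phi> t))"

definition Spec_map ::
    "('a, 'c) ring_scheme \<Rightarrow> ('b, 'd) ring_scheme \<Rightarrow> ('a \<Rightarrow> 'b)
      \<Rightarrow> ('b set, 'b set \<Rightarrow> ('b \<times> 'b) set, 'a set, 'a set \<Rightarrow> ('a \<times> 'a) set) rs_map" where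
  "Spec_map A B \<phi> =
     (prime_preimage A \<phi>,
      \<lambda>U s. \<lambda>q\<in>open_preimage (Spec B) (prime_preimage A \<phi>) U.
        stalk_map B \<phi> q (s (prime_preimage A \<phi> q)))"

text \<open>\<open>k : Y \<rightarrow> Spec A\<close> is the normalization of \<open>Spec A\<close>: up to an isomorphism over \<open>Spec A\<close> it is
  the spectrum of the integral closure of the reduction of \<open>A\<close> within its total ring of fractions.\<close>

definition is_normalization_of_Spec ::
    "('a, 'b) ring_scheme \<Rightarrow> ('p, 's) ringed_space
      \<Rightarrow> ('p, 's, 'a set, 'a set \<Rightarrow> ('a \<times> 'a) set) rs_map \<Rightarrow> bool" where
  "is_normalization_of_Spec A Y k \<longleftrightarrow>
     (\<exists>h. rs_iso Y (Spec (normalization_ring A)) h \<and>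
        rs_map_eq Y (Spec A)
          (rs_comp (Spec (normalization_ring A))
             (Spec_map A (normalization_ring A) (to_normalization A)) h)
          k)"


section \<open>Linear representations and quotient schemes\<close>

type_synonym 'k mpoly = "(nat \<Rightarrow>\<^sub>0 nat) \<Rightarrow>\<^sub>0 'k"

definition pvar :: "nat \<Rightarrow> 'k::field mpoly" where
  "pvar i = Poly_Mapping.single (Poly_Mapping.single i 1) 1"

definition pconst :: "'k \<Rightarrow> 'k::field mpoly" where
  "pconst c = Poly_Mapping.single 0 c"

definition psubst :: "(nat \<Rightarrow> 'k mpoly) \<Rightarrow> 'k mpoly \<Rightarrow> 'k::field mpoly" where
  "psubst \<sigma> p = (\<Sum>e\<in>Poly_Mapping.keys p. pconst (Poly_Mapping.lookup p e) *
     (\<Prod>i\<in>Poly_Mapping.keys e. \<sigma> i ^ Poly_Mapping.lookup e i))"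

definition GL :: "nat \<Rightarrow> 'k::field mat monoid" where
  "GL n = units_of (ring_mat TYPE('k) n ())"

definition rep_sum :: "('g \<Rightarrow> 'k::field mat) \<Rightarrow> ('g \<Rightarrow> 'k mat) \<Rightarrow> 'g \<Rightarrow> 'k mat" where
  "rep_sum \<rho> \<sigma> g = diag_block_mat [\<rho> g, \<sigma> g]"

text \<open>A matrix \<open>M\<close> acts on affine space by \<open>v \<mapsto> M v\<close> and on polynomial functions by
  \<open>f(v) \<mapsto> f(M v)\<close>.\<close>

definition linear_action :: "'k mat \<Rightarrow> 'k mpoly \<Rightarrow> 'k::field mpoly" where
  "linear_action M = psubst (\<lambda>i. \<Sum>j<dim_col M. pconst (M $$ (i, j)) * pvar j)"

text \<open>The ring of invariants of an \<open>n\<close>-dimensional representation in \<open>K[x\<^sub>0, \<dots>, x\<^sub>n\<^sub>-\<^sub>1]\<close>.\<close>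

definition invariant_ring ::
    "('g, 'z) monoid_scheme \<Rightarrow> nat \<Rightarrow> ('g \<Rightarrow> 'k mat) \<Rightarrow> 'k::field mpoly ring" where
  "invariant_ring G n \<sigma> = \<lparr>
     carrier = {p. (\<forall>e\<in>Poly_Mapping.keys p. Poly_Mapping.keys e \<subseteq> {..<n}) \<and>
                   (\<forall>g\<in>carrier G. linear_action (\<sigma> g) p = p)},
     monoid.mult = (*), one = 1, ring.zero = 0, ring.add = (+)\<rparr>"

text \<open>The coordinate ring of \<open>Z\<^sub>\<rho> = (\<A>\<^sup>d \<times> \<A>\<^sup>m) / (\<beta> \<times> \<rho>)\<close>. The variables with index below \<open>d\<close> are
  \<open>X\<^sub>1, \<dots>, X\<^sub>d\<close>, the following \<open>m\<close> ones are \<open>W\<^sub>1, \<dots>, W\<^sub>m\<close>; so the invariant ring \<open>R\<close> of \<open>\<beta>\<close> is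
  literally contained in it.\<close>

definition quotient_ring ::
    "('g, 'z) monoid_scheme \<Rightarrow> nat \<Rightarrow> ('g \<Rightarrow> 'k mat) \<Rightarrow> nat \<Rightarrow> ('g \<Rightarrow> 'k mat)
      \<Rightarrow> 'k::field mpoly ring" where
  "quotient_ring G d \<beta> m \<rho> = invariant_ring G (d + m) (rep_sum \<beta> \<rho>)"

definition quotient_scheme ::
    "('g, 'z) monoid_scheme \<Rightarrow> nat \<Rightarrow> ('g \<Rightarrow> 'k mat) \<Rightarrow> nat \<Rightarrow> ('g \<Rightarrow> 'k mat)
      \<Rightarrow> ('k mpoly set, 'k mpoly set \<Rightarrow> ('k mpoly \<times> 'k::field mpoly) set) ringed_space" where
  "quotient_scheme G d \<beta> m \<rho> = Spec (quotient_ring G d \<beta> m \<rho>)"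

text \<open>The coordinate ring of \<open>Z\<^sub>\<rho>\<^sub>1 \<times> Z\<^sub>\<rho>\<^sub>2\<close> over \<open>Spec R\<close>.\<close>

definition fibre_product_ring ::
    "('g, 'z) monoid_scheme \<Rightarrow> nat \<Rightarrow> ('g \<Rightarrow> 'k mat) \<Rightarrow> nat \<Rightarrow> ('g \<Rightarrow> 'k mat)
      \<Rightarrow> nat \<Rightarrow> ('g \<Rightarrow> 'k mat) \<Rightarrow> (('k mpoly \<times> 'k::field mpoly) \<Rightarrow>\<^sub>0 int) set ring" where
  "fibre_product_ring G d \<beta> m1 \<rho>1 m2 \<rho>2 =
     tensor_ring (invariant_ring G d \<beta>)
       (quotient_ring G d \<beta> m1 \<rho>1) (\<lambda>r. r) (quotient_ring G d \<beta> m2 \<rho>2) (\<lambda>r. r)"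

text \<open>Pullback of functions along the projections of \<open>\<A>\<^sup>d \<times> \<A>\<^sup>m\<^sup>1 \<times> \<A>\<^sup>m\<^sup>2\<close> to \<open>\<A>\<^sup>d \<times> \<A>\<^sup>m\<^sup>1\<close> and to
  \<open>\<A>\<^sup>d \<times> \<A>\<^sup>m\<^sup>2\<close>. The first is the inclusion of polynomial rings, the second has to skip the \<open>m1\<close>
  variables of the middle factor.\<close>

definition pullback1 :: "'k mpoly \<Rightarrow> 'k::field mpoly" where
  "pullback1 p = p"

definition pullback2 :: "nat \<Rightarrow> nat \<Rightarrow> 'k mpoly \<Rightarrow> 'k::field mpoly" where
  "pullback2 d m1 = psubst (\<lambda>i. pvar (if i < d then i else m1 + i))"

definition natural_morphism ::
    "('g, 'z) monoid_scheme \<Rightarrow> nat \<Rightarrow> ('g \<Rightarrow> 'k mat) \<Rightarrow> nat \<Rightarrow> ('g \<Rightarrow> 'k mat)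
      \<Rightarrow> nat \<Rightarrow> ('g \<Rightarrow> 'k mat)
      \<Rightarrow> ('k mpoly set, 'k mpoly set \<Rightarrow> ('k mpoly \<times> 'k mpoly) set,
          (('k mpoly \<times> 'k mpoly) \<Rightarrow>\<^sub>0 int) set set,
          (('k mpoly \<times> 'k mpoly) \<Rightarrow>\<^sub>0 int) set set \<Rightarrow>
            ((('k mpoly \<times> 'k mpoly) \<Rightarrow>\<^sub>0 int) set \<times>
             (('k mpoly \<times> 'k::field mpoly) \<Rightarrow>\<^sub>0 int) set) set) rs_map" where
  "natural_morphism G d \<beta> m1 \<rho>1 m2 \<rho>2 =
     (let C = quotient_ring G d \<beta> (m1 + m2) (rep_sum \<rho>1 \<rho>2)
      in Spec_map (fibre_product_ring G d \<beta> m1 \<rho>1 m2 \<rho>2) C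
           (tensor_lift C pullback1 (pullback2 d m1)))"

end

theory Submission
  imports Defs "HOL-Computational_Algebra.Polynomial_Factorial"
begin


text \<open>Let \<open>R = K[X]\<^sup>G\<close>, \<open>B1 = K[X, W]\<^sup>G\<close>, \<open>B2 = K[X, V]\<^sup>G\<close> and \<open>C = K[X, W, V]\<^sup>G\<close>, where \<open>G\<close> acts
  on the variables \<open>X\<close>, \<open>W\<close>, \<open>V\<close> by \<open>\<beta>\<close>, \<open>\<rho>1\<close>, \<open>\<rho>2\<close> (the indices of the variables \<open>X\<close> form the set
  \<open>U\<close> below). Put \<open>T = B1 \<otimes>\<^sub>R B2\<close> and let \<open>\<phi> : T \<rightarrow> C\<close> be the
  multiplication map, which induces the natural morphism. The theorem says that \<open>\<phi>\<close> identifies \<open>C\<close>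
  with the integral closure of the reduction of \<open>T\<close> in its total ring of fractions. Since \<open>C\<close> is a
  domain, this follows from four properties of \<open>\<phi>\<close> (locale \<open>normalization_data\<close>); an isomorphism of
  rings induces one of spectra (\<open>rs_iso_Spec_map\<close>).

  \<^item> The kernel of \<open>\<phi>\<close> consists of nilpotent elements (\<open>kernel_nilpotent\<close>). Since \<open>K\<close> is a field, \<open>B1 \<otimes>\<^sub>K B2\<close> is a ring of
    polynomials in \<open>X\<close>, \<open>W\<close>, a second copy \<open>Y\<close> of \<open>X\<close>, and \<open>V\<close>; it maps onto \<open>T\<close>, and \<open>\<phi>\<close> becomes
    the substitution \<open>Y = X\<close>. If \<open>z\<close> in this ring vanishes for \<open>Y = X\<close>, then so do its conjugates
    under the action of \<open>G\<close> on \<open>Y\<close> alone (\<open>spec_conjugate\<close>). The product of all \<open>t - z\<^sub>h\<close>, where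
    \<open>z\<^sub>h\<close> runs through these conjugates, is a monic equation for \<open>z\<close> whose lower coefficients vanish
    for \<open>Y = X\<close>. They lie in \<open>B1 \<otimes>\<^sub>K K[Y]\<^sup>G \<otimes>\<^sub>K K[V]\<^sup>G\<close> (\<open>twisted_coeffs_invariant\<close>,
    \<open>invariants_product\<close>), and in \<open>T\<close> such an element depends only on its value at \<open>Y = X\<close>, because
    factors from \<open>K[Y]\<^sup>G = R\<close> can be moved across the tensor sign (\<open>determined_on_diagonal\<close>). So the
    equation becomes \<open>t\<^sup>n = 0\<close> in \<open>T\<close>.

  \<^item> \<open>C\<close> is integral over the image of \<open>\<phi>\<close> (\<open>C_integral\<close>): the product of all \<open>t - c\<^sub>h\<close>, where now \<open>c\<^sub>h\<close>
    runs through the conjugates of \<open>c\<close> under the action of \<open>G\<close> on \<open>V\<close> alone, has coefficients in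
    \<open>B1 \<otimes>\<^sub>K K[V]\<^sup>G\<close>.

  \<^item> \<open>C\<close> lies in the quotient field of the image of \<open>\<phi>\<close> (\<open>common_denominator\<close>). As \<open>\<beta>\<close> is faithful,
    \<open>K(X)\<close> is a Galois extension of its invariants, and traces with respect to it express
    invariants in \<open>X\<close>, \<open>W\<close>, \<open>V\<close> by invariants in \<open>X\<close>, \<open>W\<close> and in \<open>X\<close>, \<open>V\<close>.

  \<^item> \<open>C\<close> is integrally closed, since the polynomial ring is: division by leading monomials shows that
    it is even completely integrally closed (\<open>polys_completely_integrally_closed\<close>).\<close>


section \<open>Rings of fractions\<close>

locale denominators = cring A for A (structure) +
  fixes S :: "'a set"
  assumes denominators_subset: "S \<subseteq> carrier A"
    and one_denominator: "\<one> \<in> S"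
    and mult_denominator: "\<And>s t. s \<in> S \<Longrightarrow> t \<in> S \<Longrightarrow> s \<otimes> t \<in> S"
begin

lemma denominator_closed: "s \<in> S \<Longrightarrow> s \<in> carrier A"
  using denominators_subset by blast

lemma fraction_relI:
  assumes "a \<in> carrier A" "s \<in> S" "b \<in> carrier A" "t \<in> S" "u \<in> S"
    and "u \<otimes> (t \<otimes> a) = u \<otimes> (s \<otimes> b)"
  shows "((a, s), (b, t)) \<in> fraction_rel A S"
  using assms by (auto simp: fraction_rel_def)

lemma fraction_relE:
  assumes "((a, s), (b, t)) \<in> fraction_rel A S"
  obtains u where "a \<in> carrier A" "s \<in> S" "b \<in> carrier A" "t \<in> S" "u \<in> S"
    "u \<otimes> (t \<otimes> a) = u \<otimes> (s \<otimes> b)"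
  using assms by (auto simp: fraction_rel_def)

lemma equiv_fraction_rel: "equiv (carrier A \<times> S) (fraction_rel A S)"
proof (rule equivI)
  show "fraction_rel A S \<subseteq> (carrier A \<times> S) \<times> (carrier A \<times> S)"
    by (auto simp: fraction_rel_def)
  show "refl_on (carrier A \<times> S) (fraction_rel A S)"
    using one_denominator by (auto simp: refl_on_def fraction_rel_def)
  show "sym (fraction_rel A S)"
    unfolding sym_def fraction_rel_def by clarsimp metis
  show "trans (fraction_rel A S)"
  proof (rule transI)
    fix x y z assume xy: "(x, y) \<in> fraction_rel A S" and yz: "(y, z) \<in> fraction_rel A S"
    obtain a s b t c w where x: "x = (a, s)" and y: "y = (b, t)" and z: "z = (c, w)"
      by (metis surj_pair)
    from xy x y obtain u where u: "a \<in> carrier A" "s \<in> S" "b \<in> carrier A" "t \<in> S" "u \<in> S"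
      "u \<otimes> (t \<otimes> a) = u \<otimes> (s \<otimes> b)" by (auto elim: fraction_relE)
    from yz y z obtain v where v: "c \<in> carrier A" "w \<in> S" "v \<in> S"
      "v \<otimes> (w \<otimes> b) = v \<otimes> (t \<otimes> c)" by (auto elim: fraction_relE)
    note [simp] = denominator_closed u(1-5) v(1-3)
    have "(u \<otimes> (v \<otimes> t)) \<otimes> (w \<otimes> a) = (v \<otimes> w) \<otimes> (u \<otimes> (t \<otimes> a))"
      by (simp add: m_ac)
    also have "\<dots> = (u \<otimes> s) \<otimes> (v \<otimes> (w \<otimes> b))"
      by (simp add: u(6)) (simp add: m_ac)
    also have "\<dots> = (u \<otimes> (v \<otimes> t)) \<otimes> (s \<otimes> c)"
      by (simp add: v(4)) (simp add: m_ac)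
    finally show "(x, z) \<in> fraction_rel A S"
      unfolding x z using u v by (intro fraction_relI) (auto simp: mult_denominator)
  qed
qed

lemma fraction_eq_iff:
  assumes "a \<in> carrier A" "s \<in> S" "b \<in> carrier A" "t \<in> S"
  shows "fraction A S a s = fraction A S b t \<longleftrightarrow> ((a, s), (b, t)) \<in> fraction_rel A S"
  unfolding fraction_def using eq_equiv_class_iff[OF equiv_fraction_rel] assms by auto

lemma fraction_closed:
  "a \<in> carrier A \<Longrightarrow> s \<in> S \<Longrightarrow> fraction A S a s \<in> carrier (localization A S)"
  by (auto simp: fraction_def localization_def intro: quotientI)

lemma carrier_localizationE:
  assumes "x \<in> carrier (localization A S)"
  obtains a s where "a \<in> carrier A" "s \<in> S" "x = fraction A S a s"
  using assms by (auto simp: fraction_def localization_def elim!: quotientE)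

lemma localization_mult:
  assumes "a \<in> carrier A" "s \<in> S" "b \<in> carrier A" "t \<in> S"
  shows "fraction A S a s \<otimes>\<^bsub>localization A S\<^esub> fraction A S b t = fraction A S (a \<otimes> b) (s \<otimes> t)"
proof -
  have "congruent2 (fraction_rel A S) (fraction_rel A S)
     (\<lambda>(a, s) (b, t). fraction A S (a \<otimes> b) (s \<otimes> t))"
  proof (rule congruent2_commuteI[OF equiv_fraction_rel])
    show "(case y of (a, s) \<Rightarrow> \<lambda>(b, t). fraction A S (a \<otimes> b) (s \<otimes> t)) z =
          (case z of (a, s) \<Rightarrow> \<lambda>(b, t). fraction A S (a \<otimes> b) (s \<otimes> t)) y"
      if "y \<in> carrier A \<times> S" "z \<in> carrier A \<times> S" for y z
      using that by (auto simp: m_comm denominator_closed)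
    show "(case w of (a, s) \<Rightarrow> \<lambda>(b, t). fraction A S (a \<otimes> b) (s \<otimes> t)) y =
          (case w of (a, s) \<Rightarrow> \<lambda>(b, t). fraction A S (a \<otimes> b) (s \<otimes> t)) z"
      if w: "w \<in> carrier A \<times> S" and yz: "(y, z) \<in> fraction_rel A S" for w y z
    proof -
      obtain c r a s b t where e: "w = (c, r)" "y = (a, s)" "z = (b, t)" by (metis surj_pair)
      from yz e obtain u where u: "a \<in> carrier A" "s \<in> S" "b \<in> carrier A" "t \<in> S" "u \<in> S"
        "u \<otimes> (t \<otimes> a) = u \<otimes> (s \<otimes> b)" by (auto elim: fraction_relE)
      have cr: "c \<in> carrier A" "r \<in> S" using w e by auto
      note [simp] = denominator_closed u(1-5) cr
      have "u \<otimes> ((r \<otimes> t) \<otimes> (c \<otimes> a)) = (r \<otimes> c) \<otimes> (u \<otimes> (t \<otimes> a))"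
        by (simp add: m_ac)
      also have "\<dots> = u \<otimes> ((r \<otimes> s) \<otimes> (c \<otimes> b))"
        by (simp add: u(6)) (simp add: m_ac)
      finally show ?thesis
        by (auto simp: e mult_denominator fraction_eq_iff intro!: fraction_relI[of _ _ _ _ u])
    qed
  qed
  from UN_equiv_class2[OF equiv_fraction_rel equiv_fraction_rel this, of "(a, s)" "(b, t)"] assms
  show ?thesis by (simp add: localization_def fraction_def split_def)
qed

lemma localization_add:
  assumes "a \<in> carrier A" "s \<in> S" "b \<in> carrier A" "t \<in> S"
  shows "fraction A S a s \<oplus>\<^bsub>localization A S\<^esub> fraction A S b t =
    fraction A S ((a \<otimes> t) \<oplus> (b \<otimes> s)) (s \<otimes> t)"
proof -
  have "congruent2 (fraction_rel A S) (fraction_rel A S)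
     (\<lambda>(a, s) (b, t). fraction A S ((a \<otimes> t) \<oplus> (b \<otimes> s)) (s \<otimes> t))"
  proof (rule congruent2_commuteI[OF equiv_fraction_rel])
    show "(case y of (a, s) \<Rightarrow> \<lambda>(b, t). fraction A S ((a \<otimes> t) \<oplus> (b \<otimes> s)) (s \<otimes> t)) z =
          (case z of (a, s) \<Rightarrow> \<lambda>(b, t). fraction A S ((a \<otimes> t) \<oplus> (b \<otimes> s)) (s \<otimes> t)) y"
      if "y \<in> carrier A \<times> S" "z \<in> carrier A \<times> S" for y z
      using that by (auto simp: m_comm a_comm denominator_closed)
    show "(case w of (a, s) \<Rightarrow> \<lambda>(b, t). fraction A S ((a \<otimes> t) \<oplus> (b \<otimes> s)) (s \<otimes> t)) y =
          (case w of (a, s) \<Rightarrow> \<lambda>(b, t). fraction A S ((a \<otimes> t) \<oplus> (b \<otimes> s)) (s \<otimes> t)) z"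
      if w: "w \<in> carrier A \<times> S" and yz: "(y, z) \<in> fraction_rel A S" for w y z
    proof -
      obtain c r a s b t where e: "w = (c, r)" "y = (a, s)" "z = (b, t)" by (metis surj_pair)
      from yz e obtain u where u: "a \<in> carrier A" "s \<in> S" "b \<in> carrier A" "t \<in> S" "u \<in> S"
        "u \<otimes> (t \<otimes> a) = u \<otimes> (s \<otimes> b)" by (auto elim: fraction_relE)
      have cr: "c \<in> carrier A" "r \<in> S" using w e by auto
      note [simp] = denominator_closed u(1-5) cr
      have "u \<otimes> ((r \<otimes> t) \<otimes> (c \<otimes> s \<oplus> a \<otimes> r)) =
            u \<otimes> ((r \<otimes> t) \<otimes> (c \<otimes> s)) \<oplus> (r \<otimes> r) \<otimes> (u \<otimes> (t \<otimes> a))"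
        by (simp add: r_distr l_distr m_ac)
      also have "\<dots> = u \<otimes> ((r \<otimes> s) \<otimes> (c \<otimes> t \<oplus> b \<otimes> r))"
        by (simp add: u(6)) (simp add: r_distr l_distr m_ac)
      finally show ?thesis
        by (auto simp: e mult_denominator fraction_eq_iff intro!: fraction_relI[of _ _ _ _ u])
    qed
  qed
  from UN_equiv_class2[OF equiv_fraction_rel equiv_fraction_rel this, of "(a, s)" "(b, t)"] assms
  show ?thesis by (simp add: localization_def fraction_def split_def)
qed

lemma localization_one: "\<one>\<^bsub>localization A S\<^esub> = fraction A S \<one> \<one>"
  by (simp add: localization_def)

lemma localization_zero: "\<zero>\<^bsub>localization A S\<^esub> = fraction A S \<zero> \<one>"
  by (simp add: localization_def)

lemmas localization_simps =
  localization_mult localization_add localization_one localization_zero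

lemma localization_closed:
  assumes "x \<in> carrier (localization A S)" "y \<in> carrier (localization A S)"
  shows "x \<otimes>\<^bsub>localization A S\<^esub> y \<in> carrier (localization A S)"
    and "x \<oplus>\<^bsub>localization A S\<^esub> y \<in> carrier (localization A S)"
  using assms
  by (auto elim!: carrier_localizationE
      simp: localization_simps denominator_closed mult_denominator intro!: fraction_closed)

end

lemma denominators_compl_prime:
  assumes "primeideal p A" shows "denominators A (carrier A - p)"
proof -
  interpret primeideal p A by fact
  show ?thesis
    using I_notcarr one_imp_carrier I_prime by unfold_locales auto
qed

lemma (in ring_hom_cring) fraction_map:
  assumes "denominators R D" and "denominators S D'" and D: "h ` D \<subseteq> D'"
    and "a \<in> carrier R" "t \<in> D"
  shows "(\<Union>(a, t)\<in>fraction R D a t. fraction S D' (h a) (h t)) = fraction S D' (h a) (h t)"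
proof -
  interpret R': denominators R D by fact
  interpret S': denominators S D' by fact
  have "congruent (fraction_rel R D) (\<lambda>(a, t). fraction S D' (h a) (h t))"
  proof (rule congruentI, clarify)
    fix a s b t assume "((a, s), (b, t)) \<in> fraction_rel R D"
    then obtain u where u: "a \<in> carrier R" "s \<in> D" "b \<in> carrier R" "t \<in> D" "u \<in> D"
        "u \<otimes> (t \<otimes> a) = u \<otimes> (s \<otimes> b)" by (auto elim: R'.fraction_relE)
    note [simp] = R'.denominator_closed u(1-5)
    have "h (u \<otimes> (t \<otimes> a)) = h (u \<otimes> (s \<otimes> b))" by (simp only: u(6))
    then have *: "h u \<otimes>\<^bsub>S\<^esub> (h t \<otimes>\<^bsub>S\<^esub> h a) = h u \<otimes>\<^bsub>S\<^esub> (h s \<otimes>\<^bsub>S\<^esub> h b)" by simp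
    have "h u \<in> D'" "h s \<in> D'" "h t \<in> D'" using D u by blast+
    then show "fraction S D' (h a) (h s) = fraction S D' (h b) (h t)"
      by (subst S'.fraction_eq_iff) (use * in \<open>auto intro: S'.fraction_relI\<close>)
  qed
  from UN_equiv_class[OF R'.equiv_fraction_rel this, of "(a, t)"] assms
  show ?thesis by (simp add: fraction_def)
qed

section \<open>The spectrum as a functor\<close>

text \<open>The intersection of two such sets belongs to the products of the elements of both sets \<open>S\<close>,
  because the points are prime ideals.\<close>

lemma openin_zariski_topology:
  "openin (zariski_topology A) U \<longleftrightarrow> (\<exists>S\<subseteq>carrier A. U = {p \<in> prime_spectrum A. \<not> S \<subseteq> p})"
proof -
  have "istopology (\<lambda>U. \<exists>S\<subseteq>carrier A. U = {p \<in> prime_spectrum A. \<not> S \<subseteq> p})"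
    unfolding istopology_def
  proof (intro conjI allI impI)
    fix U V
    assume "\<exists>S\<subseteq>carrier A. U = {p \<in> prime_spectrum A. \<not> S \<subseteq> p}"
      and "\<exists>S\<subseteq>carrier A. V = {p \<in> prime_spectrum A. \<not> S \<subseteq> p}"
    then obtain S T where S: "S \<subseteq> carrier A" "U = {p \<in> prime_spectrum A. \<not> S \<subseteq> p}"
      and T: "T \<subseteq> carrier A" "V = {p \<in> prime_spectrum A. \<not> T \<subseteq> p}" by blast
    let ?W = "{s \<otimes>\<^bsub>A\<^esub> t | s t. s \<in> S \<and> t \<in> T \<and> s \<otimes>\<^bsub>A\<^esub> t \<in> carrier A}"
    have "?W \<subseteq> p \<longleftrightarrow> S \<subseteq> p \<or> T \<subseteq> p" if "p \<in> prime_spectrum A" for p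
    proof -
      interpret primeideal p A using that by (simp add: prime_spectrum_def)
      show ?thesis
      proof
        assume W: "?W \<subseteq> p"
        show "S \<subseteq> p \<or> T \<subseteq> p"
        proof (rule ccontr)
          assume "\<not> (S \<subseteq> p \<or> T \<subseteq> p)"
          then obtain s t where "s \<in> S" "s \<notin> p" "t \<in> T" "t \<notin> p" by blast
          then show False using W S(1) T(1) I_prime[of s t] by blast
        qed
      next
        assume "S \<subseteq> p \<or> T \<subseteq> p"
        then show "?W \<subseteq> p" using S(1) T(1) I_l_closed I_r_closed by blast
      qed
    qed
    then have "U \<inter> V = {p \<in> prime_spectrum A. \<not> ?W \<subseteq> p}" using S T by blast
    then show "\<exists>S\<subseteq>carrier A. U \<inter> V = {p \<in> prime_spectrum A. \<not> S \<subseteq> p}"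
      by (intro exI[of _ ?W]) auto
  next
    fix \<K> assume "\<forall>U\<in>\<K>. \<exists>S\<subseteq>carrier A. U = {p \<in> prime_spectrum A. \<not> S \<subseteq> p}"
    then obtain f where f: "\<And>U. U \<in> \<K> \<Longrightarrow> f U \<subseteq> carrier A"
      "\<And>U. U \<in> \<K> \<Longrightarrow> U = {p \<in> prime_spectrum A. \<not> f U \<subseteq> p}" by metis
    have "\<Union>\<K> = {p \<in> prime_spectrum A. \<not> \<Union>(f ` \<K>) \<subseteq> p}"
    proof (intro equalityI subsetI)
      fix p assume "p \<in> \<Union>\<K>"
      then obtain U where "U \<in> \<K>" "p \<in> U" by blast
      then show "p \<in> {p \<in> prime_spectrum A. \<not> \<Union>(f ` \<K>) \<subseteq> p}" using f(2)[of U] by blast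
    next
      fix p assume "p \<in> {p \<in> prime_spectrum A. \<not> \<Union>(f ` \<K>) \<subseteq> p}"
      then obtain U where "U \<in> \<K>" "\<not> f U \<subseteq> p" "p \<in> prime_spectrum A" by blast
      then show "p \<in> \<Union>\<K>" using f(2)[of U] by blast
    qed
    then show "\<exists>S\<subseteq>carrier A. \<Union>\<K> = {p \<in> prime_spectrum A. \<not> S \<subseteq> p}"
      using f(1) by (intro exI[of _ "\<Union>(f ` \<K>)"]) auto
  qed
  then show ?thesis unfolding zariski_topology_def by (simp add: topology_inverse')
qed

lemma topspace_zariski_topology: "topspace (zariski_topology A) = prime_spectrum A"
proof
  show "topspace (zariski_topology A) \<subseteq> prime_spectrum A"
    unfolding topspace_def openin_zariski_topology by blast
  have "p \<in> topspace (zariski_topology A)" if p: "p \<in> prime_spectrum A" for p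
  proof -
    interpret primeideal p A using p by (simp add: prime_spectrum_def)
    have "openin (zariski_topology A) {p \<in> prime_spectrum A. \<not> carrier A \<subseteq> p}"
      unfolding openin_zariski_topology by blast
    moreover have "\<not> carrier A \<subseteq> p" using I_notcarr a_subset by blast
    ultimately show ?thesis using p unfolding topspace_def by blast
  qed
  then show "prime_spectrum A \<subseteq> topspace (zariski_topology A)" by blast
qed

lemma points_Spec [simp]: "points (Spec A) = zariski_topology A"
  and sections_Spec [simp]: "sections (Spec A) = structure_sheaf A"
  and restriction_Spec [simp]: "restriction (Spec A) U V s = restrict s V"
  by (simp_all add: Spec_def)

lemma open_preimage_Spec:
  "open_preimage (Spec A) f U = {q \<in> prime_spectrum A. f q \<in> U}"
  by (simp add: open_preimage_def topspace_zariski_topology)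

lemma structure_sheaf_memI:
  assumes "\<And>p. p \<in> U \<Longrightarrow> s p \<in> carrier (stalk A p)"
    and "\<And>p. p \<in> U \<Longrightarrow> \<exists>V a f. openin (zariski_topology A) V \<and> p \<in> V \<and> V \<subseteq> U \<and>
         a \<in> carrier A \<and> f \<in> carrier A \<and> (\<forall>q\<in>V. f \<notin> q \<and> s q = germ A q a f)"
    and "s \<in> extensional U"
  shows "s \<in> carrier (structure_sheaf A U)"
  using assms by (simp add: structure_sheaf_def PiE_def)

context ring_hom_cring
begin

lemma prime_preimage_prime:
  assumes "q \<in> prime_spectrum S"
  shows "prime_preimage R h q \<in> prime_spectrum R"
proof -
  show ?thesis using ring.primeideal_vimage[OF R.is_cring, of q] assms
    by (simp add: prime_spectrum_def prime_preimage_def)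
qed

lemma denominators_stalk:
  assumes "q \<in> prime_spectrum S"
  shows "denominators R (carrier R - prime_preimage R h q)" "denominators S (carrier S - q)"
  using assms prime_preimage_prime[OF assms]
  by (auto simp: prime_spectrum_def intro: denominators_compl_prime)

lemma stalk_map_germ:
  assumes "q \<in> prime_spectrum S" "a \<in> carrier R" "t \<in> carrier R" "t \<notin> prime_preimage R h q"
  shows "stalk_map S h q (germ R (prime_preimage R h q) a t) = germ S q (h a) (h t)"
  unfolding stalk_map_def
  by (rule fraction_map[OF denominators_stalk[OF assms(1)]])
     (use assms in \<open>auto simp: prime_preimage_def\<close>)

lemma stalk_map_hom:
  assumes q: "q \<in> prime_spectrum S"
  shows "stalk_map S h q \<in> ring_hom (stalk R (prime_preimage R h q)) (stalk S q)"
proof -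
  let ?p = "prime_preimage R h q"
  interpret R': denominators R "carrier R - ?p" by (rule denominators_stalk[OF q])
  interpret S': denominators S "carrier S - q" by (rule denominators_stalk[OF q])
  have h_notin: "h t \<in> carrier S - q" if "t \<in> carrier R - ?p" for t
    using that by (auto simp: prime_preimage_def)
  have germ: "stalk_map S h q (germ R ?p a t) = germ S q (h a) (h t)"
    if "a \<in> carrier R" "t \<in> carrier R - ?p" for a t
    using stalk_map_germ[OF q] that by simp
  show ?thesis
  proof (rule ring_hom_memI)
    fix x assume "x \<in> carrier (stalk R ?p)"
    then show "stalk_map S h q x \<in> carrier (stalk S q)"
      by (elim R'.carrier_localizationE) (use h_notin in \<open>auto simp: germ intro!: S'.fraction_closed\<close>)
  next
    fix x y assume x: "x \<in> carrier (stalk R ?p)" and y: "y \<in> carrier (stalk R ?p)"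
    obtain a s where x: "a \<in> carrier R" "s \<in> carrier R - ?p" "x = germ R ?p a s"
      using x by (elim R'.carrier_localizationE)
    obtain b t where y: "b \<in> carrier R" "t \<in> carrier R - ?p" "y = germ R ?p b t"
      using y by (elim R'.carrier_localizationE)
    note xy = x(1,2) y(1,2) h_notin[OF x(2)] h_notin[OF y(2)]
    have st: "s \<otimes>\<^bsub>R\<^esub> t \<in> carrier R - ?p" using x y R'.mult_denominator by blast
    show "stalk_map S h q (x \<otimes>\<^bsub>stalk R ?p\<^esub> y) =
        stalk_map S h q x \<otimes>\<^bsub>stalk S q\<^esub> stalk_map S h q y"
      unfolding x(3) y(3) using xy st by (simp add: R'.localization_mult S'.localization_mult germ)
    show "stalk_map S h q (x \<oplus>\<^bsub>stalk R ?p\<^esub> y) =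
        stalk_map S h q x \<oplus>\<^bsub>stalk S q\<^esub> stalk_map S h q y"
      unfolding x(3) y(3) using xy st by (simp add: R'.localization_add S'.localization_add germ)
  next
    show "stalk_map S h q \<one>\<^bsub>stalk R ?p\<^esub> = \<one>\<^bsub>stalk S q\<^esub>"
      using R'.one_denominator by (simp add: R'.localization_one S'.localization_one germ)
  qed
qed

lemma openin_prime_preimage:
  assumes "openin (zariski_topology R) U"
  shows "openin (zariski_topology S) (open_preimage (Spec S) (prime_preimage R h) U)"
proof -
  from assms obtain Y where Y: "Y \<subseteq> carrier R" "U = {p \<in> prime_spectrum R. \<not> Y \<subseteq> p}"
    by (auto simp: openin_zariski_topology)
  have "open_preimage (Spec S) (prime_preimage R h) U = {q \<in> prime_spectrum S. \<not> h ` Y \<subseteq> q}"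
    using Y prime_preimage_prime by (auto simp: open_preimage_Spec prime_preimage_def)
  then show ?thesis using Y by (auto simp: openin_zariski_topology intro!: exI[of _ "h ` Y"])
qed

lemma Spec_map_sections_hom:
  assumes U: "openin (zariski_topology R) U"
  shows "snd (Spec_map R S h) U \<in> ring_hom (structure_sheaf R U)
    (structure_sheaf S (open_preimage (Spec S) (prime_preimage R h) U))"
proof -
  let ?f = "prime_preimage R h"
  let ?U = "open_preimage (Spec S) ?f U"
  have U': "q \<in> prime_spectrum S" "?f q \<in> U" if "q \<in> ?U" for q
    using that by (auto simp: open_preimage_Spec)
  have s_in: "s (?f q) \<in> carrier (stalk R (?f q))"
    if "s \<in> carrier (structure_sheaf R U)" "q \<in> ?U" for s q
    using that U'(2) by (auto simp: structure_sheaf_def)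
  show ?thesis
  proof (rule ring_hom_memI)
    fix s assume s: "s \<in> carrier (structure_sheaf R U)"
    have "(\<lambda>q\<in>?U. stalk_map S h q (s (?f q))) \<in> carrier (structure_sheaf S ?U)"
    proof (rule structure_sheaf_memI)
      fix q assume q: "q \<in> ?U"
      show "(\<lambda>q\<in>?U. stalk_map S h q (s (?f q))) q \<in> carrier (stalk S q)"
        using ring_hom_closed[OF stalk_map_hom[OF U'(1)[OF q]] s_in[OF s q]] q by simp
      from s U'(2)[OF q] obtain V a f where V: "openin (zariski_topology R) V" "?f q \<in> V" "V \<subseteq> U"
        "a \<in> carrier R" "f \<in> carrier R" "\<And>p. p \<in> V \<Longrightarrow> f \<notin> p \<and> s p = germ R p a f"
        by (simp add: structure_sheaf_def) metis
      let ?V = "open_preimage (Spec S) ?f V"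
      have sub: "q \<in> ?V" "?V \<subseteq> ?U" using q V by (auto simp: open_preimage_Spec)
      have "h f \<notin> q' \<and> (\<lambda>q\<in>?U. stalk_map S h q (s (?f q))) q' = germ S q' (h a) (h f)"
        if "q' \<in> ?V" for q'
      proof -
        have q': "q' \<in> prime_spectrum S" "?f q' \<in> V" using that by (auto simp: open_preimage_Spec)
        have "q' \<in> ?U" using that sub by blast
        then show ?thesis using V(4,5) V(6)[OF q'(2)] stalk_map_germ[OF q'(1)]
          by (auto simp: prime_preimage_def)
      qed
      then show "\<exists>V a f. openin (zariski_topology S) V \<and> q \<in> V \<and> V \<subseteq> ?U \<and>
          a \<in> carrier S \<and> f \<in> carrier S \<and>
          (\<forall>q'\<in>V. f \<notin> q' \<and> (\<lambda>q\<in>?U. stalk_map S h q (s (?f q))) q' = germ S q' a f)"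
        using V(4,5) sub openin_prime_preimage[OF V(1)]
        by (intro exI[of _ ?V] exI[of _ "h a"] exI[of _ "h f"]) simp
    qed simp
    then show "snd (Spec_map R S h) U s \<in> carrier (structure_sheaf S ?U)"
      by (simp add: Spec_map_def)
  next
    fix s t assume s: "s \<in> carrier (structure_sheaf R U)" and t: "t \<in> carrier (structure_sheaf R U)"
    show "snd (Spec_map R S h) U (s \<otimes>\<^bsub>structure_sheaf R U\<^esub> t) =
      snd (Spec_map R S h) U s \<otimes>\<^bsub>structure_sheaf S ?U\<^esub> snd (Spec_map R S h) U t"
      using U'(2) ring_hom_mult[OF stalk_map_hom[OF U'(1)] s_in[OF s] s_in[OF t]]
      by (auto simp: Spec_map_def structure_sheaf_def intro!: restrict_ext)
    show "snd (Spec_map R S h) U (s \<oplus>\<^bsub>structure_sheaf R U\<^esub> t) =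
      snd (Spec_map R S h) U s \<oplus>\<^bsub>structure_sheaf S ?U\<^esub> snd (Spec_map R S h) U t"
      using U'(2) ring_hom_add[OF stalk_map_hom[OF U'(1)] s_in[OF s] s_in[OF t]]
      by (auto simp: Spec_map_def structure_sheaf_def intro!: restrict_ext)
  next
    show "snd (Spec_map R S h) U \<one>\<^bsub>structure_sheaf R U\<^esub> = \<one>\<^bsub>structure_sheaf S ?U\<^esub>"
      using U'(2) ring_hom_one[OF stalk_map_hom[OF U'(1)]]
      by (auto simp: Spec_map_def structure_sheaf_def intro!: restrict_ext)
  qed
qed

end

lemma structure_sheaf_in_stalk:
  assumes "s \<in> carrier (structure_sheaf A U)" "p \<in> U"
  shows "s p \<in> carrier (stalk A p)"
  using assms by (auto simp: structure_sheaf_def)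

lemma stalk_map_comp:
  assumes "ring_hom_cring A B f" and "ring_hom_cring B C g" and "ring_hom_cring A C k"
    and k: "\<And>a. a \<in> carrier A \<Longrightarrow> g (f a) = k a"
    and q: "q \<in> prime_spectrum C"
    and x: "x \<in> carrier (stalk A (prime_preimage A k q))"
  shows "prime_preimage A f (prime_preimage B g q) = prime_preimage A k q"
    and "stalk_map C g q (stalk_map B f (prime_preimage B g q) x) = stalk_map C k q x"
proof -
  interpret f: ring_hom_cring A B f by fact
  interpret g: ring_hom_cring B C g by fact
  interpret k: ring_hom_cring A C k by fact
  show eq: "prime_preimage A f (prime_preimage B g q) = prime_preimage A k q"
    using k by (auto simp: prime_preimage_def)
  interpret D: denominators A "carrier A - prime_preimage A k q" by (rule k.denominators_stalk[OF q])
  from x obtain a t where at: "a \<in> carrier A" "t \<in> carrier A - prime_preimage A k q"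
    "x = germ A (prime_preimage A k q) a t" by (elim D.carrier_localizationE)
  have "stalk_map B f (prime_preimage B g q) x = germ B (prime_preimage B g q) (f a) (f t)"
    using f.stalk_map_germ[OF g.prime_preimage_prime[OF q], of a t] at by (simp add: eq)
  moreover have "f t \<notin> prime_preimage B g q" using at k by (auto simp: prime_preimage_def)
  ultimately show "stalk_map C g q (stalk_map B f (prime_preimage B g q) x) = stalk_map C k q x"
    using at k.stalk_map_germ[OF q, of a t] g.stalk_map_germ[OF q, of "f a" "f t"] by (simp add: k)
qed

lemma Spec_map_comp:
  assumes "ring_hom_cring A B f" and "ring_hom_cring B C g" and "ring_hom_cring A C k"
    and k: "\<And>a. a \<in> carrier A \<Longrightarrow> g (f a) = k a"
  shows "rs_map_eq (Spec C) (Spec A) (rs_comp (Spec B) (Spec_map A B f) (Spec_map B C g))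
    (Spec_map A C k)"
proof -
  interpret f: ring_hom_cring A B f by fact
  interpret g: ring_hom_cring B C g by fact
  have eq: "prime_preimage A f (prime_preimage B g q) = prime_preimage A k q" for q
    using k by (auto simp: prime_preimage_def)
  note [simp] = g.prime_preimage_prime
  show ?thesis
    unfolding rs_map_eq_def rs_comp_def
    using stalk_map_comp(2)[OF assms] structure_sheaf_in_stalk[of _ A]
    by (auto simp: Spec_map_def eq open_preimage_Spec fun_eq_iff)
qed

text \<open>The inverse isomorphism induces the inverse of \<open>Spec \<psi>\<close> on points and on sections, by
  functoriality.\<close>

lemma rs_iso_Spec_map:
  assumes "cring A" and "cring B" and \<psi>: "\<psi> \<in> ring_iso A B"
  shows "rs_iso (Spec B) (Spec A) (Spec_map A B \<psi>)"
proof -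
  define \<phi> where "\<phi> = inv_into (carrier A) \<psi>"
  have \<phi>: "\<phi> \<in> ring_iso B A"
    unfolding \<phi>_def using \<psi> ring_iso_set_sym[OF cring.axioms(1)[OF assms(1)]] by blast
  interpret A: cring A by fact
  interpret B: cring B by fact
  interpret \<psi>: ring_hom_cring A B \<psi>
    using \<psi> by unfold_locales (auto simp: ring_iso_def)
  interpret \<phi>: ring_hom_cring B A \<phi>
    using \<phi> by unfold_locales (auto simp: ring_iso_def)
  interpret idA: ring_hom_cring A A "\<lambda>a. a"
    by unfold_locales (auto intro: ring_hom_memI)
  interpret idB: ring_hom_cring B B "\<lambda>a. a"
    by unfold_locales (auto intro: ring_hom_memI)
  have bij: "bij_betw \<psi> (carrier A) (carrier B)" using \<psi> by (auto simp: ring_iso_def)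
  have \<phi>\<psi>: "\<phi> (\<psi> a) = a" if "a \<in> carrier A" for a
    using that bij by (simp add: \<phi>_def bij_betw_def)
  have \<psi>\<phi>: "\<psi> (\<phi> b) = b" if "b \<in> carrier B" for b
    using that bij by (simp add: \<phi>_def bij_betw_def f_inv_into_f)
  let ?f = "prime_preimage A \<psi>" and ?g = "prime_preimage B \<phi>"
  have subA: "p \<subseteq> carrier A" if "p \<in> prime_spectrum A" for p
    using that by (auto simp: prime_spectrum_def primeideal_def dest: ideal.axioms additive_subgroup.a_subset)
  have subB: "p \<subseteq> carrier B" if "p \<in> prime_spectrum B" for p
    using that by (auto simp: prime_spectrum_def primeideal_def dest: ideal.axioms additive_subgroup.a_subset)
  have gf: "?g (?f q) = q" if "q \<in> prime_spectrum B" for q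
    using subB[OF that] by (auto simp: prime_preimage_def \<psi>\<phi>)
  have fg: "?f (?g p) = p" if "p \<in> prime_spectrum A" for p
    using subA[OF that] by (auto simp: prime_preimage_def \<phi>\<psi>)
  have idpA: "prime_preimage A (\<lambda>a. a) p = p" if "p \<in> prime_spectrum A" for p
    using subA[OF that] by (auto simp: prime_preimage_def)
  have idpB: "prime_preimage B (\<lambda>a. a) p = p" if "p \<in> prime_spectrum B" for p
    using subB[OF that] by (auto simp: prime_preimage_def)
  have stA: "stalk_map A (\<lambda>a. a) p x = x"
    if p: "p \<in> prime_spectrum A" and x: "x \<in> carrier (stalk A p)" for p x
  proof -
    interpret D: denominators A "carrier A - p"
      using p by (simp add: prime_spectrum_def denominators_compl_prime)
    show ?thesis using x idA.stalk_map_germ[OF p]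
      by (elim D.carrier_localizationE) (simp add: idpA[OF p])
  qed
  have stB: "stalk_map B (\<lambda>a. a) p x = x"
    if p: "p \<in> prime_spectrum B" and x: "x \<in> carrier (stalk B p)" for p x
  proof -
    interpret D: denominators B "carrier B - p"
      using p by (simp add: prime_spectrum_def denominators_compl_prime)
    show ?thesis using x idB.stalk_map_germ[OF p]
      by (elim D.carrier_localizationE) (simp add: idpB[OF p])
  qed
  have "homeomorphic_maps (zariski_topology B) (zariski_topology A) ?f ?g"
    unfolding homeomorphic_maps_def continuous_map_def
    using \<psi>.openin_prime_preimage \<phi>.openin_prime_preimage
    by (auto simp: topspace_zariski_topology gf fg open_preimage_Spec
        \<psi>.prime_preimage_prime \<phi>.prime_preimage_prime)
  then have homeo: "homeomorphic_map (zariski_topology B) (zariski_topology A) ?f"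
    using homeomorphic_map_maps by blast
  have iso: "snd (Spec_map A B \<psi>) U \<in>
      ring_iso (structure_sheaf A U) (structure_sheaf B (open_preimage (Spec B) ?f U))"
    if U: "openin (zariski_topology A) U" for U
  proof -
    let ?U = "open_preimage (Spec B) ?f U"
    have U': "openin (zariski_topology B) ?U" by (rule \<psi>.openin_prime_preimage[OF U])
    have U_sub: "p \<in> prime_spectrum A" if "p \<in> U" for p
      using that U by (auto simp: openin_zariski_topology)
    have U'_sub: "p \<in> prime_spectrum B" if "p \<in> ?U" for p
      using that by (auto simp: open_preimage_Spec)
    have UU: "open_preimage (Spec A) ?g ?U = U"
      using U_sub by (auto simp: open_preimage_Spec fg \<phi>.prime_preimage_prime)
    have hom1: "snd (Spec_map A B \<psi>) U \<in> ring_hom (structure_sheaf A U) (structure_sheaf B ?U)"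
      by (rule \<psi>.Spec_map_sections_hom[OF U])
    have hom2: "snd (Spec_map B A \<phi>) ?U \<in> ring_hom (structure_sheaf B ?U) (structure_sheaf A U)"
      using \<phi>.Spec_map_sections_hom[OF U'] by (simp add: UU)
    have inv1: "snd (Spec_map B A \<phi>) ?U (snd (Spec_map A B \<psi>) U s) = s"
      if s: "s \<in> carrier (structure_sheaf A U)" for s
    proof
      fix p
      show "snd (Spec_map B A \<phi>) ?U (snd (Spec_map A B \<psi>) U s) p = s p"
      proof (cases "p \<in> U")
        case True
        have p: "p \<in> prime_spectrum A" by (rule U_sub[OF True])
        have sp: "s p \<in> carrier (stalk A p)" by (rule structure_sheaf_in_stalk[OF s True])
        show ?thesis
          using True p UU stalk_map_comp(2)[OF \<psi>.ring_hom_cring_axioms \<phi>.ring_hom_cring_axioms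
              idA.ring_hom_cring_axioms, OF \<phi>\<psi> p, of "s p"] sp stA[OF p sp]
          by (simp add: Spec_map_def open_preimage_Spec idpA fg \<phi>.prime_preimage_prime)
      next
        case False
        then show ?thesis using s UU
          by (auto simp: Spec_map_def structure_sheaf_def PiE_def extensional_def)
      qed
    qed
    have inv2: "snd (Spec_map A B \<psi>) U (snd (Spec_map B A \<phi>) ?U s) = s"
      if s: "s \<in> carrier (structure_sheaf B ?U)" for s
    proof
      fix p
      show "snd (Spec_map A B \<psi>) U (snd (Spec_map B A \<phi>) ?U s) p = s p"
      proof (cases "p \<in> ?U")
        case True
        have p: "p \<in> prime_spectrum B" by (rule U'_sub[OF True])
        have sp: "s p \<in> carrier (stalk B p)" by (rule structure_sheaf_in_stalk[OF s True])
        have "?f p \<in> U" using True by (simp add: open_preimage_Spec)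
        then show ?thesis
          using True p UU stalk_map_comp(2)[OF \<phi>.ring_hom_cring_axioms \<psi>.ring_hom_cring_axioms
              idB.ring_hom_cring_axioms, OF \<psi>\<phi> p, of "s p"] sp stB[OF p sp]
          by (simp add: Spec_map_def idpB gf UU)
      next
        case False
        then show ?thesis using s
          by (auto simp: Spec_map_def structure_sheaf_def PiE_def extensional_def)
      qed
    qed
    have "bij_betw (snd (Spec_map A B \<psi>) U) (carrier (structure_sheaf A U)) (carrier (structure_sheaf B ?U))"
      using inv1 inv2 ring_hom_closed[OF hom1] ring_hom_closed[OF hom2]
      by (intro bij_betwI[of _ _ _ "snd (Spec_map B A \<phi>) ?U"]) auto
    then show ?thesis using hom1 by (simp add: ring_iso_def)
  qed
  have restr: "restrict (snd (Spec_map A B \<psi>) U s) (open_preimage (Spec B) ?f V) =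
      snd (Spec_map A B \<psi>) V (restrict s V)" if "V \<subseteq> U" for U V s
    using that by (auto simp: Spec_map_def open_preimage_Spec fun_eq_iff)
  have fst: "fst (Spec_map A B \<psi>) = ?f" by (simp add: Spec_map_def)
  show ?thesis
    unfolding rs_iso_def using homeo iso restr by (simp add: fst)
qed

section \<open>A criterion for being the normalization\<close>

lemma ring_hom_cringI2:
  assumes "cring R" "cring S" "h \<in> ring_hom R S"
  shows "ring_hom_cring R S h"
  using assms by (intro ring_hom_cring.intro ring_hom_cring_axioms.intro)

lemma to_fract_power: "to_fract (c ^ n) = to_fract c ^ n"
  by (induction n) auto

text \<open>An injective map to a commutative ring reflects every ring axiom that is an equation between terms.
  Only the existence of negatives has to be supplied.\<close>

lemma cring_if_embeds:
  fixes f :: "'a \<Rightarrow> 'c::comm_ring_1" and A :: "('a, 'b) ring_scheme" (structure)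
  assumes inj: "inj_on f (carrier A)"
    and closed: "\<zero> \<in> carrier A" "\<one> \<in> carrier A"
      "\<And>x y. x \<in> carrier A \<Longrightarrow> y \<in> carrier A \<Longrightarrow> x \<oplus> y \<in> carrier A"
      "\<And>x y. x \<in> carrier A \<Longrightarrow> y \<in> carrier A \<Longrightarrow> x \<otimes> y \<in> carrier A"
    and hom: "f \<zero> = 0" "f \<one> = 1"
      "\<And>x y. x \<in> carrier A \<Longrightarrow> y \<in> carrier A \<Longrightarrow> f (x \<oplus> y) = f x + f y"
      "\<And>x y. x \<in> carrier A \<Longrightarrow> y \<in> carrier A \<Longrightarrow> f (x \<otimes> y) = f x * f y"
    and uminus: "\<And>x. x \<in> carrier A \<Longrightarrow> \<exists>y\<in>carrier A. f y = - f x"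
  shows "cring A"
proof -
  note eqI = inj_onD[OF inj]
  show ?thesis
  proof (rule cringI)
    show "abelian_group A"
    proof (rule abelian_groupI)
      fix x assume x: "x \<in> carrier A"
      from uminus[OF x] obtain y where "y \<in> carrier A" "f y = - f x" by blast
      then show "\<exists>y\<in>carrier A. y \<oplus> x = \<zero>"
        using x by (intro bexI[of _ y] eqI) (auto simp: closed hom)
    qed (auto intro!: eqI simp: closed hom algebra_simps)
    show "Group.comm_monoid A"
      by (rule comm_monoidI) (auto intro!: eqI simp: closed hom algebra_simps)
  next
    fix x y z assume "x \<in> carrier A" "y \<in> carrier A" "z \<in> carrier A"
    then show "(x \<oplus> y) \<otimes> z = x \<otimes> z \<oplus> y \<otimes> z"
      by (intro eqI) (simp_all add: closed hom algebra_simps)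
  qed
qed

definition induced_ring :: "'c::comm_ring_1 set \<Rightarrow> 'c ring" where
  "induced_ring S = \<lparr>carrier = S, monoid.mult = (*), one = 1, ring.zero = 0, ring.add = (+)\<rparr>"

lemma induced_ring_simps [simp]:
  "carrier (induced_ring S) = S" "x \<otimes>\<^bsub>induced_ring S\<^esub> y = x * y" "\<one>\<^bsub>induced_ring S\<^esub> = 1"
  "\<zero>\<^bsub>induced_ring S\<^esub> = 0" "x \<oplus>\<^bsub>induced_ring S\<^esub> y = x + y"
  by (simp_all add: induced_ring_def)

locale closed_under_ring_ops =
  fixes S :: "'c::comm_ring_1 set"
  assumes one_in: "1 \<in> S"
    and diff_in: "x \<in> S \<Longrightarrow> y \<in> S \<Longrightarrow> x - y \<in> S"
    and mult_in: "x \<in> S \<Longrightarrow> y \<in> S \<Longrightarrow> x * y \<in> S"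
begin

lemma zero_in: "0 \<in> S" using diff_in[OF one_in one_in] by simp

lemma uminus_in: "x \<in> S \<Longrightarrow> - x \<in> S" using diff_in[OF zero_in] by fastforce

lemma add_in: "x \<in> S \<Longrightarrow> y \<in> S \<Longrightarrow> x + y \<in> S" using diff_in[OF _ uminus_in] by fastforce

lemma sum_in: "(\<And>i. i \<in> I \<Longrightarrow> f i \<in> S) \<Longrightarrow> sum f I \<in> S"
  by (induction I rule: infinite_finite_induct) (auto simp: zero_in add_in)

lemma power_in: "x \<in> S \<Longrightarrow> x ^ n \<in> S"
  by (induction n) (auto simp: one_in mult_in)

lemma cring_induced_ring: "cring (induced_ring S)"
  by (rule cring_if_embeds[where f = "\<lambda>x. x"])
     (auto simp: zero_in one_in add_in mult_in uminus_in intro: inj_onI)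

end

text \<open>With \<open>n\<close> the degree of the equation and \<open>d = s\<^sup>n\<close>, all \<open>d (f/s)\<^sup>k\<close> lie in \<open>S\<close>: for \<open>k < n\<close> the
  denominator is cleared, and for larger \<open>k\<close> the equation reduces the exponent.\<close>

lemma integral_imp_almost_integral:
  fixes S :: "'c::idom set" and P :: "'c fract poly"
  assumes "closed_under_ring_ops S"
    and monic: "Polynomial.coeff P (Polynomial.degree P) = 1"
    and coeffs: "\<And>i. Polynomial.coeff P i \<in> to_fract ` S"
    and root: "poly P (Fract f s) = 0" and fs: "f \<in> S" "s \<in> S" "s \<noteq> 0"
  shows "\<exists>d\<in>S. d \<noteq> 0 \<and> (\<forall>k. \<exists>g\<in>S. d * f ^ k = s ^ k * g)"
proof -
  interpret S: closed_under_ring_ops S by fact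
  define n where "n = Polynomial.degree P"
  define x where "x = Fract f s"
  have sx: "to_fract s * x = to_fract f" using fs by (simp add: x_def to_fract_def eq_fract)
  have skx: "to_fract (s ^ k) * x ^ k = to_fract (f ^ k)" for k
  proof (induction k)
    case (Suc k)
    then show ?case using sx by (simp add: ac_simps)
  qed simp
  have "poly P x = x ^ n + (\<Sum>i<n. Polynomial.coeff P i * x ^ i)"
    using monic by (simp add: poly_altdef n_def flip: lessThan_Suc_atMost)
  then have xn: "x ^ n = - (\<Sum>i<n. Polynomial.coeff P i * x ^ i)"
    using root by (simp add: x_def add_eq_0_iff)
  have "\<forall>i. \<exists>c. c \<in> S \<and> Polynomial.coeff P i = to_fract c"
    using coeffs by blast
  from choice[OF this] obtain c
    where c: "\<And>i. c i \<in> S" "\<And>i. Polynomial.coeff P i = to_fract (c i)" by auto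
  let ?d = "s ^ n"
  have "\<exists>g\<in>S. to_fract ?d * x ^ k = to_fract g" for k
  proof (induction k rule: less_induct)
    case (less k)
    show ?case
    proof (cases "k < n")
      case True
      have "to_fract ?d * x ^ k = to_fract (s ^ (n - k)) * (to_fract (s ^ k) * x ^ k)"
        using True by (simp flip: to_fract_mult power_add mult.assoc)
      also have "\<dots> = to_fract (s ^ (n - k) * f ^ k)" by (simp only: skx to_fract_mult)
      finally show ?thesis
        using fs by (intro bexI[of _ "s ^ (n - k) * f ^ k"] S.mult_in S.power_in)
    next
      case False
      then have "to_fract ?d * x ^ k = to_fract ?d * (x ^ (k - n) * x ^ n)"
        by (simp flip: power_add)
      also have "\<dots> = - (\<Sum>i<n. to_fract ?d * x ^ (k - n) * (to_fract (c i) * x ^ i))"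
        unfolding xn c(2) by (simp only: sum_distrib_left mult.assoc mult_minus_right)
      also have "\<dots> = - (\<Sum>i<n. to_fract (c i) * (to_fract ?d * x ^ (i + (k - n))))"
        by (simp only: power_add mult_ac)
      finally have eq: "to_fract ?d * x ^ k =
          - (\<Sum>i<n. to_fract (c i) * (to_fract ?d * x ^ (i + (k - n))))" .
      have "\<forall>i\<in>{..<n}. \<exists>g. g \<in> S \<and> to_fract ?d * x ^ (i + (k - n)) = to_fract g"
      proof
        fix i assume "i \<in> {..<n}"
        then have "i + (k - n) < k" using False by auto
        from less[OF this] show "\<exists>g. g \<in> S \<and> to_fract ?d * x ^ (i + (k - n)) = to_fract g" by blast
      qed
      from bchoice[OF this] obtain g where g: "\<And>i. i < n \<Longrightarrow> g i \<in> S"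
        "\<And>i. i < n \<Longrightarrow> to_fract ?d * x ^ (i + (k - n)) = to_fract (g i)" by auto
      have "to_fract ?d * x ^ k = to_fract (- (\<Sum>i<n. c i * g i))"
        unfolding eq to_fract_uminus to_fract_sum to_fract_mult[of "c _"]
        by (intro arg_cong[where f = uminus] sum.cong refl) (simp add: g(2))
      then show ?thesis using g(1) c(1)
        by (intro bexI[of _ "- (\<Sum>i<n. c i * g i)"]) (auto intro!: S.uminus_in S.sum_in S.mult_in)
    qed
  qed
  then have "\<exists>g\<in>S. ?d * f ^ k = s ^ k * g" for k
  proof -
    obtain g where g: "g \<in> S" "to_fract ?d * x ^ k = to_fract g"
      using \<open>\<And>k. \<exists>g\<in>S. to_fract ?d * x ^ k = to_fract g\<close> by blast
    have "to_fract (?d * f ^ k) = to_fract ?d * (to_fract (s ^ k) * x ^ k)"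
      by (simp only: skx to_fract_mult)
    also have "\<dots> = to_fract (s ^ k * g)" using g(2) by (simp add: ac_simps)
    finally have "?d * f ^ k = s ^ k * g" by (simp only: to_fract_eq_iff)
    then show ?thesis using g(1) by blast
  qed
  then show ?thesis using fs S.power_in by (intro bexI[of _ ?d]) auto
qed

text \<open>The counterpart of \<open>ring.eval\<close>, with the leading coefficient first, in a type of class
  \<open>comm_ring_1\<close>.\<close>

fun horner :: "'c::comm_ring_1 list \<Rightarrow> 'c \<Rightarrow> 'c" where
  "horner [] x = 0"
| "horner (c # cs) x = c * x ^ length cs + horner cs x"

lemma horner_append: "horner (cs @ [c]) x = horner cs x * x + c"
  by (induction cs) (auto simp: algebra_simps)

lemma horner_rev: "horner (rev cs) x = poly (Poly cs) x"
  by (induction cs) (auto simp: horner_append algebra_simps)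

lemma Poly_rev_monic:
  fixes cs :: "'c::comm_ring_1 list"
  shows "Polynomial.degree (Poly (rev (1 # cs))) = length cs"
    and "Polynomial.coeff (Poly (rev (1 # cs))) (length cs) = 1"
proof -
  have co: "coeffs (Poly (rev (1 # cs))) = rev (1 # cs)"
    by (simp only: coeffs_Poly) (simp add: strip_while_def)
  have ne: "Poly (rev (1 # cs)) \<noteq> 0" using co by (metis coeffs_eq_Nil rev_is_Nil_conv list.distinct(1))
  show "Polynomial.degree (Poly (rev (1 # cs))) = length cs"
    using length_coeffs_degree[OF ne] co by simp
  show "Polynomial.coeff (Poly (rev (1 # cs))) (length cs) = 1"
    by (simp add: nth_default_def nth_append)
qed

lemma (in ring) map_eval:
  fixes f :: "'a \<Rightarrow> 'c::comm_ring_1"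
  assumes f: "f \<in> ring_hom R (induced_ring UNIV)"
    and x: "x \<in> carrier R" and p: "set p \<subseteq> carrier R"
  shows "f (eval p x) = horner (map f p) (f x)"
proof -
  have f0: "f \<zero> = 0"
  proof -
    have "f (\<zero> \<oplus> \<zero>) = f \<zero> + f \<zero>" using ring_hom_add[OF f, of \<zero> \<zero>] by simp
    then show ?thesis by simp
  qed
  have pow: "f (x [^] n) = f x ^ n" for n :: nat
    using x by (induction n) (auto simp: ring_hom_mult[OF f] ring_hom_one[OF f])
  show ?thesis using p
  proof (induction p)
    case (Cons c p)
    then show ?case
      using x ring_hom_add[OF f, of "c \<otimes> x [^] length p" "eval p x"] eval_in_carrier[of p x]
      by (simp add: ring_hom_mult[OF f] pow)
  qed (simp add: f0)
qed

text \<open>Conditions under which \<open>\<phi>\<close> exhibits the domain \<open>S\<close> as the integral closure of the reduction of \<open>T\<close>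
  in its total ring of fractions. The last condition, that \<open>S\<close> is completely integrally closed, is
  more than integral closedness, but easier to inherit.\<close>

locale normalization_data =
  T: cring T + S: closed_under_ring_ops S
  for T :: "('t, 'x) ring_scheme" and S :: "'c::idom set" +
  fixes \<phi> :: "'t \<Rightarrow> 'c"
  assumes hom: "\<phi> \<in> ring_hom T (induced_ring S)"
    and kernel_nilpotent: "t \<in> carrier T \<Longrightarrow> \<phi> t = 0 \<Longrightarrow> \<exists>n::nat. t [^]\<^bsub>T\<^esub> n = \<zero>\<^bsub>T\<^esub>"
    and birational: "c \<in> S \<Longrightarrow> \<exists>t\<in>carrier T. \<exists>s\<in>carrier T. \<phi> s \<noteq> 0 \<and> \<phi> t = \<phi> s * c"
    and integral: "c \<in> S \<Longrightarrow> \<exists>P. Polynomial.coeff P (Polynomial.degree P) = 1 \<and>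
      (\<forall>i. Polynomial.coeff P i \<in> \<phi> ` carrier T) \<and> poly P c = 0"
    and completely_integrally_closed:
      "\<lbrakk>f \<in> S; s \<in> S; d \<in> S; s \<noteq> 0; d \<noteq> 0; \<And>k. \<exists>g\<in>S. d * f ^ k = s ^ k * g\<rbrakk> \<Longrightarrow> \<exists>g\<in>S. f = s * g"
begin

sublocale \<phi>: ring_hom_cring T "induced_ring S" \<phi>
  by (intro ring_hom_cringI2 hom S.cring_induced_ring T.is_cring)

lemma nilradical_eq_kernel: "nilradical T = a_kernel T (induced_ring S) \<phi>"
proof -
  have "\<phi> t = 0" if "t \<in> carrier T" "t [^]\<^bsub>T\<^esub> (n::nat) = \<zero>\<^bsub>T\<^esub>" for t n
  proof -
    have "\<phi> (t [^]\<^bsub>T\<^esub> k) = \<phi> t ^ k" for k :: nat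
      using that(1) by (induction k) (simp_all add: mult.commute)
    from this[of n] that(2) have "\<phi> t ^ n = 0" by simp
    then show ?thesis by simp
  qed
  then have "nilradical T \<subseteq> {t \<in> carrier T. \<phi> t = 0}"
    unfolding nilradical_def by blast
  moreover have "{t \<in> carrier T. \<phi> t = 0} \<subseteq> nilradical T"
    unfolding nilradical_def using kernel_nilpotent by blast
  moreover have "a_kernel T (induced_ring S) \<phi> = {t \<in> carrier T. \<phi> t = 0}"
    unfolding a_kernel_def' by simp
  ultimately show ?thesis by blast
qed

abbreviation "N \<equiv> nilradical T"
abbreviation "D \<equiv> reduction T"

text \<open>The embedding of the reduction of \<open>T\<close> into \<open>S\<close> induced by \<open>\<phi>\<close>.\<close>

definition val :: "'t set \<Rightarrow> 'c" where "val Y = the_elem (\<phi> ` Y)"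

lemma ideal_N: "ideal N T"
  unfolding nilradical_eq_kernel by (rule \<phi>.ring.kernel_is_ideal)

lemma cring_D: "cring D"
  unfolding reduction_def by (rule ideal.quotient_is_cring[OF ideal_N T.is_cring])

lemma coset_in: "t \<in> carrier T \<Longrightarrow> N +>\<^bsub>T\<^esub> t \<in> carrier D"
  unfolding reduction_def using ring_hom_closed[OF ideal.rcos_ring_hom[OF ideal_N]] .

lemma val_coset: "t \<in> carrier T \<Longrightarrow> val (N +>\<^bsub>T\<^esub> t) = \<phi> t"
  unfolding val_def nilradical_eq_kernel by (rule \<phi>.ring.the_elem_simp)

lemma val_hom: "val \<in> ring_hom D (induced_ring S)"
  using \<phi>.ring.the_elem_hom unfolding val_def[abs_def] reduction_def nilradical_eq_kernel .

lemma val_inj: "x \<in> carrier D \<Longrightarrow> y \<in> carrier D \<Longrightarrow> val x = val y \<Longrightarrow> x = y"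
  using \<phi>.ring.the_elem_inj unfolding val_def[abs_def] reduction_def nilradical_eq_kernel .

sublocale D: cring D by (rule cring_D)
sublocale val: ring_hom_cring D "induced_ring S" val
  by (intro ring_hom_cringI2 val_hom S.cring_induced_ring cring_D)

lemma val_simps [simp]:
  "x \<in> carrier D \<Longrightarrow> y \<in> carrier D \<Longrightarrow> val (x \<otimes>\<^bsub>D\<^esub> y) = val x * val y"
  "x \<in> carrier D \<Longrightarrow> y \<in> carrier D \<Longrightarrow> val (x \<oplus>\<^bsub>D\<^esub> y) = val x + val y"
  "val \<one>\<^bsub>D\<^esub> = 1" "val \<zero>\<^bsub>D\<^esub> = 0" "x \<in> carrier D \<Longrightarrow> val x \<in> S"
  using val.hom_mult[of x y] val.hom_add[of x y] val.hom_one val.hom_zero val.hom_closed[of x] by simp_all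

abbreviation "Reg \<equiv> regular_elements D"
abbreviation "Q \<equiv> total_fractions D"

lemma Reg_iff: "s \<in> Reg \<longleftrightarrow> s \<in> carrier D \<and> val s \<noteq> 0"
proof -
  have "\<not> (\<forall>a\<in>carrier D. s \<otimes>\<^bsub>D\<^esub> a = \<zero>\<^bsub>D\<^esub> \<longrightarrow> a = \<zero>\<^bsub>D\<^esub>)" if "s \<in> carrier D" "val s = 0"
  proof -
    have "s = \<zero>\<^bsub>D\<^esub>" using that by (intro val_inj) auto
    moreover have "\<one>\<^bsub>D\<^esub> \<noteq> \<zero>\<^bsub>D\<^esub>" using val_simps(3,4) by (metis zero_neq_one)
    ultimately show ?thesis by (intro notI) (metis D.one_closed D.l_null)
  qed
  moreover have "a = \<zero>\<^bsub>D\<^esub>"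
    if "s \<in> carrier D" "val s \<noteq> 0" "a \<in> carrier D" "s \<otimes>\<^bsub>D\<^esub> a = \<zero>\<^bsub>D\<^esub>" for a
    using that val_simps(1)[of s a] by (intro val_inj) auto
  ultimately show ?thesis by (auto simp: regular_elements_def)
qed

sublocale Reg: denominators D Reg
  by unfold_locales (auto simp: Reg_iff)

text \<open>By \<open>Reg_iff\<close> the regular elements of the reduction are the non-zero ones, so its total ring of
  fractions embeds into the field of fractions of the surrounding domain.\<close>

definition ev :: "('t set \<times> 't set) set \<Rightarrow> 'c fract" where
  "ev x = the_elem ((\<lambda>(a, s). Fract (val a) (val s)) ` x)"

lemma fraction_rel_iff:
  assumes "a \<in> carrier D" "s \<in> Reg" "b \<in> carrier D" "t \<in> Reg"
  shows "((a, s), (b, t)) \<in> fraction_rel D Reg \<longleftrightarrow> Fract (val a) (val s) = Fract (val b) (val t)"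
proof -
  have st: "s \<in> carrier D" "t \<in> carrier D" "val s \<noteq> 0" "val t \<noteq> 0" using assms by (auto simp: Reg_iff)
  have "\<exists>u\<in>Reg. u \<otimes>\<^bsub>D\<^esub> (t \<otimes>\<^bsub>D\<^esub> a) = u \<otimes>\<^bsub>D\<^esub> (s \<otimes>\<^bsub>D\<^esub> b)" if "val t * val a = val s * val b"
    using that st assms Reg.one_denominator by (intro bexI[of _ "\<one>\<^bsub>D\<^esub>"] val_inj) auto
  moreover have "val t * val a = val s * val b"
    if "u \<in> Reg" "u \<otimes>\<^bsub>D\<^esub> (t \<otimes>\<^bsub>D\<^esub> a) = u \<otimes>\<^bsub>D\<^esub> (s \<otimes>\<^bsub>D\<^esub> b)" for u
  proof -
    have u: "u \<in> carrier D" "val u \<noteq> 0" using that(1) by (auto simp: Reg_iff)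
    have "val (u \<otimes>\<^bsub>D\<^esub> (t \<otimes>\<^bsub>D\<^esub> a)) = val (u \<otimes>\<^bsub>D\<^esub> (s \<otimes>\<^bsub>D\<^esub> b))" by (simp only: that(2))
    then show ?thesis using u st assms by auto
  qed
  ultimately show ?thesis
    using assms st by (auto simp: fraction_rel_def eq_fract ac_simps)
qed

lemma ev_fraction:
  assumes "a \<in> carrier D" "s \<in> Reg"
  shows "ev (fraction D Reg a s) = Fract (val a) (val s)"
proof -
  have "(\<lambda>(a, s). Fract (val a) (val s)) ` fraction D Reg a s = {Fract (val a) (val s)}"
  proof (intro equalityI subsetI)
    fix y assume "y \<in> (\<lambda>(a, s). Fract (val a) (val s)) ` fraction D Reg a s"
    then obtain b t where bt: "((a, s), (b, t)) \<in> fraction_rel D Reg" "y = Fract (val b) (val t)"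
      by (auto simp: fraction_def)
    then have "b \<in> carrier D" "t \<in> Reg" by (auto simp: fraction_rel_def)
    then show "y \<in> {Fract (val a) (val s)}" using bt assms fraction_rel_iff by auto
  next
    fix y assume "y \<in> {Fract (val a) (val s)}"
    then show "y \<in> (\<lambda>(a, s). Fract (val a) (val s)) ` fraction D Reg a s"
      using assms fraction_rel_iff[OF assms assms] by (force simp: fraction_def)
  qed
  then show ?thesis by (simp add: ev_def)
qed

lemma Q_cases:
  assumes "x \<in> carrier Q"
  obtains a s where "a \<in> carrier D" "s \<in> Reg" "x = fraction D Reg a s"
  using assms Reg.carrier_localizationE by (auto simp: total_fractions_def)

lemma fraction_in_Q: "a \<in> carrier D \<Longrightarrow> s \<in> Reg \<Longrightarrow> fraction D Reg a s \<in> carrier Q"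
  using Reg.fraction_closed by (simp add: total_fractions_def)

lemma ev_inj: "inj_on ev (carrier Q)"
  by (rule inj_onI, elim Q_cases) (simp add: ev_fraction Reg.fraction_eq_iff fraction_rel_iff)

lemma ev_ops:
  "x \<in> carrier Q \<Longrightarrow> y \<in> carrier Q \<Longrightarrow> ev (x \<otimes>\<^bsub>Q\<^esub> y) = ev x * ev y"
  "x \<in> carrier Q \<Longrightarrow> y \<in> carrier Q \<Longrightarrow> ev (x \<oplus>\<^bsub>Q\<^esub> y) = ev x + ev y"
  "ev \<one>\<^bsub>Q\<^esub> = 1" "ev \<zero>\<^bsub>Q\<^esub> = 0"
proof -
  have R: "s \<in> carrier D" "val s \<noteq> 0" if "s \<in> Reg" for s using that by (auto simp: Reg_iff)
  show "x \<in> carrier Q \<Longrightarrow> y \<in> carrier Q \<Longrightarrow> ev (x \<otimes>\<^bsub>Q\<^esub> y) = ev x * ev y"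
    by (elim Q_cases) (simp add: total_fractions_def Reg.localization_mult ev_fraction
        Reg.mult_denominator R)
  show "x \<in> carrier Q \<Longrightarrow> y \<in> carrier Q \<Longrightarrow> ev (x \<oplus>\<^bsub>Q\<^esub> y) = ev x + ev y"
    by (elim Q_cases) (simp add: total_fractions_def Reg.localization_add ev_fraction
        Reg.mult_denominator R)
  show "ev \<one>\<^bsub>Q\<^esub> = 1" "ev \<zero>\<^bsub>Q\<^esub> = 0"
    by (simp_all add: total_fractions_def Reg.localization_one Reg.localization_zero ev_fraction
        Reg.one_denominator fract_collapse)
qed

lemma Q_closed:
  "\<one>\<^bsub>Q\<^esub> \<in> carrier Q" "\<zero>\<^bsub>Q\<^esub> \<in> carrier Q"
  "x \<in> carrier Q \<Longrightarrow> y \<in> carrier Q \<Longrightarrow> x \<otimes>\<^bsub>Q\<^esub> y \<in> carrier Q"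
  "x \<in> carrier Q \<Longrightarrow> y \<in> carrier Q \<Longrightarrow> x \<oplus>\<^bsub>Q\<^esub> y \<in> carrier Q"
  using Reg.localization_closed Reg.fraction_closed Reg.one_denominator
  by (auto simp: total_fractions_def Reg.localization_one Reg.localization_zero)

lemma cring_Q: "cring Q"
proof (rule cring_if_embeds[OF ev_inj])
  fix x assume "x \<in> carrier Q"
  then obtain a s where as: "a \<in> carrier D" "s \<in> Reg" "x = fraction D Reg a s" by (elim Q_cases)
  have "val (\<ominus>\<^bsub>D\<^esub> a) = - val a"
    using val_simps(2)[of "\<ominus>\<^bsub>D\<^esub> a" a] as(1) by (simp add: D.l_neg eq_neg_iff_add_eq_0)
  then show "\<exists>y\<in>carrier Q. ev y = - ev x"
    using as by (intro bexI[of _ "fraction D Reg (\<ominus>\<^bsub>D\<^esub> a) s"]) (auto simp: ev_fraction fraction_in_Q)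
qed (simp_all add: ev_ops Q_closed)

sublocale Q: cring Q by (rule cring_Q)

lemma ev_hom: "ev \<in> ring_hom Q (induced_ring UNIV)"
  by (rule ring_hom_memI) (auto simp: ev_ops)

abbreviation "\<iota> \<equiv> to_total_fractions D"

lemma \<iota>: "a \<in> carrier D \<Longrightarrow> \<iota> a \<in> carrier Q" "a \<in> carrier D \<Longrightarrow> ev (\<iota> a) = to_fract (val a)"
  by (simp_all add: to_total_fractions_def fraction_in_Q ev_fraction Reg.one_denominator to_fract_def)

text \<open>Elements that are integral over the reduction are integral, hence almost integral, over \<open>S\<close>, and so
  lie in \<open>S\<close>. Conversely, an equation over \<open>\<phi>(T)\<close> lifts to the reduction, coefficient by
  coefficient.\<close>

lemma integral_closure_iff:
  assumes x: "x \<in> carrier Q"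
  shows "x \<in> integral_closure Q (\<iota> ` carrier D) \<longleftrightarrow> ev x \<in> to_fract ` S"
proof
  assume "x \<in> integral_closure Q (\<iota> ` carrier D)"
  then obtain p where p: "set p \<subseteq> \<iota> ` carrier D" "Q.eval (\<one>\<^bsub>Q\<^esub> # p) x = \<zero>\<^bsub>Q\<^esub>"
    by (auto simp: integral_closure_def)
  let ?cs = "map ev p"
  let ?P = "Poly (rev (1 # ?cs))"
  have "horner (map ev (\<one>\<^bsub>Q\<^esub> # p)) (ev x) = ev (Q.eval (\<one>\<^bsub>Q\<^esub> # p) x)"
    using p(1) \<iota>(1) x by (intro Q.map_eval[OF ev_hom, symmetric]) auto
  then have "horner (1 # ?cs) (ev x) = 0"
    by (simp only: p(2) ev_ops list.map)
  then have root: "poly ?P (ev x) = 0"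
    using horner_rev[of "rev (1 # ?cs)" "ev x"] by simp
  have coeffs: "Polynomial.coeff ?P i \<in> to_fract ` S" for i
  proof -
    have "set ?cs \<subseteq> to_fract ` S" using p(1) \<iota>(2) by auto
    moreover have "(0::'c fract) \<in> to_fract ` S"
      by (rule image_eqI[where x = 0]) (simp_all add: S.zero_in)
    moreover have "(1::'c fract) \<in> to_fract ` S"
      by (rule image_eqI[where x = 1]) (simp_all add: S.one_in)
    ultimately have "set (rev (1 # ?cs)) \<subseteq> to_fract ` S" by auto
    then show ?thesis
      unfolding coeff_Poly_eq nth_default_def using \<open>(0::'c fract) \<in> to_fract ` S\<close>
        nth_mem[of i "rev (1 # ?cs)"] by (cases "i < length (rev (1 # ?cs))") (simp_all only: if_True if_False subsetD)
  qed
  obtain a s where as: "a \<in> carrier D" "s \<in> Reg" "x = fraction D Reg a s" using x by (elim Q_cases)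
  have vs: "val a \<in> S" "val s \<in> S" "val s \<noteq> 0"
    using as(1,2) by (simp_all add: Reg_iff)
  have ex: "ev x = Fract (val a) (val s)" using as by (simp add: ev_fraction)
  have monic: "Polynomial.coeff ?P (Polynomial.degree ?P) = 1"
    by (simp only: Poly_rev_monic)
  obtain d where "d \<in> S" "d \<noteq> 0" "\<And>k. \<exists>g\<in>S. d * val a ^ k = val s ^ k * g"
    using integral_imp_almost_integral[OF S.closed_under_ring_ops_axioms monic coeffs
        root[unfolded ex] vs] by blast
  then obtain g where "g \<in> S" "val a = val s * g"
    using completely_integrally_closed[OF vs(1,2) _ vs(3)] by blast
  then show "ev x \<in> to_fract ` S" using vs ex by (auto simp: to_fract_def eq_fract)
next
  assume "ev x \<in> to_fract ` S"
  then obtain c where c: "c \<in> S" "ev x = to_fract c" by blast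
  from integral[OF c(1)] obtain P where P: "Polynomial.coeff P (Polynomial.degree P) = 1"
    "\<And>i. Polynomial.coeff P i \<in> \<phi> ` carrier T" "poly P c = 0" by blast
  have "P \<noteq> 0" using P(1) by auto
  define cs where "cs = tl (rev (coeffs P))"
  have ne: "rev (coeffs P) \<noteq> []" using \<open>P \<noteq> 0\<close> by simp
  have hd: "hd (rev (coeffs P)) = 1"
    using P(1) \<open>P \<noteq> 0\<close> by (simp add: hd_rev last_coeffs_eq_coeff_degree)
  have cons: "rev (coeffs P) = 1 # cs"
    unfolding cs_def by (rule list.collapse[OF ne, unfolded hd, symmetric])
  have "set (coeffs P) \<subseteq> \<phi> ` carrier T"
    using P(2) by (auto simp: coeffs_def)
  moreover have "set cs \<subseteq> set (coeffs P)" using cons by (metis set_rev set_subset_Cons)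
  moreover have "\<phi> ` carrier T \<subseteq> val ` carrier D"
  proof
    fix y assume "y \<in> \<phi> ` carrier T"
    then obtain t where t: "t \<in> carrier T" "y = \<phi> t" by blast
    then show "y \<in> val ` carrier D" by (intro image_eqI[OF _ coset_in]) (simp_all add: val_coset)
  qed
  ultimately have cs: "set cs \<subseteq> val ` carrier D" by blast
  define r where "r c = (SOME d. d \<in> carrier D \<and> val d = c)" for c
  have r: "r c \<in> carrier D" "val (r c) = c" if "c \<in> set cs" for c
  proof -
    have "\<exists>d. d \<in> carrier D \<and> val d = c" using that cs by auto
    from someI_ex[OF this] show "r c \<in> carrier D" "val (r c) = c" by (auto simp: r_def)
  qed
  let ?p = "map (\<lambda>c. \<iota> (r c)) cs"
  have horner_to_fract: "horner (map to_fract l) (to_fract c) = to_fract (horner l c)" for l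
    by (induction l) (simp_all add: to_fract_power)
  have "ev (Q.eval (\<one>\<^bsub>Q\<^esub> # ?p) x) = horner (map ev (\<one>\<^bsub>Q\<^esub> # ?p)) (ev x)"
    using r \<iota>(1) x by (intro Q.map_eval[OF ev_hom]) auto
  also have "map ev (\<one>\<^bsub>Q\<^esub> # ?p) = map to_fract (1 # cs)"
    using r \<iota> by (simp add: ev_ops)
  also have "horner (map to_fract (1 # cs)) (ev x) = to_fract (poly P c)"
    using horner_rev[of "coeffs P" c] by (simp only: c(2) horner_to_fract cons Poly_coeffs)
  also have "\<dots> = ev \<zero>\<^bsub>Q\<^esub>" by (simp add: P(3) ev_ops)
  finally have "Q.eval (\<one>\<^bsub>Q\<^esub> # ?p) x = \<zero>\<^bsub>Q\<^esub>"
    by (rule inj_onD[OF ev_inj _ Q.eval_in_carrier Q_closed(2)]) (use r \<iota>(1) x Q_closed in auto)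
  moreover have "set ?p \<subseteq> \<iota> ` carrier D" using r(1) by auto
  ultimately show "x \<in> integral_closure Q (\<iota> ` carrier D)"
    using x unfolding integral_closure_def by blast
qed

lemma normalization_ring_simps:
  "carrier (normalization_ring T) = {x \<in> carrier Q. ev x \<in> to_fract ` S}"
  "x \<otimes>\<^bsub>normalization_ring T\<^esub> y = x \<otimes>\<^bsub>Q\<^esub> y" "x \<oplus>\<^bsub>normalization_ring T\<^esub> y = x \<oplus>\<^bsub>Q\<^esub> y"
  "\<one>\<^bsub>normalization_ring T\<^esub> = \<one>\<^bsub>Q\<^esub>" "\<zero>\<^bsub>normalization_ring T\<^esub> = \<zero>\<^bsub>Q\<^esub>"
proof -
  have "integral_closure Q (\<iota> ` carrier D) \<subseteq> carrier Q" by (auto simp: integral_closure_def)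
  then show "carrier (normalization_ring T) = {x \<in> carrier Q. ev x \<in> to_fract ` S}"
    unfolding normalization_ring_def using integral_closure_iff by auto
qed (simp_all add: normalization_ring_def)

lemma cring_normalization_ring: "cring (normalization_ring T)"
proof (rule cring_if_embeds[where f = ev])
  show "inj_on ev (carrier (normalization_ring T))"
    using ev_inj by (rule inj_on_subset) (auto simp: normalization_ring_simps)
next
  fix x assume x: "x \<in> carrier (normalization_ring T)"
  then have x': "x \<in> carrier Q" by (simp add: normalization_ring_simps)
  have "ev (\<ominus>\<^bsub>Q\<^esub> x) = - ev x"
    using ev_ops(2)[of "\<ominus>\<^bsub>Q\<^esub> x" x] x' by (simp add: Q.l_neg ev_ops eq_neg_iff_add_eq_0)
  moreover have "- ev x \<in> to_fract ` S"
  proof -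
    from x obtain c where "c \<in> S" "ev x = to_fract c" by (auto simp: normalization_ring_simps(1))
    then show ?thesis by (intro image_eqI[OF _ S.uminus_in]) simp_all
  qed
  ultimately show "\<exists>y\<in>carrier (normalization_ring T). ev y = - ev x"
    using x' by (intro bexI[of _ "\<ominus>\<^bsub>Q\<^esub> x"]) (auto simp: normalization_ring_simps)
next
  fix x y assume "x \<in> carrier (normalization_ring T)" "y \<in> carrier (normalization_ring T)"
  then obtain b c where b: "x \<in> carrier Q" "b \<in> S" "ev x = to_fract b"
    and c: "y \<in> carrier Q" "c \<in> S" "ev y = to_fract c"
    by (auto simp: normalization_ring_simps(1))
  have "ev x + ev y \<in> to_fract ` S" "ev x * ev y \<in> to_fract ` S"
    using imageI[OF S.add_in[OF b(2) c(2)], of to_fract] imageI[OF S.mult_in[OF b(2) c(2)], of to_fract]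
    by (simp_all add: b(3) c(3))
  then show "x \<oplus>\<^bsub>normalization_ring T\<^esub> y \<in> carrier (normalization_ring T)"
    and "x \<otimes>\<^bsub>normalization_ring T\<^esub> y \<in> carrier (normalization_ring T)"
    and "ev (x \<oplus>\<^bsub>normalization_ring T\<^esub> y) = ev x + ev y"
    and "ev (x \<otimes>\<^bsub>normalization_ring T\<^esub> y) = ev x * ev y"
    by (simp_all add: normalization_ring_simps ev_ops Q_closed b(1) c(1))
next
  have "(0::'c fract) \<in> to_fract ` S" "(1::'c fract) \<in> to_fract ` S"
    by (rule image_eqI[OF _ S.zero_in], simp) (rule image_eqI[OF _ S.one_in], simp)
  then show "\<zero>\<^bsub>normalization_ring T\<^esub> \<in> carrier (normalization_ring T)"
    "\<one>\<^bsub>normalization_ring T\<^esub> \<in> carrier (normalization_ring T)"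
    by (simp_all add: normalization_ring_simps ev_ops Q_closed)
qed (simp_all add: normalization_ring_simps ev_ops)

definition \<psi> :: "('t set \<times> 't set) set \<Rightarrow> 'c" where
  "\<psi> x = inv_into S to_fract (ev x)"

lemma \<psi>: "ev x = to_fract c \<Longrightarrow> c \<in> S \<Longrightarrow> \<psi> x = c"
  by (simp add: \<psi>_def inv_into_f_f inj_on_def)

lemma to_fract_\<psi>:
  assumes "x \<in> carrier (normalization_ring T)"
  shows "\<psi> x \<in> S" "ev x = to_fract (\<psi> x)"
  using assms \<psi> by (auto simp: normalization_ring_simps)

lemma \<psi>_iso: "\<psi> \<in> ring_iso (normalization_ring T) (induced_ring S)"
proof -
  note in_Q = normalization_ring_simps(1)
  have hom: "\<psi> \<in> ring_hom (normalization_ring T) (induced_ring S)"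
  proof (rule ring_hom_memI)
    fix x y assume x: "x \<in> carrier (normalization_ring T)" and y: "y \<in> carrier (normalization_ring T)"
    have xy: "x \<in> carrier Q" "y \<in> carrier Q" using x y by (simp_all add: in_Q)
    have "ev (x \<otimes>\<^bsub>Q\<^esub> y) = to_fract (\<psi> x * \<psi> y)"
      by (simp only: ev_ops(1)[OF xy] to_fract_\<psi>(2)[OF x] to_fract_\<psi>(2)[OF y] to_fract_mult)
    then show "\<psi> (x \<otimes>\<^bsub>normalization_ring T\<^esub> y) = \<psi> x \<otimes>\<^bsub>induced_ring S\<^esub> \<psi> y"
      using \<psi> S.mult_in[OF to_fract_\<psi>(1)[OF x] to_fract_\<psi>(1)[OF y]]
      by (simp add: normalization_ring_simps(2))
    have "ev (x \<oplus>\<^bsub>Q\<^esub> y) = to_fract (\<psi> x + \<psi> y)"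
      by (simp only: ev_ops(2)[OF xy] to_fract_\<psi>(2)[OF x] to_fract_\<psi>(2)[OF y] to_fract_add)
    then show "\<psi> (x \<oplus>\<^bsub>normalization_ring T\<^esub> y) = \<psi> x \<oplus>\<^bsub>induced_ring S\<^esub> \<psi> y"
      using \<psi> S.add_in[OF to_fract_\<psi>(1)[OF x] to_fract_\<psi>(1)[OF y]]
      by (simp add: normalization_ring_simps(3))
  next
    fix x assume "x \<in> carrier (normalization_ring T)"
    then show "\<psi> x \<in> carrier (induced_ring S)" using to_fract_\<psi>(1) by simp
  next
    show "\<psi> \<one>\<^bsub>normalization_ring T\<^esub> = \<one>\<^bsub>induced_ring S\<^esub>"
      using S.one_in by (simp add: normalization_ring_simps ev_ops \<psi>)
  qed
  have "inj_on \<psi> (carrier (normalization_ring T))"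
  proof (rule inj_onI)
    fix x y assume x: "x \<in> carrier (normalization_ring T)" and y: "y \<in> carrier (normalization_ring T)"
      and "\<psi> x = \<psi> y"
    then have "ev x = ev y" using to_fract_\<psi>(2) by metis
    then show "x = y" using x y inj_onD[OF ev_inj] by (simp add: in_Q)
  qed
  moreover have "c \<in> \<psi> ` carrier (normalization_ring T)" if c: "c \<in> S" for c
  proof -
    from birational[OF c] obtain t s where ts: "t \<in> carrier T" "s \<in> carrier T" "\<phi> s \<noteq> 0" "\<phi> t = \<phi> s * c"
      by blast
    let ?x = "fraction D Reg (N +>\<^bsub>T\<^esub> t) (N +>\<^bsub>T\<^esub> s)"
    have s: "N +>\<^bsub>T\<^esub> s \<in> Reg" using ts by (simp add: Reg_iff coset_in val_coset)
    then have "ev ?x = to_fract c"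
      using ts by (simp add: ev_fraction coset_in val_coset to_fract_def eq_fract)
    then show ?thesis
      using s c ts \<psi>[of ?x c] by (intro image_eqI[of _ _ ?x]) (auto simp: in_Q fraction_in_Q coset_in)
  qed
  moreover have "\<psi> ` carrier (normalization_ring T) \<subseteq> S" using to_fract_\<psi>(1) by blast
  ultimately have "bij_betw \<psi> (carrier (normalization_ring T)) S"
    unfolding bij_betw_def by blast
  then show ?thesis using hom by (simp add: ring_iso_def)
qed

lemma to_normalization:
  assumes "t \<in> carrier T"
  shows "to_normalization T t \<in> carrier (normalization_ring T)" "\<psi> (to_normalization T t) = \<phi> t"
proof -
  have "ev (to_normalization T t) = to_fract (\<phi> t)"
    using assms by (simp add: to_normalization_def \<iota> coset_in val_coset)
  note ev = this
  have S: "\<phi> t \<in> S" using \<phi>.hom_closed[OF assms] by simp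
  show "to_normalization T t \<in> carrier (normalization_ring T)" "\<psi> (to_normalization T t) = \<phi> t"
    using \<psi>[OF ev S] ev S assms
    by (simp_all add: normalization_ring_simps(1)) (simp add: to_normalization_def \<iota>(1) coset_in)
qed

theorem is_normalization:
  "is_normalization_of_Spec T (Spec (induced_ring S)) (Spec_map T (induced_ring S) \<phi>)"
proof -
  let ?A = "normalization_ring T"
  interpret A: cring ?A by (rule cring_normalization_ring)
  have \<psi>_hom: "\<psi> \<in> ring_hom ?A (induced_ring S)" using \<psi>_iso by (simp add: ring_iso_def)
  have inj: "inj_on \<psi> (carrier ?A)" using \<psi>_iso by (simp add: ring_iso_def bij_betw_def)
  interpret \<psi>: ring_hom_cring ?A "induced_ring S" \<psi>
    by (intro ring_hom_cringI2 \<psi>_hom S.cring_induced_ring cring_normalization_ring)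
  have "to_normalization T \<in> ring_hom T ?A"
  proof (rule ring_hom_memI)
    fix x y assume xy: "x \<in> carrier T" "y \<in> carrier T"
    show "to_normalization T (x \<otimes>\<^bsub>T\<^esub> y) = to_normalization T x \<otimes>\<^bsub>?A\<^esub> to_normalization T y"
      by (rule inj_onD[OF inj]) (simp_all add: to_normalization xy)
    show "to_normalization T (x \<oplus>\<^bsub>T\<^esub> y) = to_normalization T x \<oplus>\<^bsub>?A\<^esub> to_normalization T y"
      by (rule inj_onD[OF inj]) (simp_all add: to_normalization xy)
  next
    show "to_normalization T \<one>\<^bsub>T\<^esub> = \<one>\<^bsub>?A\<^esub>"
      by (rule inj_onD[OF inj]) (simp_all add: to_normalization)
  qed (rule to_normalization(1))
  then interpret n: ring_hom_cring T ?A "to_normalization T"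
    by (intro ring_hom_cringI2 cring_normalization_ring T.is_cring)
  show ?thesis
    unfolding is_normalization_of_Spec_def
    using rs_iso_Spec_map[OF cring_normalization_ring S.cring_induced_ring \<psi>_iso]
      Spec_map_comp[OF n.ring_hom_cring_axioms \<psi>.ring_hom_cring_axioms \<phi>.ring_hom_cring_axioms
        to_normalization(2)]
    by blast
qed

end

section \<open>Polynomials and substitution\<close>

definition polys :: "nat set \<Rightarrow> 'k::field mpoly set" where
  "polys V = {p. \<forall>e\<in>Poly_Mapping.keys p. Poly_Mapping.keys e \<subseteq> V}"

lemma sum_singles:
  fixes p :: "'a \<Rightarrow>\<^sub>0 'b::comm_monoid_add"
  assumes "finite A" "Poly_Mapping.keys p \<subseteq> A"
  shows "(\<Sum>e\<in>A. Poly_Mapping.single e (Poly_Mapping.lookup p e)) = p"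
proof (rule poly_mapping_eqI)
  fix k
  have "(\<Sum>e\<in>A. Poly_Mapping.lookup (Poly_Mapping.single e (Poly_Mapping.lookup p e)) k) =
    (\<Sum>e\<in>A. if e = k then Poly_Mapping.lookup p k else 0)"
    by (rule sum.cong) (auto simp: lookup_single when_def)
  also have "\<dots> = Poly_Mapping.lookup p k"
    using assms by (auto simp: in_keys_iff)
  finally show "Poly_Mapping.lookup (\<Sum>e\<in>A. Poly_Mapping.single e (Poly_Mapping.lookup p e)) k =
    Poly_Mapping.lookup p k" by (simp add: lookup_sum)
qed

lemma polys_mono: "V \<subseteq> W \<Longrightarrow> p \<in> polys V \<Longrightarrow> p \<in> polys W"
  by (auto simp: polys_def)

lemma polys_UNIV [simp]: "p \<in> polys UNIV"
  by (simp add: polys_def)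

lemma keys_add_nat: "Poly_Mapping.keys (e + f :: nat \<Rightarrow>\<^sub>0 nat) = Poly_Mapping.keys e \<union> Poly_Mapping.keys f"
  by (auto simp: in_keys_iff lookup_add)

lemma polys_single: "c = 0 \<or> Poly_Mapping.keys e \<subseteq> V \<Longrightarrow> Poly_Mapping.single e c \<in> polys V"
  by (auto simp: polys_def)

lemma closed_under_ring_ops_polys: "closed_under_ring_ops (polys V)"
proof
  show "1 \<in> polys V" by (simp add: polys_def)
  show "p - q \<in> polys V" if "p \<in> polys V" "q \<in> polys V" for p q
    using that keys_diff[of p q] by (auto simp: polys_def)
  show "p * q \<in> polys V" if "p \<in> polys V" "q \<in> polys V" for p q
    unfolding polys_def
  proof safe
    fix e i assume e: "e \<in> Poly_Mapping.keys (p * q)" and i: "i \<in> Poly_Mapping.keys e"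
    obtain a b where "a \<in> Poly_Mapping.keys p" "b \<in> Poly_Mapping.keys q" "e = a + b"
      using keys_mult[of p q] e by blast
    then show "i \<in> V" using that i by (auto simp: polys_def keys_add_nat)
  qed
qed

global_interpretation polys: closed_under_ring_ops "polys V" for V
  by (rule closed_under_ring_ops_polys)

lemma pconst_simps:
  "pconst (a + b) = pconst a + pconst b" "pconst (a * b) = pconst a * pconst b"
  "pconst 0 = 0" "pconst 1 = 1" "pconst (- a) = - pconst a"
  by (simp_all add: pconst_def single_add mult_single single_uminus)

lemma pconst_in: "pconst c \<in> polys V"
  by (simp add: pconst_def polys_single)

lemma pvar_in: "i \<in> V \<Longrightarrow> pvar i \<in> polys V"
  by (simp add: pvar_def polys_single)

lemma pvar_power: "pvar i ^ n = Poly_Mapping.single (Poly_Mapping.single i n) 1"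
  by (induction n) (simp_all add: pvar_def mult_single flip: single_add)

lemma single_eq_prod:
  "Poly_Mapping.single e c = pconst c * (\<Prod>i\<in>Poly_Mapping.keys e. pvar i ^ Poly_Mapping.lookup e i)"
proof -
  have "(\<Prod>i\<in>A. pvar i ^ Poly_Mapping.lookup e i) =
    Poly_Mapping.single (\<Sum>i\<in>A. Poly_Mapping.single i (Poly_Mapping.lookup e i)) (1::'a)"
    if "finite A" for A
    using that by (induction A rule: finite_induct) (simp_all add: pvar_power mult_single)
  from this[of "Poly_Mapping.keys e"] show ?thesis
    by (simp add: sum_singles pconst_def mult_single)
qed

text \<open>Algebra homomorphisms agree if they agree on the variables: this is the induction rule behind all
  identities between substitutions below.\<close>

lemma polys_induct [consumes 1, case_names const var add mult]:
  assumes p: "p \<in> polys V"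
    and "\<And>c. P (pconst c)" "\<And>i. i \<in> V \<Longrightarrow> P (pvar i)"
    and "\<And>p q. P p \<Longrightarrow> P q \<Longrightarrow> P (p + q)" "\<And>p q. P p \<Longrightarrow> P q \<Longrightarrow> P (p * q)"
  shows "P p"
proof -
  have one: "P 1" using assms(2)[of 1] by (simp add: pconst_simps)
  have zero: "P 0" using assms(2)[of 0] by (simp add: pconst_simps)
  have pow: "P (pvar i ^ n)" if "i \<in> V" for i n
    by (induction n) (use that assms one in auto)
  have prod: "P (\<Prod>i\<in>A. pvar i ^ f i)" if "finite A" "A \<subseteq> V" for A f
    using that by (induction A rule: finite_induct) (use assms one pow in auto)
  have "P (Poly_Mapping.single e c)" if "Poly_Mapping.keys e \<subseteq> V" for e c
    unfolding single_eq_prod using assms prod that by auto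
  note single = this
  have "P (\<Sum>e\<in>A. Poly_Mapping.single e (Poly_Mapping.lookup p e))"
    if "finite A" "A \<subseteq> Poly_Mapping.keys p" for A
    using that
    by (induction A rule: finite_induct) (use assms(4) p zero single in \<open>auto simp: polys_def\<close>)
  from this[of "Poly_Mapping.keys p"] show ?thesis by (simp add: sum_singles)
qed

abbreviation subst_monom :: "(nat \<Rightarrow> 'k mpoly) \<Rightarrow> (nat \<Rightarrow>\<^sub>0 nat) \<Rightarrow> 'k::field mpoly" where
  "subst_monom \<sigma> e \<equiv> (\<Prod>i\<in>Poly_Mapping.keys e. \<sigma> i ^ Poly_Mapping.lookup e i)"

lemma subst_monom_superset:
  "finite A \<Longrightarrow> Poly_Mapping.keys e \<subseteq> A \<Longrightarrow> subst_monom \<sigma> e = (\<Prod>i\<in>A. \<sigma> i ^ Poly_Mapping.lookup e i)"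
  by (rule prod.mono_neutral_left) (auto simp: in_keys_iff)

lemma subst_monom_add: "subst_monom \<sigma> (e + f) = subst_monom \<sigma> e * subst_monom \<sigma> f"
  by (subst (1 2 3) subst_monom_superset[of "Poly_Mapping.keys e \<union> Poly_Mapping.keys f"])
     (auto simp: keys_add_nat lookup_add power_add prod.distrib)

lemma psubst_superset:
  "finite A \<Longrightarrow> Poly_Mapping.keys p \<subseteq> A \<Longrightarrow>
    psubst \<sigma> p = (\<Sum>e\<in>A. pconst (Poly_Mapping.lookup p e) * subst_monom \<sigma> e)"
  unfolding psubst_def by (rule sum.mono_neutral_left) (auto simp: in_keys_iff pconst_simps)

lemma psubst_add: "psubst \<sigma> (p + q) = psubst \<sigma> p + psubst \<sigma> q"
  by (subst (1 2 3) psubst_superset[of "Poly_Mapping.keys p \<union> Poly_Mapping.keys q"])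
     (use keys_add[of p q] in \<open>auto simp: lookup_add pconst_simps distrib_right sum.distrib\<close>)

lemma psubst_single: "psubst \<sigma> (Poly_Mapping.single e c) = pconst c * subst_monom \<sigma> e"
  by (subst psubst_superset[of "{e}"]) auto

lemma psubst_pconst [simp]: "psubst \<sigma> (pconst c) = pconst c"
  unfolding pconst_def[of c] psubst_single by (simp add: pconst_def)

lemma psubst_0 [simp]: "psubst \<sigma> 0 = 0" and psubst_1 [simp]: "psubst \<sigma> 1 = 1"
  using psubst_pconst[of \<sigma> 0] psubst_pconst[of \<sigma> 1] by (simp_all add: pconst_simps)

lemma psubst_pvar [simp]: "psubst \<sigma> (pvar i) = \<sigma> i"
  unfolding pvar_def psubst_single by (simp add: pconst_simps)

lemma psubst_sum: "psubst \<sigma> (sum f A) = (\<Sum>a\<in>A. psubst \<sigma> (f a))"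
  by (induction A rule: infinite_finite_induct) (simp_all add: psubst_add)

lemma psubst_mult: "psubst \<sigma> (p * q) = psubst \<sigma> p * psubst \<sigma> q"
proof -
  let ?s = "\<lambda>p e. Poly_Mapping.single e (Poly_Mapping.lookup p e)"
  have "p * q = (\<Sum>e\<in>Poly_Mapping.keys p. ?s p e) * (\<Sum>f\<in>Poly_Mapping.keys q. ?s q f)"
    by (simp add: sum_singles)
  also have "\<dots> = (\<Sum>e\<in>Poly_Mapping.keys p. \<Sum>f\<in>Poly_Mapping.keys q. ?s p e * ?s q f)"
    by (simp add: sum_product)
  finally have "psubst \<sigma> (p * q) =
      (\<Sum>e\<in>Poly_Mapping.keys p. \<Sum>f\<in>Poly_Mapping.keys q. psubst \<sigma> (?s p e * ?s q f))"
    by (simp add: psubst_sum)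
  also have "\<dots> = psubst \<sigma> p * psubst \<sigma> q"
    unfolding psubst_def[of _ p] psubst_def[of _ q] sum_product
    by (intro sum.cong refl)
       (simp add: mult_single psubst_single subst_monom_add pconst_simps ac_simps del: prod.cong)
  finally show ?thesis .
qed

lemma psubst_uminus: "psubst \<sigma> (- p) = - psubst \<sigma> p"
  using psubst_add[of \<sigma> "- p" p] by (simp add: eq_neg_iff_add_eq_0)

lemma psubst_diff: "psubst \<sigma> (p - q) = psubst \<sigma> p - psubst \<sigma> q"
  using psubst_add[of \<sigma> p "- q"] by (simp add: psubst_uminus)

lemma psubst_power: "psubst \<sigma> (p ^ n) = psubst \<sigma> p ^ n"
  by (induction n) (simp_all add: psubst_mult)

lemma psubst_prod: "psubst \<sigma> (prod f A) = (\<Prod>a\<in>A. psubst \<sigma> (f a))"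
  by (induction A rule: infinite_finite_induct) (simp_all add: psubst_mult)

lemmas psubst_hom = psubst_add psubst_mult psubst_sum psubst_diff psubst_power psubst_prod

lemma psubst_cong:
  assumes "p \<in> polys V" "\<And>i. i \<in> V \<Longrightarrow> \<sigma> i = \<tau> i"
  shows "psubst \<sigma> p = psubst \<tau> p"
  using assms by (induction rule: polys_induct) (simp_all add: psubst_hom)

lemma psubst_comp: "psubst \<sigma> (psubst \<tau> p) = psubst (\<lambda>i. psubst \<sigma> (\<tau> i)) p"
  using polys_UNIV[of p] by (induction rule: polys_induct) (simp_all add: psubst_hom)

lemma psubst_id: "p \<in> polys V \<Longrightarrow> (\<And>i. i \<in> V \<Longrightarrow> \<sigma> i = pvar i) \<Longrightarrow> psubst \<sigma> p = p"
  by (induction rule: polys_induct) (simp_all add: psubst_hom)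

lemma psubst_in: "p \<in> polys V \<Longrightarrow> (\<And>i. i \<in> V \<Longrightarrow> \<sigma> i \<in> polys W) \<Longrightarrow> psubst \<sigma> p \<in> polys W"
  by (induction rule: polys_induct) (simp_all add: psubst_hom pconst_in polys.add_in polys.mult_in)

section \<open>Polynomial rings are completely integrally closed\<close>

lemma wf_lex_exponents:
  "wf {(e, f). Poly_Mapping.keys e \<subseteq> {..<n} \<and> Poly_Mapping.keys f \<subseteq> {..<n} \<and> (e :: nat \<Rightarrow>\<^sub>0 nat) < f}"
proof -
  let ?l = "\<lambda>e::nat \<Rightarrow>\<^sub>0 nat. map (Poly_Mapping.lookup e) [0..<n]"
  have "(?l e, ?l f) \<in> lexn less_than n"
    if "Poly_Mapping.keys e \<subseteq> {..<n}" "Poly_Mapping.keys f \<subseteq> {..<n}" "e < f" for e f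
  proof -
    from that(3) obtain k where k: "Poly_Mapping.lookup e k < Poly_Mapping.lookup f k"
      "\<And>k'. k' < k \<Longrightarrow> Poly_Mapping.lookup e k' = Poly_Mapping.lookup f k'"
      by (auto simp: less_poly_mapping.rep_eq less_fun_def)
    then have "k \<in> Poly_Mapping.keys f" by (simp add: in_keys_iff)
    then have "k < n" using that by auto
    then have "[0..<n] = [0..<k] @ k # [Suc k..<n]"
      using upt_add_eq_append[of 0 k "n - k"] by (simp add: upt_conv_Cons)
    then have "?l g = map (Poly_Mapping.lookup g) [0..<k] @ Poly_Mapping.lookup g k #
        map (Poly_Mapping.lookup g) [Suc k..<n]" for g :: "nat \<Rightarrow>\<^sub>0 nat" by simp
    moreover have "map (Poly_Mapping.lookup e) [0..<k] = map (Poly_Mapping.lookup f) [0..<k]"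
      using k(2) by simp
    ultimately show ?thesis using k(1) unfolding lexn_conv by fastforce
  qed
  then have "{(e, f). Poly_Mapping.keys e \<subseteq> {..<n} \<and> Poly_Mapping.keys f \<subseteq> {..<n} \<and> e < f} \<subseteq>
    inv_image (lexn less_than n) ?l" by (auto simp: in_inv_image)
  then show ?thesis by (rule wf_subset[OF wf_inv_image[OF wf_lexn[OF wf_less_than]]])
qed

text \<open>The leading exponent with respect to the lexicographic order, in which the variable with the smallest
  index is the most significant one.\<close>

definition lead_exp :: "'k::field mpoly \<Rightarrow> (nat \<Rightarrow>\<^sub>0 nat)" where
  "lead_exp p = Max (Poly_Mapping.keys p)"

lemma lead_exp:
  assumes "p \<noteq> 0"
  shows "lead_exp p \<in> Poly_Mapping.keys p" "e \<in> Poly_Mapping.keys p \<Longrightarrow> e \<le> lead_exp p"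
  using assms by (simp_all add: lead_exp_def)

lemma lead_exp_eqI:
  assumes "e \<in> Poly_Mapping.keys p" "\<And>f. f \<in> Poly_Mapping.keys p \<Longrightarrow> f \<le> e"
  shows "lead_exp p = e"
  unfolding lead_exp_def using assms by (intro Max_eqI) auto

lemma lookup_mult_lead:
  assumes "p \<noteq> 0" "q \<noteq> 0"
  shows "Poly_Mapping.lookup (p * q) (lead_exp p + lead_exp q) =
    Poly_Mapping.lookup p (lead_exp p) * Poly_Mapping.lookup q (lead_exp q)"
proof -
  let ?e = "lead_exp p" and ?f = "lead_exp q"
  define p' where "p' = p - Poly_Mapping.single ?e (Poly_Mapping.lookup p ?e)"
  define q' where "q' = q - Poly_Mapping.single ?f (Poly_Mapping.lookup q ?f)"
  have p': "a < ?e" if "a \<in> Poly_Mapping.keys p'" for a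
    using that lead_exp(2)[OF assms(1), of a]
    by (cases "a = ?e") (auto simp: p'_def in_keys_iff lookup_minus lookup_single when_def)
  have q': "a < ?f" if "a \<in> Poly_Mapping.keys q'" for a
    using that lead_exp(2)[OF assms(2), of a]
    by (cases "a = ?f") (auto simp: q'_def in_keys_iff lookup_minus lookup_single when_def)
  have "p * q = Poly_Mapping.single (?e + ?f) (Poly_Mapping.lookup p ?e * Poly_Mapping.lookup q ?f) +
    (p' * q + Poly_Mapping.single ?e (Poly_Mapping.lookup p ?e) * q')"
    by (simp add: p'_def q'_def algebra_simps mult_single)
  moreover have "?e + ?f \<notin> Poly_Mapping.keys (p' * q)"
  proof
    assume "?e + ?f \<in> Poly_Mapping.keys (p' * q)"
    then obtain a b where "a \<in> Poly_Mapping.keys p'" "b \<in> Poly_Mapping.keys q" "?e + ?f = a + b"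
      using keys_mult[of p' q] by auto
    then show False using p' lead_exp(2)[OF assms(2)] by (metis add_less_le_mono less_irrefl)
  qed
  moreover have "?e + ?f \<notin> Poly_Mapping.keys (Poly_Mapping.single ?e (Poly_Mapping.lookup p ?e) * q')"
  proof
    assume "?e + ?f \<in> Poly_Mapping.keys (Poly_Mapping.single ?e (Poly_Mapping.lookup p ?e) * q')"
    then obtain b where "b \<in> Poly_Mapping.keys q'" "?e + ?f = ?e + b"
      using keys_mult[of "Poly_Mapping.single ?e (Poly_Mapping.lookup p ?e)" q']
      by (auto split: if_splits)
    then show False using q' by auto
  qed
  ultimately show ?thesis by (simp add: lookup_add in_keys_iff)
qed

lemma lead_exp_mult:
  assumes "p \<noteq> 0" "q \<noteq> 0"
  shows "lead_exp (p * q) = lead_exp p + lead_exp q"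
proof (rule lead_exp_eqI)
  show "lead_exp p + lead_exp q \<in> Poly_Mapping.keys (p * q)"
    using lead_exp(1)[OF assms(1)] lead_exp(1)[OF assms(2)]
    by (simp add: in_keys_iff lookup_mult_lead[OF assms])
  fix f assume "f \<in> Poly_Mapping.keys (p * q)"
  then obtain a b where "a \<in> Poly_Mapping.keys p" "b \<in> Poly_Mapping.keys q" "f = a + b"
    using keys_mult[of p q] by auto
  then show "f \<le> lead_exp p + lead_exp q" using lead_exp(2) assms by (metis add_mono)
qed

lemma lookup_lead_exp_power:
  "p \<noteq> 0 \<Longrightarrow> Poly_Mapping.lookup (lead_exp (p ^ k)) i = k * Poly_Mapping.lookup (lead_exp p) i"
proof (induction k)
  case 0
  have "lead_exp (1::'a mpoly) = 0" by (rule lead_exp_eqI) auto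
  then show ?case by simp
qed (simp add: lead_exp_mult lookup_add)

text \<open>Division with remainder by \<open>s\<close>, one leading term at a time: \<open>d f\<^sup>k \<in> (s\<^sup>k)\<close> for all \<open>k\<close> forces
  the leading exponent of \<open>s\<close> to be at most that of \<open>f\<close> in every coordinate, and the property is
  inherited by \<open>f - u s\<close> for every \<open>u\<close>, by the binomial theorem. The lexicographic order of
  exponents in finitely many variables is well-founded, so the process ends with remainder 0.\<close>

lemma polys_completely_integrally_closed:
  fixes f s d :: "'k::field mpoly"
  assumes f: "f \<in> polys {..<n}" and s: "s \<in> polys {..<n}" and "s \<noteq> 0" "d \<noteq> 0"
    and "\<And>k. \<exists>g. d * f ^ k = s ^ k * g"
  shows "\<exists>g\<in>polys {..<n}. f = s * g"
proof -
  let ?r = "{(e, f). Poly_Mapping.keys e \<subseteq> {..<n} \<and> Poly_Mapping.keys f \<subseteq> {..<n} \<and>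
    (e :: nat \<Rightarrow>\<^sub>0 nat) < f}"
  have lead_vars: "Poly_Mapping.keys (lead_exp p) \<subseteq> {..<n}" if "p \<in> polys {..<n}" "p \<noteq> 0"
    for p :: "'k mpoly" using that lead_exp(1) by (auto simp: polys_def)
  have "f \<in> polys {..<n} \<Longrightarrow> lead_exp f = e \<Longrightarrow> (\<And>k. \<exists>g. d * f ^ k = s ^ k * g) \<Longrightarrow>
      \<exists>g\<in>polys {..<n}. f = s * g" for e f
  proof (induction e arbitrary: f rule: wf_induct_rule[OF wf_lex_exponents[of n]])
    case (1 e)
    show ?case
    proof (cases "f = 0")
      case True
      then show ?thesis by (intro bexI[of _ 0]) (simp_all add: polys.zero_in)
    next
      case False
      have le: "Poly_Mapping.lookup (lead_exp s) i \<le> Poly_Mapping.lookup (lead_exp f) i" for i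
      proof (rule ccontr)
        let ?D = "Poly_Mapping.lookup (lead_exp d) i" and ?S = "Poly_Mapping.lookup (lead_exp s) i"
          and ?F = "Poly_Mapping.lookup (lead_exp f) i"
        assume "\<not> ?S \<le> ?F"
        then have SF: "?F + 1 \<le> ?S" by simp
        \<comment> \<open>In this coordinate, \<open>s\<^sup>k\<close> outgrows \<open>d f\<^sup>k\<close> as soon as \<open>k > ?D\<close>.\<close>
        from 1(4)[of "Suc ?D"] obtain g where g: "d * f ^ Suc ?D = s ^ Suc ?D * g" by blast
        then have "g \<noteq> 0" using False assms(4) by (metis mult_eq_0_iff power_eq_0_iff)
        then have "?D + Suc ?D * ?F = Suc ?D * ?S + Poly_Mapping.lookup (lead_exp g) i"
          using arg_cong[OF g, of "\<lambda>p. Poly_Mapping.lookup (lead_exp p) i"] assms(3,4) False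
          by (simp add: lead_exp_mult lookup_add lookup_lead_exp_power del: power_Suc)
        moreover have "Suc ?D * (?F + 1) \<le> Suc ?D * ?S" using SF by (rule mult_le_mono2)
        ultimately show False by simp
      qed
      define a where "a = lead_exp f - lead_exp s"
      have a: "a + lead_exp s = lead_exp f"
        using le by (intro poly_mapping_eqI) (simp add: a_def lookup_add lookup_minus)
      define c where "c = Poly_Mapping.lookup f (lead_exp f) / Poly_Mapping.lookup s (lead_exp s)"
      define u where "u = Poly_Mapping.single a c"
      have lcs: "Poly_Mapping.lookup s (lead_exp s) \<noteq> 0" and lcf: "Poly_Mapping.lookup f (lead_exp f) \<noteq> 0"
        using lead_exp(1) assms(3) False by (auto simp: in_keys_iff)
      have u: "u \<noteq> 0" "lead_exp u = a" "Poly_Mapping.lookup u a = c"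
      proof -
        show "Poly_Mapping.lookup u a = c" by (simp add: u_def)
        moreover have "c \<noteq> 0" using lcs lcf by (simp add: c_def)
        ultimately show "u \<noteq> 0" by auto
        show "lead_exp u = a" using \<open>c \<noteq> 0\<close> by (intro lead_exp_eqI) (auto simp: u_def)
      qed
      have "Poly_Mapping.keys a \<subseteq> Poly_Mapping.keys (lead_exp f)"
        unfolding a[symmetric] keys_add_nat by blast
      then have u_in: "u \<in> polys {..<n}"
        unfolding u_def using lead_vars[OF 1(2) False] by (intro polys_single disjI2) (rule order_trans)
      define f' where "f' = f - u * s"
      have f'_in: "f' \<in> polys {..<n}"
        unfolding f'_def by (intro polys.diff_in polys.mult_in 1(2) u_in s)
      have "\<exists>g\<in>polys {..<n}. f' = s * g"
      proof (cases "f' = 0")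
        case True
        then show ?thesis by (intro bexI[of _ 0]) (simp_all add: polys.zero_in)
      next
        case f'0: False
        have us: "lead_exp (u * s) = lead_exp f"
          using u assms(3) by (simp add: lead_exp_mult a)
        have "Poly_Mapping.lookup (u * s) (lead_exp f) = Poly_Mapping.lookup f (lead_exp f)"
          using lookup_mult_lead[OF u(1) assms(3)] lcs by (simp add: u a c_def)
        then have "lead_exp f \<notin> Poly_Mapping.keys f'"
          by (simp add: f'_def in_keys_iff lookup_minus)
        moreover have "b \<le> lead_exp f" if "b \<in> Poly_Mapping.keys f'" for b
          using that keys_diff[of f "u * s"] lead_exp(2)[OF False] lead_exp(2)[of "u * s"] us u(1) assms(3)
          by (auto simp: f'_def)
        ultimately have "lead_exp f' < lead_exp f"
          using lead_exp(1)[OF f'0] by (metis order_le_less)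
        then have r: "(lead_exp f', e) \<in> ?r"
          using lead_vars[OF f'_in f'0] lead_vars[OF 1(2) False] 1(3) by simp
        show ?thesis
        proof (rule 1(1)[OF r f'_in refl])
          fix k
          from 1(4) obtain g where g: "\<And>j. d * f ^ j = s ^ j * g j" by metis
          have "d * f' ^ k = (\<Sum>j\<le>k. of_nat (k choose j) * (d * f ^ j) * (- u * s) ^ (k - j))"
            unfolding f'_def using binomial_ring[of f "- u * s" k]
            by (simp add: sum_distrib_left ac_simps)
          also have "\<dots> = (\<Sum>j\<le>k. s ^ k * (of_nat (k choose j) * g j * (- u) ^ (k - j)))"
          proof (rule sum.cong[OF refl])
            fix j assume "j \<in> {..k}"
            then have "s ^ k = s ^ j * s ^ (k - j)" by (simp flip: power_add)
            then show "of_nat (k choose j) * (d * f ^ j) * (- u * s) ^ (k - j) =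
              s ^ k * (of_nat (k choose j) * g j * (- u) ^ (k - j))"
              by (simp only: g power_mult_distrib ac_simps)
          qed
          also have "\<dots> = s ^ k * (\<Sum>j\<le>k. of_nat (k choose j) * g j * (- u) ^ (k - j))"
            by (simp only: sum_distrib_left)
          finally show "\<exists>g. d * f' ^ k = s ^ k * g" by blast
        qed
      qed
      then obtain g where "g \<in> polys {..<n}" "f' = s * g" by blast
      then show ?thesis using u_in
        by (intro bexI[of _ "u + g"]) (auto simp: f'_def algebra_simps intro: polys.add_in)
    qed
  qed
  then show ?thesis using assms by blast
qed

section \<open>Polynomials in two disjoint sets of variables\<close>

abbreviation monomial :: "(nat \<Rightarrow>\<^sub>0 nat) \<Rightarrow> 'k::field mpoly" where
  "monomial e \<equiv> Poly_Mapping.single e 1"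

lemma single_pconst: "Poly_Mapping.single e c = pconst c * monomial e"
  by (simp add: pconst_def mult_single)

definition restrict_exp :: "nat set \<Rightarrow> (nat \<Rightarrow>\<^sub>0 nat) \<Rightarrow> (nat \<Rightarrow>\<^sub>0 nat)" where
  "restrict_exp V e = Poly_Mapping.mapp (\<lambda>i x. if i \<in> V then x else 0) e"

lemma lookup_restrict_exp:
  "Poly_Mapping.lookup (restrict_exp V e) i = (if i \<in> V then Poly_Mapping.lookup e i else 0)"
  by (simp add: restrict_exp_def lookup_mapp in_keys_iff when_def)

lemma keys_restrict_exp: "Poly_Mapping.keys (restrict_exp V e) = Poly_Mapping.keys e \<inter> V"
  by (auto simp: in_keys_iff lookup_restrict_exp split: if_splits)

lemma restrict_exp_add:
  "Poly_Mapping.keys e \<subseteq> V \<Longrightarrow> Poly_Mapping.keys f \<inter> V = {} \<Longrightarrow> restrict_exp V (e + f) = e"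
  by (rule poly_mapping_eqI) (auto simp: lookup_restrict_exp lookup_add in_keys_iff)

lemma restrict_exp_split: "V1 \<inter> V2 = {} \<Longrightarrow> Poly_Mapping.keys e \<subseteq> V1 \<union> V2 \<Longrightarrow>
    restrict_exp V1 e + restrict_exp V2 e = e"
  by (rule poly_mapping_eqI) (auto simp: lookup_restrict_exp lookup_add in_keys_iff disjoint_iff)

lemma polys_add_induct [consumes 1, case_names single add]:
  assumes p: "p \<in> polys V"
    and single: "\<And>e c. Poly_Mapping.keys e \<subseteq> V \<Longrightarrow> P (Poly_Mapping.single e c)"
    and add: "\<And>p q. P p \<Longrightarrow> P q \<Longrightarrow> P (p + q)"
  shows "P p"
proof -
  have zero: "P 0" using single[of 0 0] by simp
  have "P (\<Sum>e\<in>A. Poly_Mapping.single e (Poly_Mapping.lookup p e))"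
    if "finite A" "A \<subseteq> Poly_Mapping.keys p" for A
    using that
  proof (induction A rule: finite_induct)
    case (insert e A)
    then have "Poly_Mapping.keys e \<subseteq> V" using p by (auto simp: polys_def)
    then show ?case using insert single add by simp
  qed (simp add: zero)
  from this[of "Poly_Mapping.keys p"] show ?thesis by (simp add: sum_singles)
qed

lemma pconst_mult_in: "p \<in> polys V \<Longrightarrow> pconst c * p \<in> polys V"
  by (simp add: polys.mult_in pconst_in)

text \<open>The universal property of \<open>K[V1] \<otimes>\<^sub>K K[V2] = K[V1 \<union> V2]\<close>: a map \<open>F\<close> that is biadditive and
  \<open>K\<close>-balanced modulo a subgroup \<open>J\<close> extends to a map \<open>bil\<close> on \<open>K[V1 \<union> V2]\<close> that is additive
  modulo \<open>J\<close>.\<close>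

locale balanced_map =
  fixes V1 V2 :: "nat set" and J :: "'z::ab_group_add set"
    and F :: "'k::field mpoly \<Rightarrow> 'k mpoly \<Rightarrow> 'z"
  assumes disjoint: "V1 \<inter> V2 = {}"
    and J_zero: "0 \<in> J" and J_diff: "x \<in> J \<Longrightarrow> y \<in> J \<Longrightarrow> x - y \<in> J"
    and add_left: "F (a + a') b - F a b - F a' b \<in> J"
    and add_right: "F a (b + b') - F a b - F a b' \<in> J"
    and balanced: "F (pconst c * a) b - F a (pconst c * b) \<in> J"
begin

lemma J_uminus: "x \<in> J \<Longrightarrow> - x \<in> J" using J_diff[OF J_zero, of x] by simp

lemma J_add: "x \<in> J \<Longrightarrow> y \<in> J \<Longrightarrow> x + y \<in> J" using J_diff[OF _ J_uminus, of x y] by simp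

lemma J_sum: "(\<And>i. i \<in> I \<Longrightarrow> f i \<in> J) \<Longrightarrow> sum f I \<in> J"
  by (induction I rule: infinite_finite_induct) (auto simp: J_zero J_add)

lemma J_trans: "x - y \<in> J \<Longrightarrow> y - z \<in> J \<Longrightarrow> x - z \<in> J"
  using J_add[of "x - y" "y - z"] by simp

lemma J_sym: "x - y \<in> J \<Longrightarrow> y - x \<in> J"
  using J_uminus[of "x - y"] by simp

lemma J_add_cong: "x - x' \<in> J \<Longrightarrow> y - y' \<in> J \<Longrightarrow> (x + y) - (x' + y') \<in> J"
  using J_add[of "x - x'" "y - y'"] by (simp add: algebra_simps)

lemma J_sum_cong: "(\<And>i. i \<in> I \<Longrightarrow> f i - g i \<in> J) \<Longrightarrow> sum f I - sum g I \<in> J"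
  using J_sum[of I "\<lambda>i. f i - g i"] by (simp add: sum_subtractf)

lemma zero_left: "F 0 b \<in> J"
  using J_uminus[OF add_left[of 0 0 b]] by simp

definition summand :: "'k mpoly \<Rightarrow> (nat \<Rightarrow>\<^sub>0 nat) \<Rightarrow> 'z" where
  "summand p e = F (pconst (Poly_Mapping.lookup p e) * monomial (restrict_exp V1 e)) (monomial (restrict_exp V2 e))"

definition bil :: "'k mpoly \<Rightarrow> 'z" where
  "bil p = (\<Sum>e\<in>Poly_Mapping.keys p. summand p e)"

lemma bil_superset:
  assumes "finite A" "Poly_Mapping.keys p \<subseteq> A"
  shows "bil p - (\<Sum>e\<in>A. summand p e) \<in> J"
proof -
  have "(\<Sum>e\<in>A - Poly_Mapping.keys p. summand p e) \<in> J"
    by (rule J_sum) (auto simp: summand_def in_keys_iff pconst_simps zero_left)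
  moreover have "(\<Sum>e\<in>A. summand p e) = bil p + (\<Sum>e\<in>A - Poly_Mapping.keys p. summand p e)"
    unfolding bil_def using sum.subset_diff[OF assms(2,1), of "summand p"] by (simp add: add.commute)
  ultimately show ?thesis using J_uminus by simp
qed

lemma bil_add: "bil (p + q) - (bil p + bil q) \<in> J"
proof -
  let ?A = "Poly_Mapping.keys p \<union> Poly_Mapping.keys q"
  have A: "finite ?A" by simp
  have "summand (p + q) e - (summand p e + summand q e) \<in> J" for e
    using add_left[of "pconst (Poly_Mapping.lookup p e) * monomial (restrict_exp V1 e)"
        "pconst (Poly_Mapping.lookup q e) * monomial (restrict_exp V1 e)" "monomial (restrict_exp V2 e)"]
    by (simp add: summand_def lookup_add pconst_simps distrib_right diff_diff_add)
  then have "(\<Sum>e\<in>?A. summand (p + q) e) - ((\<Sum>e\<in>?A. summand p e) + (\<Sum>e\<in>?A. summand q e)) \<in> J"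
    unfolding sum.distrib[symmetric] by (rule J_sum_cong)
  moreover have "bil (p + q) - (\<Sum>e\<in>?A. summand (p + q) e) \<in> J"
    by (rule bil_superset[OF A keys_add])
  moreover have "(bil p + bil q) - ((\<Sum>e\<in>?A. summand p e) + (\<Sum>e\<in>?A. summand q e)) \<in> J"
    by (intro J_add_cong bil_superset[OF A]) auto
  ultimately show ?thesis by (blast intro: J_trans J_sym)
qed

lemma bil_sum: "bil (sum f I) - (\<Sum>i\<in>I. bil (f i)) \<in> J"
proof (induction I rule: infinite_finite_induct)
  case (insert i I)
  have "bil (f i + sum f I) - (bil (f i) + (\<Sum>i\<in>I. bil (f i))) \<in> J"
    by (rule J_trans[OF bil_add J_add_cong]) (use insert J_zero in simp_all)
  then show ?case using insert by simp
qed (simp_all add: bil_def J_zero)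

lemma bil_single:
  "bil (Poly_Mapping.single e c) - F (pconst c * monomial (restrict_exp V1 e)) (monomial (restrict_exp V2 e)) \<in> J"
  using bil_superset[of "{e}" "Poly_Mapping.single e c"] by (simp add: summand_def)

lemma bil_mult:
  assumes "a \<in> polys V1" "b \<in> polys V2"
  shows "bil (a * b) - F a b \<in> J"
  using assms(1)
proof (induction rule: polys_add_induct)
  case (single e c)
  show ?case using assms(2)
  proof (induction rule: polys_add_induct)
    case s: (single f c')
    have "restrict_exp V1 (e + f) = e" "restrict_exp V2 (e + f) = f"
      using restrict_exp_add[of e V1 f] restrict_exp_add[of f V2 e] single s disjoint
      by (auto simp: add.commute)
    then have "bil (Poly_Mapping.single e c * Poly_Mapping.single f c') -
        F (pconst (c * c') * monomial e) (monomial f) \<in> J"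
      using bil_single[of "e + f" "c * c'"] by (simp add: mult_single)
    moreover have "F (pconst (c * c') * monomial e) (monomial f) - F (pconst c * monomial e) (pconst c' * monomial f) \<in> J"
      using balanced[of c' "pconst c * monomial e" "monomial f"] by (simp add: pconst_simps ac_simps)
    ultimately show ?case
      using J_trans by (simp only: single_pconst[of e c] single_pconst[of f c'])
  next
    case (add p q)
    have "bil (Poly_Mapping.single e c * p + Poly_Mapping.single e c * q) -
        (F (Poly_Mapping.single e c) p + F (Poly_Mapping.single e c) q) \<in> J"
      by (rule J_trans[OF bil_add J_add_cong]) (use add in simp_all)
    from J_trans[OF this J_sym, of "F (Poly_Mapping.single e c) (p + q)"]
    show ?case using add_right[of "Poly_Mapping.single e c" p q] by (simp add: distrib_left diff_diff_add)
  qed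
next
  case (add p q)
  have "bil (p * b + q * b) - (F p b + F q b) \<in> J"
    by (rule J_trans[OF bil_add J_add_cong]) (use add in simp_all)
  from J_trans[OF this J_sym, of "F (p + q) b"]
  show ?case using add_left[of p q b] by (simp add: distrib_right diff_diff_add)
qed

end

section \<open>Invariants of two groups acting on disjoint sets of variables\<close>

definition linear_subspace :: "'k::field mpoly set \<Rightarrow> bool" where
  "linear_subspace B \<longleftrightarrow> 0 \<in> B \<and> (\<forall>p\<in>B. \<forall>q\<in>B. p + q \<in> B) \<and> (\<forall>c. \<forall>p\<in>B. pconst c * p \<in> B)"

lemma linear_projection_exists:
  fixes B :: "'k::field mpoly set"
  assumes "linear_subspace B"
  obtains \<pi> where "\<And>p. \<pi> p \<in> B" "\<And>p. p \<in> B \<Longrightarrow> \<pi> p = p"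
    "\<And>p q. \<pi> (p + q) = \<pi> p + \<pi> q" "\<And>c p. \<pi> (pconst c * p) = pconst c * \<pi> p"
proof -
  let ?s = "\<lambda>c p. pconst c * p :: 'k mpoly"
  interpret vs: vector_space ?s
    by unfold_locales (simp_all add: distrib_left distrib_right pconst_simps mult.assoc)
  interpret pair: vector_space_pair ?s ?s ..
  have "vs.subspace B" using assms by (simp add: linear_subspace_def vs.subspace_def)
  moreover have "Vector_Spaces.linear ?s ?s (\<lambda>x. x)"
    by unfold_locales simp_all
  ultimately obtain \<pi> where \<pi>: "range \<pi> \<subseteq> B" "Vector_Spaces.linear ?s ?s \<pi>" "\<forall>v\<in>B. \<pi> v = v"
    using pair.linear_exists_left_inverse_on[of "\<lambda>x. x" B] by (auto simp: inj_on_def)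
  interpret \<pi>: Vector_Spaces.linear ?s ?s \<pi> by fact
  show thesis using that[of \<pi>] \<pi>(1,3) \<pi>.add \<pi>.scale by blast
qed

definition substitution_on :: "nat set \<Rightarrow> (nat \<Rightarrow> 'k::field mpoly) \<Rightarrow> bool" where
  "substitution_on V \<sigma> \<longleftrightarrow> (\<forall>i. if i \<in> V then \<sigma> i \<in> polys V else \<sigma> i = pvar i)"

definition invariants :: "nat set \<Rightarrow> (nat \<Rightarrow> 'k::field mpoly) set \<Rightarrow> 'k mpoly set" where
  "invariants V H = {p \<in> polys V. \<forall>\<sigma>\<in>H. psubst \<sigma> p = p}"

lemma invariants_closed: "closed_under_ring_ops (invariants V H)"
  by unfold_locales
    (auto simp: invariants_def psubst_hom intro: polys.one_in polys.diff_in polys.mult_in)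

global_interpretation invariants: closed_under_ring_ops "invariants V H" for V H
  by (rule invariants_closed)

lemma linear_subspace_invariants: "linear_subspace (invariants V H)"
  by (auto simp: linear_subspace_def invariants_def psubst_hom intro: polys.zero_in polys.add_in pconst_mult_in)

lemma psubst_on:
  assumes "substitution_on V \<sigma>"
  shows "p \<in> polys V \<Longrightarrow> psubst \<sigma> p \<in> polys V" and "p \<in> polys W \<Longrightarrow> W \<inter> V = {} \<Longrightarrow> psubst \<sigma> p = p"
proof -
  show "p \<in> polys V \<Longrightarrow> psubst \<sigma> p \<in> polys V"
    by (rule psubst_in) (use assms in \<open>auto simp: substitution_on_def split: if_splits\<close>)
  show "p \<in> polys W \<Longrightarrow> W \<inter> V = {} \<Longrightarrow> psubst \<sigma> p = p"
    by (rule psubst_id) (use assms in \<open>auto simp: substitution_on_def split: if_splits\<close>)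
qed

lemma lookup_mono_mult:
  "Poly_Mapping.lookup (monomial f * a) (f + e) = Poly_Mapping.lookup a (e :: nat \<Rightarrow>\<^sub>0 nat)"
proof (induction rule: polys_add_induct[OF polys_UNIV[of a]])
  case (1 e' c)
  show ?case by (simp add: mult_single lookup_single when_def)
next
  case (2 p q)
  then show ?case by (simp add: distrib_left lookup_add)
qed

text \<open>The monomials in the variables outside \<open>V\<close> are linearly independent over \<open>K[V]\<close>.\<close>

lemma mono_independent:
  assumes "finite M" and M: "\<And>f. f \<in> M \<Longrightarrow> Poly_Mapping.keys f \<inter> V = {}"
    and a: "\<And>f. f \<in> M \<Longrightarrow> a f \<in> polys V" and zero: "(\<Sum>f\<in>M. monomial f * a f) = 0" and f: "f \<in> M"
  shows "a f = 0"
proof (rule poly_mapping_eqI)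
  fix e
  show "Poly_Mapping.lookup (a f) e = Poly_Mapping.lookup 0 e"
  proof (cases "Poly_Mapping.keys e \<subseteq> V")
    case True
    have "Poly_Mapping.lookup (monomial f' * a f') (f + e) = (if f' = f then Poly_Mapping.lookup (a f) e else 0)"
      if f': "f' \<in> M" for f'
    proof (cases "f' = f")
      case False
      have "f + e \<notin> Poly_Mapping.keys (monomial f' * a f')"
      proof
        assume "f + e \<in> Poly_Mapping.keys (monomial f' * a f')"
        then obtain b where b: "b \<in> Poly_Mapping.keys (a f')" "f + e = f' + b"
          using keys_mult[of "monomial f'" "a f'"] by auto
        then have "Poly_Mapping.keys b \<subseteq> V" using a[OF f'] by (auto simp: polys_def)
        then have "restrict_exp (- V) (f' + b) = f'"
          using M[OF f'] by (intro restrict_exp_add) auto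
        moreover have "restrict_exp (- V) (f + e) = f"
          using M[OF f] True by (intro restrict_exp_add) auto
        ultimately show False using b False by simp
      qed
      then show ?thesis using False by (simp add: in_keys_iff)
    qed (simp add: lookup_mono_mult)
    then have "Poly_Mapping.lookup (\<Sum>f\<in>M. monomial f * a f) (f + e) =
        (\<Sum>f'\<in>M. if f' = f then Poly_Mapping.lookup (a f) e else 0)"
      unfolding lookup_sum by (rule sum.cong[OF refl])
    then show ?thesis using f \<open>finite M\<close> zero by simp
  next
    case False
    then show ?thesis using a[OF f] by (auto simp: polys_def in_keys_iff)
  qed
qed

text \<open>A group that acts on the variables in \<open>V\<close> acts separately on the coefficients, in \<open>K[V]\<close>, of the
  monomials in the other variables.\<close>

lemma invariants_expansion:
  assumes H: "\<And>\<sigma>. \<sigma> \<in> H \<Longrightarrow> substitution_on V \<sigma>"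
    and p: "p \<in> polys (W \<union> V)" "W \<inter> V = {}" "\<And>\<sigma>. \<sigma> \<in> H \<Longrightarrow> psubst \<sigma> p = p"
  obtains M b where "finite M" "\<And>f. f \<in> M \<Longrightarrow> Poly_Mapping.keys f \<subseteq> W"
    "\<And>f. f \<in> M \<Longrightarrow> b f \<in> invariants V H" "p = (\<Sum>f\<in>M. monomial f * b f)"
proof -
  let ?r = "restrict_exp W"
  define M where "M = ?r ` Poly_Mapping.keys p"
  define b where "b f = (\<Sum>e\<in>{e \<in> Poly_Mapping.keys p. ?r e = f}.
    Poly_Mapping.single (restrict_exp V e) (Poly_Mapping.lookup p e))" for f
  have M: "finite M" "\<And>f. f \<in> M \<Longrightarrow> Poly_Mapping.keys f \<subseteq> W"
    by (auto simp: M_def keys_restrict_exp)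
  have b_in: "b f \<in> polys V" for f
    unfolding b_def by (intro polys.sum_in polys_single) (auto simp: keys_restrict_exp)
  have "(\<Sum>f\<in>M. monomial f * b f) = (\<Sum>f\<in>M. \<Sum>e\<in>{e \<in> Poly_Mapping.keys p. ?r e = f}.
      Poly_Mapping.single e (Poly_Mapping.lookup p e))"
    unfolding b_def sum_distrib_left
  proof (intro sum.cong refl)
    fix f e assume "e \<in> {e \<in> Poly_Mapping.keys p. ?r e = f}"
    moreover from this have "Poly_Mapping.keys e \<subseteq> W \<union> V" using p(1) by (auto simp: polys_def)
    ultimately show "monomial f * Poly_Mapping.single (restrict_exp V e) (Poly_Mapping.lookup p e) =
        Poly_Mapping.single e (Poly_Mapping.lookup p e)"
      using restrict_exp_split[OF p(2), of e] by (auto simp: mult_single)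
  qed
  also have "\<dots> = (\<Sum>e\<in>Poly_Mapping.keys p. Poly_Mapping.single e (Poly_Mapping.lookup p e))"
    unfolding M_def by (rule sum.image_gen[symmetric]) simp
  finally have eq: "p = (\<Sum>f\<in>M. monomial f * b f)" by (simp add: sum_singles)
  have "psubst \<sigma> (b f) = b f" if \<sigma>: "\<sigma> \<in> H" and f: "f \<in> M" for \<sigma> f
  proof -
    have on: "substitution_on V \<sigma>" by (rule H[OF \<sigma>])
    have "psubst \<sigma> (monomial f) = monomial f" if "f \<in> M" for f
      by (rule psubst_on(2)[OF on _ p(2)]) (use M(2)[OF that] in \<open>simp add: polys_single\<close>)
    then have "psubst \<sigma> p = (\<Sum>f\<in>M. monomial f * psubst \<sigma> (b f))"
      unfolding eq psubst_hom by (intro sum.cong refl) simp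
    then have "(\<Sum>f\<in>M. monomial f * (psubst \<sigma> (b f) - b f)) = 0"
      using p(3)[OF \<sigma>] by (simp add: right_diff_distrib sum_subtractf flip: eq)
    then have "psubst \<sigma> (b f) - b f = 0"
      by (rule mono_independent[where V = V, OF M(1) _ _ _ f, rotated 2])
         (use M(2) p(2) in \<open>auto intro!: polys.diff_in psubst_on(1)[OF on] b_in\<close>)
    then show ?thesis by simp
  qed
  then show thesis using that[OF M, of b] eq b_in by (simp add: invariants_def)
qed

text \<open>The invariants of \<open>H1 \<times> H2\<close> in \<open>K[V1 \<union> V2] = K[V1] \<otimes>\<^sub>K K[V2]\<close> are
  \<open>K[V1]\<^sup>H\<^sup>1 \<otimes>\<^sub>K K[V2]\<^sup>H\<^sup>2\<close>: linear projections \<open>\<pi>1\<close>, \<open>\<pi>2\<close> onto the two rings of invariants give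
  projections \<open>\<pi>1 \<otimes> id\<close> and \<open>id \<otimes> \<pi>2\<close>, and both fix every element that is invariant under \<open>H1\<close>
  and \<open>H2\<close>. So \<open>\<pi>1 \<otimes> \<pi>2\<close> does, too.\<close>

lemma invariants_product:
  fixes p :: "'k::field mpoly"
  assumes disj: "V1 \<inter> V2 = {}"
    and H1: "\<And>\<sigma>. \<sigma> \<in> H1 \<Longrightarrow> substitution_on V1 \<sigma>"
    and H2: "\<And>\<sigma>. \<sigma> \<in> H2 \<Longrightarrow> substitution_on V2 \<sigma>"
    and p: "p \<in> polys (V1 \<union> V2)" "\<And>\<sigma>. \<sigma> \<in> H1 \<union> H2 \<Longrightarrow> psubst \<sigma> p = p"
  obtains I :: "(nat \<Rightarrow>\<^sub>0 nat) set" and a b where "finite I"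
    "\<And>i. i \<in> I \<Longrightarrow> a i \<in> invariants V1 H1" "\<And>i. i \<in> I \<Longrightarrow> b i \<in> invariants V2 H2"
    "p = (\<Sum>i\<in>I. a i * b i)"
proof -
  obtain \<pi>1 where \<pi>1: "\<And>p. \<pi>1 p \<in> invariants V1 H1" "\<And>p. p \<in> invariants V1 H1 \<Longrightarrow> \<pi>1 p = p"
    "\<And>p q. \<pi>1 (p + q) = \<pi>1 p + \<pi>1 q" "\<And>c p. \<pi>1 (pconst c * p) = pconst c * \<pi>1 p"
    using linear_projection_exists[OF linear_subspace_invariants] by blast
  obtain \<pi>2 where \<pi>2: "\<And>p. \<pi>2 p \<in> invariants V2 H2" "\<And>p. p \<in> invariants V2 H2 \<Longrightarrow> \<pi>2 p = p"
    "\<And>p q. \<pi>2 (p + q) = \<pi>2 p + \<pi>2 q" "\<And>c p. \<pi>2 (pconst c * p) = pconst c * \<pi>2 p"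
    using linear_projection_exists[OF linear_subspace_invariants] by blast
  interpret L2: balanced_map V1 V2 "{0}" "\<lambda>a b. a * \<pi>2 b"
    by unfold_locales (use disj \<pi>2 in \<open>simp_all add: algebra_simps\<close>)
  interpret L1: balanced_map V1 V2 "{0}" "\<lambda>a b. \<pi>1 a * b"
    by unfold_locales (use disj \<pi>1 in \<open>simp_all add: algebra_simps\<close>)
  have inv: "a \<in> polys V" if "a \<in> invariants V H" for a :: "'k mpoly" and V H
    using that by (simp add: invariants_def)
  have "L2.bil p = p"
  proof -
    obtain M b where M: "finite M" "\<And>f. f \<in> M \<Longrightarrow> Poly_Mapping.keys f \<subseteq> V1"
      "\<And>f. f \<in> M \<Longrightarrow> b f \<in> invariants V2 H2" "p = (\<Sum>f\<in>M. monomial f * b f)"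
      using invariants_expansion[OF H2 p(1) disj] p(2) by blast
    have "L2.bil p = (\<Sum>f\<in>M. L2.bil (monomial f * b f))"
      using L2.bil_sum[of "\<lambda>f. monomial f * b f" M] M(4) by simp
    also have "\<dots> = (\<Sum>f\<in>M. monomial f * b f)"
    proof (rule sum.cong[OF refl])
      fix f assume f: "f \<in> M"
      have "L2.bil (monomial f * b f) - monomial f * \<pi>2 (b f) \<in> {0}"
        by (rule L2.bil_mult) (use M(2,3)[OF f] inv in \<open>auto intro: polys_single\<close>)
      then show "L2.bil (monomial f * b f) = monomial f * b f" using \<pi>2(2)[OF M(3)[OF f]] by simp
    qed
    finally show ?thesis using M(4) by simp
  qed
  then have p2: "p = (\<Sum>e\<in>Poly_Mapping.keys p.
      (pconst (Poly_Mapping.lookup p e) * monomial (restrict_exp V1 e)) * \<pi>2 (monomial (restrict_exp V2 e)))"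
    by (simp add: L2.bil_def L2.summand_def)
  have "L1.bil p = p"
  proof -
    have p1: "p \<in> polys (V2 \<union> V1)" "V2 \<inter> V1 = {}" using p(1) disj by (auto simp: Un_commute)
    obtain M b where M: "finite M" "\<And>f. f \<in> M \<Longrightarrow> Poly_Mapping.keys f \<subseteq> V2"
      "\<And>f. f \<in> M \<Longrightarrow> b f \<in> invariants V1 H1" "p = (\<Sum>f\<in>M. monomial f * b f)"
      using invariants_expansion[OF H1 p1] p(2) by blast
    have "L1.bil p = (\<Sum>f\<in>M. L1.bil (b f * monomial f))"
      using L1.bil_sum[of "\<lambda>f. monomial f * b f" M] M(4) by (simp add: mult.commute)
    also have "\<dots> = (\<Sum>f\<in>M. monomial f * b f)"
    proof (rule sum.cong[OF refl])
      fix f assume f: "f \<in> M"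
      have "L1.bil (b f * monomial f) - \<pi>1 (b f) * monomial f \<in> {0}"
        by (rule L1.bil_mult) (use M(2,3)[OF f] inv in \<open>auto intro: polys_single\<close>)
      then show "L1.bil (b f * monomial f) = monomial f * b f"
        using \<pi>1(2)[OF M(3)[OF f]] by (simp add: mult.commute)
    qed
    finally show ?thesis using M(4) by simp
  qed
  moreover have "L1.bil p = (\<Sum>e\<in>Poly_Mapping.keys p.
      \<pi>1 (pconst (Poly_Mapping.lookup p e) * monomial (restrict_exp V1 e)) * \<pi>2 (monomial (restrict_exp V2 e)))"
  proof -
    let ?a = "\<lambda>e. pconst (Poly_Mapping.lookup p e) * monomial (restrict_exp V1 e)"
    let ?b = "\<lambda>e. \<pi>2 (monomial (restrict_exp V2 e))"
    have "L1.bil p = (\<Sum>e\<in>Poly_Mapping.keys p. L1.bil (?a e * ?b e))"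
      using L1.bil_sum[of "\<lambda>e. ?a e * ?b e" "Poly_Mapping.keys p"] by (simp flip: p2)
    also have "\<dots> = (\<Sum>e\<in>Poly_Mapping.keys p. \<pi>1 (?a e) * ?b e)"
    proof (rule sum.cong[OF refl])
      fix e
      have "L1.bil (?a e * ?b e) - \<pi>1 (?a e) * ?b e \<in> {0}"
        by (rule L1.bil_mult) (auto simp: keys_restrict_exp intro!: pconst_mult_in polys_single inv[OF \<pi>2(1)])
      then show "L1.bil (?a e * ?b e) = \<pi>1 (?a e) * ?b e" by simp
    qed
    finally show ?thesis .
  qed
  ultimately have "p = (\<Sum>e\<in>Poly_Mapping.keys p.
      \<pi>1 (pconst (Poly_Mapping.lookup p e) * monomial (restrict_exp V1 e)) * \<pi>2 (monomial (restrict_exp V2 e)))"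
    by simp
  from that[OF finite_keys _ _ this] \<pi>1(1) \<pi>2(1) show thesis by blast
qed

section \<open>The characteristic polynomial of a twisted invariant\<close>

text \<open>The additive span of the products; for subrings \<open>A\<close> and \<open>B\<close> this is the image of \<open>A \<otimes> B\<close>.\<close>

inductive_set mult_span :: "'c::comm_ring_1 set \<Rightarrow> 'c set \<Rightarrow> 'c set" for A B where
  zero: "0 \<in> mult_span A B"
| step: "a \<in> A \<Longrightarrow> b \<in> B \<Longrightarrow> s \<in> mult_span A B \<Longrightarrow> a * b + s \<in> mult_span A B"

lemma mult_span_add: "s \<in> mult_span A B \<Longrightarrow> t \<in> mult_span A B \<Longrightarrow> s + t \<in> mult_span A B"
  by (induction rule: mult_span.induct) (auto simp: add.assoc intro: mult_span.step)

lemma mult_span_mult: "a \<in> A \<Longrightarrow> b \<in> B \<Longrightarrow> a * b \<in> mult_span A B"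
  using mult_span.step[OF _ _ mult_span.zero] by fastforce

lemma mult_span_sum: "(\<And>i. i \<in> I \<Longrightarrow> f i \<in> mult_span A B) \<Longrightarrow> sum f I \<in> mult_span A B"
  by (induction I rule: infinite_finite_induct) (auto intro: mult_span.zero mult_span_add)

lemma mult_span_mono: "s \<in> mult_span A B \<Longrightarrow> A \<subseteq> A' \<Longrightarrow> B \<subseteq> B' \<Longrightarrow> s \<in> mult_span A' B'"
  by (induction rule: mult_span.induct) (auto intro: mult_span.intros)

definition root_poly :: "'i set \<Rightarrow> ('i \<Rightarrow> 'c::idom) \<Rightarrow> 'c poly" where
  "root_poly A f = (\<Prod>h\<in>A. [:- f h, 1:])"

lemma root_poly_monic:
  assumes "finite A"
  shows "Polynomial.degree (root_poly A f) = card A" "Polynomial.coeff (root_poly A f) (card A) = 1"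
proof -
  have "root_poly A f \<noteq> 0 \<and> Polynomial.degree (root_poly A f) = card A \<and>
      Polynomial.coeff (root_poly A f) (card A) = 1"
    using assms
  proof (induction A rule: finite_induct)
    case (insert h A)
    have eq: "root_poly (insert h A) f = [:- f h, 1:] * root_poly A f"
      using insert by (simp add: root_poly_def)
    have "Polynomial.degree (root_poly (insert h A) f) = card (insert h A)"
      unfolding eq by (subst degree_mult_eq) (use insert in auto)
    moreover have "Polynomial.coeff (root_poly (insert h A) f) (card (insert h A)) = 1"
      unfolding eq using insert by (simp add: coeff_eq_0)
    ultimately show ?case by auto
  qed (simp add: root_poly_def)
  then show "Polynomial.degree (root_poly A f) = card A" "Polynomial.coeff (root_poly A f) (card A) = 1"
    by auto
qed

lemma root_poly_root: "finite A \<Longrightarrow> h \<in> A \<Longrightarrow> poly (root_poly A f) (f h) = 0"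
  by (auto simp: root_poly_def poly_prod)

lemma coeff_root_poly_insert:
  assumes "finite A" "h \<notin> A"
  shows "Polynomial.coeff (root_poly (insert h A) f) i =
    (case i of 0 \<Rightarrow> 0 | Suc j \<Rightarrow> Polynomial.coeff (root_poly A f) j) - f h * Polynomial.coeff (root_poly A f) i"
proof -
  have "root_poly (insert h A) f = [:- f h, 1:] * root_poly A f"
    using assms by (simp add: root_poly_def)
  then show ?thesis by (simp add: coeff_pCons split: nat.split)
qed

lemma coeff_root_poly_in:
  assumes "closed_under_ring_ops S" "finite A" "\<And>h. h \<in> A \<Longrightarrow> f h \<in> S"
  shows "Polynomial.coeff (root_poly A f) i \<in> S"
proof -
  interpret closed_under_ring_ops S by fact
  show ?thesis using assms(2,3)
    by (induction A arbitrary: i rule: finite_induct)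
       (auto simp: coeff_root_poly_insert root_poly_def[of "{}"] one_in zero_in coeff_1
         intro!: diff_in mult_in uminus_in split: nat.split)
qed

lemma psubst_coeff_root_poly:
  assumes "finite A"
  shows "psubst \<sigma> (Polynomial.coeff (root_poly A f) i) =
    Polynomial.coeff (root_poly A (\<lambda>h. psubst \<sigma> (f h))) i"
  using assms
  by (induction A arbitrary: i rule: finite_induct)
     (auto simp: coeff_root_poly_insert root_poly_def[of "{}"] psubst_hom split: nat.split)

lemma root_poly_reindex:
  assumes "bij_betw \<pi> A A"
  shows "root_poly A (\<lambda>h. f (\<pi> h)) = root_poly A f"
  unfolding root_poly_def using assms by (rule prod.reindex_bij_betw)

lemma substitution_on_in:
  "substitution_on A \<sigma> \<Longrightarrow> A \<subseteq> B \<Longrightarrow> i \<in> B \<Longrightarrow> \<sigma> i \<in> polys B"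
  by (cases "i \<in> A") (auto simp: substitution_on_def intro: polys_mono pvar_in)

lemma substitutions_commute:
  assumes \<sigma>: "substitution_on A \<sigma>" and \<tau>: "substitution_on B \<tau>" and "A \<inter> B = {}"
  shows "psubst \<sigma> (psubst \<tau> p) = psubst \<tau> (psubst \<sigma> p)"
proof -
  have "psubst \<sigma> (\<tau> i) = psubst \<tau> (\<sigma> i)" for i
  proof -
    consider "i \<in> A" "i \<notin> B" | "i \<in> B" "i \<notin> A" | "i \<notin> A" "i \<notin> B" using assms(3) by blast
    then show ?thesis
    proof cases
      case 1
      then have "\<sigma> i \<in> polys A" "\<tau> i = pvar i" using \<sigma> \<tau> by (auto simp: substitution_on_def)
      then show ?thesis using psubst_on(2)[OF \<tau>, of "\<sigma> i" A] assms(3) by simp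
    next
      case 2
      then have "\<tau> i \<in> polys B" "\<sigma> i = pvar i" using \<sigma> \<tau> by (auto simp: substitution_on_def)
      then show ?thesis using psubst_on(2)[OF \<sigma>, of "\<tau> i" B] assms(3) by (simp add: Int_commute)
    next
      case 3
      then have "\<sigma> i = pvar i" "\<tau> i = pvar i" using \<sigma> \<tau> by (auto simp: substitution_on_def)
      then show ?thesis by simp
    qed
  qed
  then show ?thesis by (simp add: psubst_comp)
qed

context group
begin

text \<open>Substitutions compose contravariantly, as \<open>(f \<circ> M) \<circ> N = f \<circ> (M N)\<close>: the group acts from
  the right.\<close>

definition action_on :: "nat set \<Rightarrow> ('a \<Rightarrow> nat \<Rightarrow> 'k::field mpoly) \<Rightarrow> bool" where
  "action_on Z s \<longleftrightarrow> (\<forall>g\<in>carrier G. substitution_on Z (s g)) \<and>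
     (\<forall>p. psubst (s \<one>) p = p) \<and>
     (\<forall>g\<in>carrier G. \<forall>h\<in>carrier G. \<forall>p. psubst (s g) (psubst (s h) p) = psubst (s (h \<otimes> g)) p)"

lemma action_onD:
  assumes "action_on Z s"
  shows "g \<in> carrier G \<Longrightarrow> substitution_on Z (s g)" "psubst (s \<one>) p = p"
    "g \<in> carrier G \<Longrightarrow> h \<in> carrier G \<Longrightarrow> psubst (s g) (psubst (s h) p) = psubst (s (h \<otimes> g)) p"
  using assms by (auto simp: action_on_def)

lemma bij_mult: "g \<in> carrier G \<Longrightarrow> bij_betw (\<lambda>h. h \<otimes> g) (carrier G) (carrier G)"
  "g \<in> carrier G \<Longrightarrow> bij_betw (\<lambda>h. g \<otimes> h) (carrier G) (carrier G)"
  by (intro bij_betwI[of _ _ _ "\<lambda>h. h \<otimes> inv g"]; simp add: m_assoc)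
     (intro bij_betwI[of _ _ _ "\<lambda>h. inv g \<otimes> h"]; simp flip: m_assoc)

text \<open>Two actions \<open>s\<close>, \<open>t\<close> on disjoint sets of variables commute. If \<open>z\<close> is invariant under the
  diagonal action, then every \<open>s\<^sub>g\<close> permutes the elements \<open>t\<^sub>h z\<close>, because \<open>s\<^sub>g z = t\<^sub>g\<inverse> z\<close>; so
  the coefficients of \<open>\<Prod>\<^sub>h (T - t\<^sub>h z)\<close>, a monic polynomial with root \<open>z\<close>, are invariant under
  both actions separately.\<close>

lemma twisted_coeffs_invariant:
  assumes fin: "finite (carrier G)" and s: "action_on Z s" and t: "action_on Z' t" and disj: "Z \<inter> Z' = {}"
    and z: "\<And>g. g \<in> carrier G \<Longrightarrow> psubst (s g) (psubst (t g) z) = z" and g: "g \<in> carrier G"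
  defines "P \<equiv> root_poly (carrier G) (\<lambda>h. psubst (t h) z)"
  shows "psubst (s g) (Polynomial.coeff P i) = Polynomial.coeff P i"
    and "psubst (t g) (Polynomial.coeff P i) = Polynomial.coeff P i"
proof -
  note comm = substitutions_commute[OF action_onD(1)[OF s] action_onD(1)[OF t] disj]
  have sz: "psubst (s g) z = psubst (t (inv g)) z"
  proof -
    have "psubst (t (inv g)) z = psubst (t (inv g)) (psubst (t g) (psubst (s g) z))"
      using z[OF g] comm[OF g g] by simp
    also have "\<dots> = psubst (s g) z"
      using action_onD(3)[OF t, of "inv g" g] action_onD(2)[OF t] g by simp
    finally show ?thesis by simp
  qed
  have "psubst (s g) (psubst (t h) z) = psubst (t (inv g \<otimes> h)) z" if h: "h \<in> carrier G" for h
    using comm[OF g h, of z] action_onD(3)[OF t h, of "inv g" z] g h by (simp add: sz)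
  then have "root_poly (carrier G) (\<lambda>h. psubst (s g) (psubst (t h) z)) =
      root_poly (carrier G) (\<lambda>h. psubst (t (inv g \<otimes> h)) z)"
    unfolding root_poly_def by (intro prod.cong) auto
  also have "\<dots> = P"
    unfolding P_def using root_poly_reindex[OF bij_mult(2)[of "inv g"], of "\<lambda>h. psubst (t h) z"] g by simp
  finally show "psubst (s g) (Polynomial.coeff P i) = Polynomial.coeff P i"
    by (simp add: P_def psubst_coeff_root_poly[OF fin])
  have "psubst (t g) (psubst (t h) z) = psubst (t (h \<otimes> g)) z" if h: "h \<in> carrier G" for h
    using action_onD(3)[OF t g h] .
  then have "root_poly (carrier G) (\<lambda>h. psubst (t g) (psubst (t h) z)) =
      root_poly (carrier G) (\<lambda>h. psubst (t (h \<otimes> g)) z)"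
    unfolding root_poly_def by (intro prod.cong) auto
  also have "\<dots> = P"
    unfolding P_def using root_poly_reindex[OF bij_mult(1)[of g], of "\<lambda>h. psubst (t h) z"] g by simp
  finally show "psubst (t g) (Polynomial.coeff P i) = Polynomial.coeff P i"
    by (simp add: P_def psubst_coeff_root_poly[OF fin])
qed

lemma action_on_compose:
  assumes s: "action_on Z s" and t: "action_on Z' t" and disj: "Z \<inter> Z' = {}"
  shows "action_on (Z \<union> Z') (\<lambda>g i. psubst (s g) (t g i))"
    and "psubst (\<lambda>i. psubst (s g) (t g i)) p = psubst (s g) (psubst (t g) p)"
proof -
  show eq: "psubst (\<lambda>i. psubst (s g) (t g i)) p = psubst (s g) (psubst (t g) p)" for g p
    by (simp add: psubst_comp)
  note comm = substitutions_commute[OF action_onD(1)[OF s] action_onD(1)[OF t] disj]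
  have "substitution_on (Z \<union> Z') (\<lambda>i. psubst (s g) (t g i))" if g: "g \<in> carrier G" for g
  proof -
    have s': "substitution_on Z (s g)" and t': "substitution_on Z' (t g)"
      using action_onD(1) s t g by auto
    have "psubst (s g) (t g i) \<in> polys (Z \<union> Z')" if "i \<in> Z \<union> Z'" for i
    proof (rule psubst_in[where V = "Z \<union> Z'"])
      show "t g i \<in> polys (Z \<union> Z')"
        using substitution_on_in[OF t'] that by blast
      show "s g j \<in> polys (Z \<union> Z')" if "j \<in> Z \<union> Z'" for j
        using substitution_on_in[OF s'] that by blast
    qed
    then show ?thesis using s' t' by (auto simp: substitution_on_def)
  qed
  moreover have "psubst (s g) (psubst (t g) (psubst (s h) (psubst (t h) p))) =
      psubst (s (h \<otimes> g)) (psubst (t (h \<otimes> g)) p)" if "g \<in> carrier G" "h \<in> carrier G" for g h p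
    using that by (simp add: comm[symmetric] action_onD(3)[OF s] action_onD(3)[OF t])
  ultimately show "action_on (Z \<union> Z') (\<lambda>g i. psubst (s g) (t g i))"
    unfolding action_on_def by (simp add: eq action_onD(2)[OF s] action_onD(2)[OF t])
qed

section \<open>Trace forms\<close>

text \<open>This is the point where faithfulness is used. Multiplying \<open>\<Sum>\<^sub>i p\<^sub>i \<otimes> q\<^sub>i\<close> by
  \<open>x \<otimes> 1 - 1 \<otimes> (s\<^sub>g\<inverse> x)\<close> makes the value \<open>\<Sum>\<^sub>i p\<^sub>i s\<^sub>h(q\<^sub>i)\<close> at \<open>h = g\<close> vanish and multiplies
  the value at \<open>h = \<one>\<close> by \<open>x - s\<^sub>g\<inverse> x\<close>, which is non-zero for a suitable \<open>x\<close>.\<close>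

lemma separating_elements:
  fixes s :: "'a \<Rightarrow> nat \<Rightarrow> 'k::field mpoly"
  assumes s: "action_on Z s"
    and faithful: "\<And>g. g \<in> carrier G \<Longrightarrow> g \<noteq> \<one> \<Longrightarrow> \<exists>x\<in>polys Z. psubst (s g) x \<noteq> x"
    and "finite H" "H \<subseteq> carrier G - {\<one>}"
  shows "\<exists>ps. (\<forall>(p, q)\<in>set ps. p \<in> polys Z \<and> q \<in> polys Z) \<and>
    (\<forall>h\<in>H. (\<Sum>(p, q)\<leftarrow>ps. p * psubst (s h) q) = 0) \<and> (\<Sum>(p, q)\<leftarrow>ps. p * q) \<noteq> 0"
  using assms(3,4)
proof (induction H rule: finite_induct)
  case empty
  show ?case by (rule exI[of _ "[(1, 1)]"]) (simp add: polys.one_in)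
next
  case (insert g H)
  then obtain ps where ps: "\<And>p q. (p, q) \<in> set ps \<Longrightarrow> p \<in> polys Z \<and> q \<in> polys Z"
    "\<And>h. h \<in> H \<Longrightarrow> (\<Sum>(p, q)\<leftarrow>ps. p * psubst (s h) q) = 0" "(\<Sum>(p, q)\<leftarrow>ps. p * q) \<noteq> 0"
    by auto
  have g: "g \<in> carrier G" "g \<noteq> \<one>" using insert by auto
  then have "inv g \<in> carrier G" "inv g \<noteq> \<one>" by (simp_all add: inv_eq_1_iff)
  then obtain x where x: "x \<in> polys Z" "psubst (s (inv g)) x \<noteq> x" using faithful by blast
  define y where "y = psubst (s (inv g)) x"
  have y: "y \<in> polys Z"
    unfolding y_def by (rule psubst_on(1)[OF action_onD(1)[OF s]]) (use g x in auto)
  let ?ps = "map (\<lambda>(p, q). (x * p, q)) ps @ map (\<lambda>(p, q). (- p, y * q)) ps"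
  have sum: "(\<Sum>(p, q)\<leftarrow>?ps. p * psubst \<sigma> q) = (x - psubst \<sigma> y) * (\<Sum>(p, q)\<leftarrow>ps. p * psubst \<sigma> q)" for \<sigma>
    by (induction ps) (auto simp: psubst_mult algebra_simps)
  have "psubst (s g) y = x"
    using action_onD(2,3)[OF s] g by (simp add: y_def)
  then have "(\<Sum>(p, q)\<leftarrow>?ps. p * psubst (s h) q) = 0" if "h \<in> insert g H" for h
    unfolding sum using that ps(2) by auto
  moreover have "(\<Sum>(p, q)\<leftarrow>?ps. p * q) \<noteq> 0"
    using sum[of "s \<one>"] ps(3) x(2) by (simp add: action_onD(2)[OF s] y_def)
  moreover have "\<forall>(p, q)\<in>set ?ps. p \<in> polys Z \<and> q \<in> polys Z"
    using ps(1) x(1) y by (auto intro: polys.mult_in polys.uminus_in)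
  ultimately show ?case by blast
qed

end

section \<open>Invariants of the diagonal action\<close>

lemma substitution_on_mono: "substitution_on A \<sigma> \<Longrightarrow> A \<subseteq> B \<Longrightarrow> substitution_on B \<sigma>"
  unfolding substitution_on_def by (metis pvar_in polys_mono subsetD)

text \<open>\<open>G\<close> acts separately on four disjoint sets of variables. The set \<open>Y\<close> is a copy of \<open>U\<close>, and \<open>spec\<close> is the
  substitution that identifies the variables in \<open>Y\<close> with those in \<open>U\<close>. The rings of functions on
  the two quotients are \<open>B1\<close>, in the variables \<open>U\<close>, \<open>W\<close>, and \<open>B2\<close>, in the variables \<open>U\<close>, \<open>V\<close>; the ring
  \<open>B2'\<close> is the copy of \<open>B2\<close> with \<open>Y\<close> in place of \<open>U\<close>. All of these are invariants of diagonal actions.\<close>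

locale fibre_product_actions = group G for G (structure) +
  fixes U W V Y :: "nat set"
    and sX sW sV sY :: "'a \<Rightarrow> nat \<Rightarrow> 'k::field mpoly"
    and spec :: "nat \<Rightarrow> 'k mpoly"
  assumes finite_group: "finite (carrier G)"
    and disjoint: "U \<inter> W = {}" "U \<inter> V = {}" "W \<inter> V = {}" "Y \<inter> U = {}" "Y \<inter> W = {}" "Y \<inter> V = {}"
    and action: "action_on U sX" "action_on W sW" "action_on V sV" "action_on Y sY"
    and faithful: "\<And>g. g \<in> carrier G \<Longrightarrow> g \<noteq> \<one> \<Longrightarrow> \<exists>x\<in>polys U. psubst (sX g) x \<noteq> x"
    and spec_Y: "\<And>i. i \<in> Y \<Longrightarrow> spec i \<in> polys U"
    and spec_id: "\<And>i. i \<notin> Y \<Longrightarrow> spec i = pvar i"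
    and spec_equivariant:
      "\<And>i g. i \<in> Y \<Longrightarrow> g \<in> carrier G \<Longrightarrow> psubst spec (sY g i) = psubst (sX g) (spec i)"
begin

definition "sXW g i = psubst (sX g) (sW g i)"
definition "sXV g i = psubst (sX g) (sV g i)"
definition "sYV g i = psubst (sY g) (sV g i)"
definition "sXWV g i = psubst (sXW g) (sV g i)"

lemma psubst_compose:
  "psubst (sXW g) p = psubst (sX g) (psubst (sW g) p)"
  "psubst (sXV g) p = psubst (sX g) (psubst (sV g) p)"
  "psubst (sYV g) p = psubst (sY g) (psubst (sV g) p)"
  "psubst (sXWV g) p = psubst (sXW g) (psubst (sV g) p)"
  by (simp_all add: psubst_comp sXW_def[abs_def] sXV_def[abs_def] sYV_def[abs_def] sXWV_def[abs_def])

lemma action_compose: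
  "action_on (U \<union> W) sXW" "action_on (U \<union> V) sXV" "action_on (Y \<union> V) sYV"
  "action_on (U \<union> W \<union> V) sXWV"
proof -
  show XW: "action_on (U \<union> W) sXW"
    unfolding sXW_def[abs_def] by (rule action_on_compose(1)[OF action(1,2) disjoint(1)])
  show "action_on (U \<union> V) sXV"
    unfolding sXV_def[abs_def] by (rule action_on_compose(1)[OF action(1,3) disjoint(2)])
  show "action_on (Y \<union> V) sYV"
    unfolding sYV_def[abs_def] by (rule action_on_compose(1)[OF action(4,3) disjoint(6)])
  show "action_on (U \<union> W \<union> V) sXWV"
    unfolding sXWV_def[abs_def] by (rule action_on_compose(1)[OF XW action(3)]) (use disjoint in auto)
qed

definition "RX = invariants U (sX ` carrier G)"
definition "RY = invariants Y (sY ` carrier G)"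
definition "KV = invariants V (sV ` carrier G)"
definition "B1 = invariants (U \<union> W) (sXW ` carrier G)"
definition "B2 = invariants (U \<union> V) (sXV ` carrier G)"
definition "B2' = invariants (Y \<union> V) (sYV ` carrier G)"
definition "C = invariants (U \<union> W \<union> V) (sXWV ` carrier G)"

lemma fixes_other:
  "p \<in> polys Z \<Longrightarrow> Z \<inter> U = {} \<Longrightarrow> g \<in> carrier G \<Longrightarrow> psubst (sX g) p = p"
  "p \<in> polys Z \<Longrightarrow> Z \<inter> W = {} \<Longrightarrow> g \<in> carrier G \<Longrightarrow> psubst (sW g) p = p"
  "p \<in> polys Z \<Longrightarrow> Z \<inter> V = {} \<Longrightarrow> g \<in> carrier G \<Longrightarrow> psubst (sV g) p = p"
  "p \<in> polys Z \<Longrightarrow> Z \<inter> Y = {} \<Longrightarrow> g \<in> carrier G \<Longrightarrow> psubst (sY g) p = p"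
  using psubst_on(2) action[THEN action_onD(1)] by blast+

lemma RX_subset_B1: "RX \<subseteq> B1"
proof
  fix p assume p: "p \<in> RX"
  then have U: "p \<in> polys U" by (simp add: RX_def invariants_def)
  then have "p \<in> polys (U \<union> W)" by (rule polys_mono[rotated]) simp
  then show "p \<in> B1"
    using p fixes_other(2)[OF U disjoint(1)] by (auto simp: RX_def B1_def invariants_def psubst_compose)
qed

lemma KV_subset_B2: "KV \<subseteq> B2"
proof
  fix p assume p: "p \<in> KV"
  then have V: "p \<in> polys V" by (simp add: KV_def invariants_def)
  have VX: "V \<inter> U = {}" using disjoint(2) by blast
  from V have "p \<in> polys (U \<union> V)" by (rule polys_mono[rotated]) simp
  then show "p \<in> B2"
    using p fixes_other(1)[OF V VX] by (auto simp: KV_def B2_def invariants_def psubst_compose)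
qed

text \<open>The coefficients of the product of all \<open>t - c\<^sub>h\<close>, with \<open>c\<^sub>h\<close> the conjugates of \<open>c\<close> under the
  action on \<open>V\<close>, are invariant under the actions of \<open>G\<close> on \<open>U \<union> W\<close> and on \<open>V\<close> separately.\<close>

theorem C_integral:
  assumes c: "c \<in> C"
  shows "\<exists>P. Polynomial.coeff P (Polynomial.degree P) = 1 \<and>
    (\<forall>i. Polynomial.coeff P i \<in> mult_span B1 B2) \<and> poly P c = 0"
proof -
  define P where "P = root_poly (carrier G) (\<lambda>h. psubst (sV h) c)"
  have cC: "c \<in> polys (U \<union> W \<union> V)" "\<And>g. g \<in> carrier G \<Longrightarrow> psubst (sXW g) (psubst (sV g) c) = c"
    using c by (auto simp: C_def invariants_def psubst_compose(4))
  have disj: "(U \<union> W) \<inter> V = {}" using disjoint by blast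
  have "Polynomial.coeff P i \<in> mult_span B1 B2" for i
  proof -
    have "psubst (sV h) c \<in> polys (U \<union> W \<union> V)" if h: "h \<in> carrier G" for h
      by (rule psubst_on(1)[OF substitution_on_mono[OF action_onD(1)[OF action(3) h]] cC(1)]) simp
    then have in_polys: "Polynomial.coeff P i \<in> polys (U \<union> W \<union> V)"
      unfolding P_def by (intro coeff_root_poly_in finite_group closed_under_ring_ops_polys)
    have inv: "psubst \<sigma> (Polynomial.coeff P i) = Polynomial.coeff P i"
      if "\<sigma> \<in> sXW ` carrier G \<union> sV ` carrier G" for \<sigma>
      using that twisted_coeffs_invariant[OF finite_group action_compose(1) action(3) disj cC(2)]
      by (auto simp: P_def)
    obtain I :: "(nat \<Rightarrow>\<^sub>0 nat) set" and a b where "finite I"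
      "\<And>i. i \<in> I \<Longrightarrow> a i \<in> invariants (U \<union> W) (sXW ` carrier G)"
      "\<And>i. i \<in> I \<Longrightarrow> b i \<in> invariants V (sV ` carrier G)"
      "Polynomial.coeff P i = (\<Sum>i\<in>I. a i * b i)"
      by (rule invariants_product[OF disj _ _ in_polys inv])
         (use action_onD(1)[OF action_compose(1)] action_onD(1)[OF action(3)] in auto)
    then show ?thesis using KV_subset_B2
      by (auto simp: B1_def[symmetric] KV_def[symmetric] intro!: mult_span_sum mult_span_mult)
  qed
  moreover have "poly P c = 0"
    using root_poly_root[OF finite_group one_closed, of "\<lambda>h. psubst (sV h) c"]
    by (simp add: P_def action_onD(2)[OF action(3)])
  moreover have "Polynomial.coeff P (Polynomial.degree P) = 1"
    unfolding P_def root_poly_monic(1)[OF finite_group] by (rule root_poly_monic(2)[OF finite_group])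
  ultimately show ?thesis by blast
qed

lemma spec_X: "p \<in> polys Z \<Longrightarrow> Z \<inter> Y = {} \<Longrightarrow> psubst spec p = p"
  by (rule psubst_id) (use spec_id in auto)

lemma B1_polys: "a \<in> B1 \<Longrightarrow> a \<in> polys (U \<union> W)" and B2'_polys: "b \<in> B2' \<Longrightarrow> b \<in> polys (Y \<union> V)"
  by (simp_all add: B1_def B2'_def invariants_def)

lemma spec_B1: "a \<in> B1 \<Longrightarrow> psubst spec a = a"
  by (rule spec_X[OF B1_polys]) (use disjoint in auto)

lemma spec_sY:
  assumes b: "b \<in> polys (Y \<union> V)" and g: "g \<in> carrier G"
  shows "psubst spec (psubst (sY g) b) = psubst (sXW g) (psubst spec b)"
proof -
  have sY_V: "sY g i = pvar i" if "i \<notin> Y" for i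
    using action_onD(1)[OF action(4) g] that by (auto simp: substitution_on_def)
  have W: "psubst (sW g) p = p" if "p \<in> polys (U \<union> V)" for p
    by (rule fixes_other(2)[OF that _ g]) (use disjoint in auto)
  have eq: "psubst spec (sY g i) = psubst (sXW g) (spec i)" if i: "i \<in> Y \<union> V" for i
  proof (cases "i \<in> Y")
    case True
    then have "spec i \<in> polys (U \<union> V)" by (intro polys_mono[OF _ spec_Y]) auto
    then show ?thesis using spec_equivariant[OF True g] W by (simp add: psubst_compose)
  next
    case False
    then have "i \<in> V" using i by simp
    then have V: "pvar i \<in> polys V" by (rule pvar_in)
    have "psubst (sX g) (pvar i) = pvar i" by (rule fixes_other(1)[OF V _ g]) (use disjoint in auto)
    moreover have "psubst (sW g) (pvar i) = pvar i"
      by (rule fixes_other(2)[OF V _ g]) (use disjoint in auto)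
    ultimately show ?thesis using False sY_V[of i] spec_id[of i]
      by (simp only: psubst_compose) simp
  qed
  show ?thesis unfolding psubst_comp by (rule psubst_cong[OF b eq])
qed

text \<open>If \<open>z\<close> becomes zero when the variables \<open>Y\<close> are identified with \<open>U\<close>, then so do all its
  conjugates under the action of \<open>G\<close> on \<open>Y\<close> alone: \<open>z\<close> is invariant under the action on
  \<open>U \<union> W\<close>, so conjugating \<open>Y\<close> by \<open>g\<close> is the same as conjugating \<open>U\<close>, \<open>W\<close> and \<open>Y\<close>.\<close>

lemma spec_conjugate:
  assumes "z \<in> mult_span B1 B2'" and g: "g \<in> carrier G"
  shows "psubst spec (psubst (sY g) z) = psubst (sXW g) (psubst spec z)"
  using assms(1)
proof (induction rule: mult_span.induct)
  case (step a b s)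
  have "psubst (sY g) a = a"
    by (rule fixes_other(4)[OF B1_polys[OF step(1)] _ g]) (use disjoint in auto)
  moreover have "psubst (sXW g) a = a"
    using step(1) g by (auto simp: B1_def invariants_def)
  ultimately show ?case
    using spec_B1[OF step(1)] spec_sY[OF B2'_polys[OF step(2)] g] step(4)
    by (simp add: psubst_hom)
qed simp

text \<open>The equation is the product of all \<open>t - z\<^sub>h\<close>, with \<open>z\<^sub>h\<close> the conjugates of \<open>z\<close> under the action on \<open>Y\<close>.\<close>

theorem kernel_element_equation:
  assumes z: "z \<in> mult_span B1 B2'" and spec_z: "psubst spec z = 0"
  obtains P where "Polynomial.coeff P (Polynomial.degree P) = 1" "poly P z = 0"
    "\<And>i. Polynomial.coeff P i \<in> mult_span B1 (mult_span RY KV)"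
    "\<And>i. i < Polynomial.degree P \<Longrightarrow> psubst spec (Polynomial.coeff P i) = 0"
proof -
  define P where "P = root_poly (carrier G) (\<lambda>h. psubst (sY h) z)"
  have z_polys: "z \<in> polys ((U \<union> W) \<union> (Y \<union> V))"
    using z
  proof (induction rule: mult_span.induct)
    case (step a b s)
    then show ?case
      using B1_polys[OF step(1)] B2'_polys[OF step(2)]
      by (intro polys.add_in polys.mult_in) (auto intro: polys_mono[rotated])
  qed (rule polys.zero_in)
  have z_XW: "psubst (sXW g) z = z" and z_YV: "psubst (sY g) (psubst (sV g) z) = z"
    if g: "g \<in> carrier G" for g
  proof -
    have disj: "(Y \<union> V) \<inter> (U \<union> W) = {}" "(U \<union> W) \<inter> (Y \<union> V) = {}" using disjoint by auto
    have 1: "psubst (sXW g) b = b" "psubst (sYV g) a = a" if "a \<in> B1" "b \<in> B2'" for a b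
      using psubst_on(2)[OF action_onD(1)[OF action_compose(1) g] B2'_polys[OF that(2)] disj(1)]
        psubst_on(2)[OF action_onD(1)[OF action_compose(3) g] B1_polys[OF that(1)] disj(2)]
      by simp_all
    have 2: "psubst (sXW g) a = a" "psubst (sYV g) b = b" if "a \<in> B1" "b \<in> B2'" for a b
      using that g by (auto simp: B1_def B2'_def invariants_def)
    show "psubst (sXW g) z = z"
      using z by (induction rule: mult_span.induct) (simp_all add: psubst_hom 1 2)
    have "psubst (sYV g) z = z"
      using z by (induction rule: mult_span.induct) (simp_all add: psubst_hom 1 2)
    then show "psubst (sY g) (psubst (sV g) z) = z" by (simp add: psubst_compose(3))
  qed
  note on = action_onD(1)[OF action_compose(1)] action_onD(1)[OF action(3)] action_onD(1)[OF action(4)]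
  have disj: "(U \<union> W) \<inter> (Y \<union> V) = {}" "(U \<union> W) \<inter> Y = {}" "V \<inter> Y = {}" using disjoint by auto
  have coeff: "Polynomial.coeff P i \<in> mult_span B1 (mult_span RY KV)" for i
  proof -
    have "psubst (sY h) z \<in> polys ((U \<union> W) \<union> (Y \<union> V))" if h: "h \<in> carrier G" for h
      by (rule psubst_on(1)[OF substitution_on_mono[OF on(3)[OF h]] z_polys]) auto
    then have in_polys: "Polynomial.coeff P i \<in> polys ((U \<union> W) \<union> (Y \<union> V))"
      unfolding P_def by (intro coeff_root_poly_in finite_group closed_under_ring_ops_polys)
    have XW: "psubst (sXW g) (Polynomial.coeff P i) = Polynomial.coeff P i" if g: "g \<in> carrier G" for g
    proof -
      have "root_poly (carrier G) (\<lambda>h. psubst (sXW g) (psubst (sY h) z)) = P"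
        unfolding P_def root_poly_def
        by (intro prod.cong refl)
           (simp add: substitutions_commute[OF on(1)[OF g] on(3) disj(2)] z_XW[OF g])
      then show ?thesis by (simp add: P_def psubst_coeff_root_poly[OF finite_group])
    qed
    have YV: "psubst (sV g) (psubst (sY g) z) = z" if g: "g \<in> carrier G" for g
      using z_YV[OF g] substitutions_commute[OF on(2)[OF g] on(3)[OF g] disj(3)] by simp
    have twist: "psubst (sV g) (Polynomial.coeff P i) = Polynomial.coeff P i"
      "psubst (sY g) (Polynomial.coeff P i) = Polynomial.coeff P i" if g: "g \<in> carrier G" for g
      unfolding P_def
      by (rule twisted_coeffs_invariant[OF finite_group action(3,4) disj(3) YV g], assumption)+
    have inv: "psubst \<sigma> (Polynomial.coeff P i) = Polynomial.coeff P i"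
      if "\<sigma> \<in> sXW ` carrier G \<union> (sY ` carrier G \<union> sV ` carrier G)" for \<sigma>
      using that by (elim UnE imageE) (simp_all only: XW twist)
    have onYV: "substitution_on (Y \<union> V) \<sigma>" if "\<sigma> \<in> sY ` carrier G \<union> sV ` carrier G" for \<sigma>
      using that by (elim UnE imageE) (auto intro: substitution_on_mono[OF on(2)] substitution_on_mono[OF on(3)])
    obtain I :: "(nat \<Rightarrow>\<^sub>0 nat) set" and a b where ab: "finite I"
      "\<And>i. i \<in> I \<Longrightarrow> a i \<in> invariants (U \<union> W) (sXW ` carrier G)"
      "\<And>i. i \<in> I \<Longrightarrow> b i \<in> invariants (Y \<union> V) (sY ` carrier G \<union> sV ` carrier G)"
      "Polynomial.coeff P i = (\<Sum>i\<in>I. a i * b i)"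
      by (rule invariants_product[where ?H1.0 = "sXW ` carrier G" and ?H2.0 = "sY ` carrier G \<union> sV ` carrier G",
            OF disj(1) _ onYV in_polys inv]) (use on in auto)
    have "b i \<in> mult_span RY KV" if i: "i \<in> I" for i
    proof -
      have b: "b i \<in> polys (Y \<union> V)" "\<And>\<sigma>. \<sigma> \<in> sY ` carrier G \<union> sV ` carrier G \<Longrightarrow> psubst \<sigma> (b i) = b i"
        using ab(3)[OF i] by (auto simp: invariants_def)
      obtain I' :: "(nat \<Rightarrow>\<^sub>0 nat) set" and r w where "finite I'"
        "\<And>i. i \<in> I' \<Longrightarrow> r i \<in> invariants Y (sY ` carrier G)"
        "\<And>i. i \<in> I' \<Longrightarrow> w i \<in> invariants V (sV ` carrier G)"
        "b i = (\<Sum>i\<in>I'. r i * w i)"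
        by (rule invariants_product[OF disjoint(6) _ _ b]) (use on in auto)
      then show ?thesis
        by (auto simp: RY_def[symmetric] KV_def[symmetric] intro!: mult_span_sum mult_span_mult)
    qed
    then show ?thesis using ab by (auto simp: B1_def intro!: mult_span_sum mult_span_mult)
  qed
  have deg: "Polynomial.degree P = card (carrier G)" "Polynomial.coeff P (card (carrier G)) = 1"
    unfolding P_def by (rule root_poly_monic[OF finite_group])+
  have spec_coeff: "psubst spec (Polynomial.coeff P i) = 0" if "i < Polynomial.degree P" for i
  proof -
    have "root_poly (carrier G) (\<lambda>h. psubst spec (psubst (sY h) z)) =
        (root_poly (carrier G) (\<lambda>h. 0) :: 'k mpoly poly)"
      unfolding root_poly_def by (intro prod.cong refl) (simp add: spec_conjugate[OF z] spec_z)
    also have "\<dots> = Polynomial.monom 1 (card (carrier G))"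
      by (simp add: root_poly_def monom_altdef)
    finally show ?thesis
      using that deg(1) by (simp add: P_def psubst_coeff_root_poly[OF finite_group])
  qed
  have "poly P z = 0"
    using root_poly_root[OF finite_group one_closed, of "\<lambda>h. psubst (sY h) z"]
    by (simp add: P_def action_onD(2)[OF action(4)])
  then show thesis using that[of P] deg coeff spec_coeff by simp
qed

text \<open>The quotient field of the ring of invariants of \<open>K[U, W, V]\<close> is generated by the two smaller
  rings of invariants, with one common denominator \<open>r\<close>: for separating elements \<open>p\<^sub>i, q\<^sub>i\<close> with
  \<open>D = \<Sum>\<^sub>i p\<^sub>i q\<^sub>i\<close> one has \<open>D s = \<Sum>\<^sub>i p\<^sub>i Tr(q\<^sub>i s)\<close> for every polynomial \<open>s\<close>. Applied
  to both factors of \<open>c = \<Sum>\<^sub>e s\<^sub>e s'\<^sub>e\<close> this expresses \<open>D\<^sup>2 c\<close> by traces; multiplying by a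
  polynomial \<open>u\<close> in \<open>U\<close> with \<open>Tr(u D\<^sup>2) \<noteq> 0\<close> and taking the trace again makes the
  coefficients invariant.\<close>

theorem common_denominator:
  obtains r where "r \<in> RX" "r \<noteq> 0" "\<And>c. c \<in> C \<Longrightarrow> r * c \<in> mult_span B1 B2"
proof -
  let ?T = "U \<union> W \<union> V"
  let ?act = "\<lambda>g. psubst (sXWV g)"
  note act = action_onD[OF action_compose(4)]
  define Tr where "Tr p = (\<Sum>g\<in>carrier G. ?act g p)" for p
  have Tr_inv: "?act g (Tr p) = Tr p" if g: "g \<in> carrier G" for g p
  proof -
    have "?act g (Tr p) = (\<Sum>h\<in>carrier G. ?act (h \<otimes> g) p)"
      unfolding Tr_def psubst_sum using act(3)[OF g] by (intro sum.cong) auto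
    also have "\<dots> = Tr p" unfolding Tr_def by (rule sum.reindex_bij_betw[OF bij_mult(1)[OF g]])
    finally show ?thesis .
  qed
  have Tr_sum: "Tr (sum f I) = (\<Sum>i\<in>I. Tr (f i))" for f and I :: "'i set"
    unfolding Tr_def psubst_sum by (rule sum.swap)
  have Tr_mult: "Tr (p * t) = Tr p * t" if "\<And>g. g \<in> carrier G \<Longrightarrow> ?act g t = t" for p t
    using that by (simp add: Tr_def psubst_mult sum_distrib_right)
  have act_X: "?act g p = psubst (sX g) p" if "p \<in> polys U" "g \<in> carrier G" for g p
    using fixes_other(2)[OF that(1) disjoint(1) that(2)] fixes_other(3)[OF that(1) disjoint(2) that(2)]
    by (simp add: psubst_compose)
  have act_XW: "?act g p = psubst (sXW g) p" if "p \<in> polys (U \<union> W)" "g \<in> carrier G" for g p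
    using fixes_other(3)[OF that(1) _ that(2)] disjoint by (simp add: psubst_compose Int_Un_distrib2)
  have act_XV: "?act g p = psubst (sXV g) p" if p: "p \<in> polys (U \<union> V)" and g: "g \<in> carrier G" for g p
  proof -
    have "psubst (sV g) p \<in> polys (U \<union> V)"
      by (rule psubst_on(1)[OF substitution_on_mono[OF action_onD(1)[OF action(3) g]] p]) simp
    then have "psubst (sW g) (psubst (sV g) p) = psubst (sV g) p"
      by (rule fixes_other(2)) (use disjoint g in auto)
    then show ?thesis by (simp add: psubst_compose)
  qed
  have Tr_X: "Tr p \<in> RX" if p: "p \<in> polys U" for p
  proof -
    have "Tr p \<in> polys U"
      unfolding Tr_def using act_X[OF p] psubst_on(1)[OF action_onD(1)[OF action(1)] p]
      by (intro polys.sum_in) auto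
    then show ?thesis using Tr_inv[of _ p] act_X by (auto simp: RX_def invariants_def)
  qed
  have Tr_XW: "Tr p \<in> B1" if p: "p \<in> polys (U \<union> W)" for p
  proof -
    have "Tr p \<in> polys (U \<union> W)"
      unfolding Tr_def using act_XW[OF p] psubst_on(1)[OF action_onD(1)[OF action_compose(1)] p]
      by (intro polys.sum_in) auto
    then show ?thesis using Tr_inv[of _ p] act_XW by (auto simp: B1_def invariants_def)
  qed
  have Tr_XV: "Tr p \<in> B2" if p: "p \<in> polys (U \<union> V)" for p
  proof -
    have "Tr p \<in> polys (U \<union> V)"
      unfolding Tr_def using act_XV[OF p] psubst_on(1)[OF action_onD(1)[OF action_compose(2)] p]
      by (intro polys.sum_in) auto
    then show ?thesis using Tr_inv[of _ p] act_XV by (auto simp: B2_def invariants_def)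
  qed
  obtain ps where ps: "\<And>p q. (p, q) \<in> set ps \<Longrightarrow> p \<in> polys U \<and> q \<in> polys U"
    "\<And>h. h \<in> carrier G - {\<one>} \<Longrightarrow> (\<Sum>(p, q)\<leftarrow>ps. p * psubst (sX h) q) = 0"
    "(\<Sum>(p, q)\<leftarrow>ps. p * q) \<noteq> 0"
    using separating_elements[OF action(1) faithful, of "carrier G - {\<one>}"] finite_group by blast
  define I where "I = {..<length ps}"
  define p where "p i = fst (ps ! i)" for i
  define q where "q i = snd (ps ! i)" for i
  have as_sum: "(\<Sum>(p, q)\<leftarrow>ps. p * \<phi> q) = (\<Sum>i\<in>I. p i * \<phi> (q i))" for \<phi> :: "'k mpoly \<Rightarrow> 'k mpoly"
    by (simp add: sum_list_sum_nth I_def p_def q_def split_def atLeast0LessThan)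
  have pq: "p i \<in> polys U" "q i \<in> polys U" if "i \<in> I" for i
    using ps(1)[of "p i" "q i"] that by (auto simp: I_def p_def q_def)
  define D where "D = (\<Sum>i\<in>I. p i * q i)"
  have D: "D \<noteq> 0" "D \<in> polys U"
    using ps(3) as_sum[of "\<lambda>q. q"] pq by (auto simp: D_def intro!: polys.sum_in polys.mult_in)
  \<comment> \<open>Only the identity contributes to the sum over the group.\<close>
  have D_Tr: "D * s = (\<Sum>i\<in>I. p i * Tr (q i * s))" for s
  proof -
    have "(\<Sum>i\<in>I. p i * Tr (q i * s)) =
        (\<Sum>i\<in>I. \<Sum>h\<in>carrier G. (p i * psubst (sX h) (q i)) * ?act h s)"
      unfolding Tr_def psubst_mult sum_distrib_left
      by (intro sum.cong refl) (simp add: act_X pq mult.assoc)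
    also have "\<dots> = (\<Sum>h\<in>carrier G. (\<Sum>i\<in>I. p i * psubst (sX h) (q i)) * ?act h s)"
      unfolding sum_distrib_right by (rule sum.swap)
    also have "\<dots> = (\<Sum>h\<in>carrier G. if h = \<one> then D * s else 0)"
    proof (rule sum.cong[OF refl])
      fix h assume h: "h \<in> carrier G"
      show "(\<Sum>i\<in>I. p i * psubst (sX h) (q i)) * ?act h s = (if h = \<one> then D * s else 0)"
        using ps(2)[of h] h as_sum[of "psubst (sX h)"]
        by (auto simp: D_def action_onD(2)[OF action(1)] act(2))
    qed
    finally show ?thesis using finite_group by simp
  qed
  have "D * (D * D) \<noteq> 0" using D by simp
  moreover have "D * (D * D) = 0" if "\<forall>l\<in>I. Tr (q l * (D * D)) = 0"
    unfolding D_Tr[of "D * D"] by (rule sum.neutral) (use that in simp)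
  ultimately have "\<not> (\<forall>l\<in>I. Tr (q l * (D * D)) = 0)" by blast
  then obtain l where l: "l \<in> I" "Tr (q l * (D * D)) \<noteq> 0" by blast
  let ?u = "q l"
  define r where "r = Tr (?u * (D * D))"
  have r: "r \<in> RX" "r \<noteq> 0"
    using l D pq by (auto simp: r_def intro!: Tr_X polys.mult_in)
  have "r * c \<in> mult_span B1 B2" if c: "c \<in> C" for c
  proof -
    have c_inv: "?act g c = c" if "g \<in> carrier G" for g
      using c that by (auto simp: C_def invariants_def)
    have disj: "(U \<union> W) \<inter> V = {}" using disjoint by auto
    have c_vars: "c \<in> polys ((U \<union> W) \<union> V)" using c by (simp add: C_def invariants_def)
    define s where "s e = Poly_Mapping.single (restrict_exp (U \<union> W) e) (Poly_Mapping.lookup c e)" for e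
    define s' where "s' e = (monomial (restrict_exp V e) :: 'k mpoly)" for e
    have s_in: "s e \<in> polys (U \<union> W)" "s' e \<in> polys (U \<union> V)" for e
      by (auto simp: s_def s'_def keys_restrict_exp intro!: polys_single)
    have "(\<Sum>e\<in>Poly_Mapping.keys c. s e * s' e) =
        (\<Sum>e\<in>Poly_Mapping.keys c. Poly_Mapping.single e (Poly_Mapping.lookup c e))"
    proof (rule sum.cong[OF refl])
      fix e assume "e \<in> Poly_Mapping.keys c"
      then have "Poly_Mapping.keys e \<subseteq> (U \<union> W) \<union> V" using c_vars by (auto simp: polys_def)
      then show "s e * s' e = Poly_Mapping.single e (Poly_Mapping.lookup c e)"
        using restrict_exp_split[of "U \<union> W" V e] disj by (simp add: s_def s'_def mult_single)
    qed
    then have c_sum: "c = (\<Sum>e\<in>Poly_Mapping.keys c. s e * s' e)" by (simp add: sum_singles)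
    let ?E = "Poly_Mapping.keys c"
    have "D * D * c = (\<Sum>e\<in>?E. (D * s e) * (D * s' e))"
      by (subst c_sum) (simp add: sum_distrib_left ac_simps)
    also have "\<dots> = (\<Sum>e\<in>?E. \<Sum>i\<in>I. \<Sum>k\<in>I. (p i * p k) * (Tr (q i * s e) * Tr (q k * s' e)))"
      unfolding D_Tr sum_product by (intro sum.cong refl) (simp add: ac_simps)
    finally have DDc: "D * D * c =
        (\<Sum>e\<in>?E. \<Sum>i\<in>I. \<Sum>k\<in>I. (p i * p k) * (Tr (q i * s e) * Tr (q k * s' e)))" .
    have "r * c = Tr (?u * (D * D * c))"
      unfolding r_def using Tr_mult[OF c_inv, of "?u * (D * D)"] by (simp add: mult.assoc)
    also have "\<dots> = (\<Sum>e\<in>?E. \<Sum>i\<in>I. \<Sum>k\<in>I. Tr ((?u * (p i * p k)) * (Tr (q i * s e) * Tr (q k * s' e))))"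
      unfolding DDc sum_distrib_left Tr_sum by (simp only: mult.assoc)
    also have "\<dots> = (\<Sum>e\<in>?E. \<Sum>i\<in>I. \<Sum>k\<in>I. (Tr (?u * (p i * p k)) * Tr (q i * s e)) * Tr (q k * s' e))"
      by (intro sum.cong refl, subst Tr_mult) (simp_all add: psubst_mult Tr_inv mult.assoc)
    also have "\<dots> \<in> mult_span B1 B2"
    proof (intro mult_span_sum mult_span_mult)
      fix e i k assume ik: "i \<in> I" "k \<in> I"
      have "Tr (?u * (p i * p k)) \<in> B1"
        using RX_subset_B1 Tr_X[of "?u * (p i * p k)"] pq ik l by (auto intro!: polys.mult_in)
      moreover have "Tr (q i * s e) \<in> B1"
        by (rule Tr_XW, rule polys.mult_in[OF polys_mono[OF _ pq(2)[OF ik(1)]] s_in(1)]) simp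
      ultimately show "Tr (?u * (p i * p k)) * Tr (q i * s e) \<in> B1"
        unfolding B1_def by (rule invariants.mult_in)
      show "Tr (q k * s' e) \<in> B2"
        by (rule Tr_XV, rule polys.mult_in[OF polys_mono[OF _ pq(2)[OF ik(2)]] s_in(2)]) simp
    qed
    finally show ?thesis .
  qed
  then show thesis using that r by blast
qed

end

section \<open>Tensor products of rings\<close>

abbreviation pair_mult where "pair_mult A B \<equiv> monoid.mult (pair_ring A B)"

lemma pair_ring_simps:
  "p \<in> carrier (pair_ring A B) \<longleftrightarrow> Poly_Mapping.keys p \<subseteq> carrier A \<times> carrier B"
  "\<one>\<^bsub>pair_ring A B\<^esub> = frag_of (\<one>\<^bsub>A\<^esub>, \<one>\<^bsub>B\<^esub>)" "\<zero>\<^bsub>pair_ring A B\<^esub> = 0"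
  "p \<oplus>\<^bsub>pair_ring A B\<^esub> q = p + q"
  by (simp_all add: pair_ring_def)

lemma pair_mult_of [simp]:
  "pair_mult A B (frag_of (a, b)) (frag_of (a', b')) = frag_of (a \<otimes>\<^bsub>A\<^esub> a', b \<otimes>\<^bsub>B\<^esub> b')"
  by (simp add: pair_ring_def)

lemma pair_mult_zero [simp]: "pair_mult A B 0 q = 0" "pair_mult A B p 0 = 0"
proof -
  show "pair_mult A B 0 q = 0" by (simp add: pair_ring_def)
  have "frag_extend (\<lambda>(a, b). 0) p = 0" by (rule frag_extend_eq_0) auto
  then show "pair_mult A B p 0 = 0" by (simp add: pair_ring_def)
qed

lemma pair_mult_diff_left: "pair_mult A B (p - p') q = pair_mult A B p q - pair_mult A B p' q"
  by (simp add: pair_ring_def frag_extend_diff)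

lemma pair_mult_diff_right: "pair_mult A B p (q - q') = pair_mult A B p q - pair_mult A B p q'"
proof -
  have "Poly_Mapping.keys p \<subseteq> UNIV" by simp
  then show ?thesis
  proof (induction rule: frag_induction)
    case (one x)
    then show ?case by (cases x) (simp add: pair_ring_def frag_extend_diff)
  qed (simp_all add: pair_mult_diff_left)
qed

lemma pair_mult_add_left: "pair_mult A B (p + p') q = pair_mult A B p q + pair_mult A B p' q"
  using pair_mult_diff_left[of A B p "- p'" q] pair_mult_diff_left[of A B 0 p' q] by simp

lemma pair_ring_induct [consumes 1, case_names zero pure diff]:
  assumes "p \<in> carrier (pair_ring A B)"
    and "P 0" and "\<And>a b. a \<in> carrier A \<Longrightarrow> b \<in> carrier B \<Longrightarrow> P (frag_of (a, b))"
    and "\<And>p q. P p \<Longrightarrow> P q \<Longrightarrow> P (p - q)"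
  shows "P p"
  by (rule frag_induction[of p "carrier A \<times> carrier B"]) (use assms in \<open>auto simp: pair_ring_simps\<close>)

lemma pair_ring_diff_closed:
  "p \<in> carrier (pair_ring A B) \<Longrightarrow> q \<in> carrier (pair_ring A B) \<Longrightarrow> p - q \<in> carrier (pair_ring A B)"
  using keys_diff[of p q] by (auto simp: pair_ring_simps)

lemma pure_closed: "a \<in> carrier A \<Longrightarrow> b \<in> carrier B \<Longrightarrow> frag_of (a, b) \<in> carrier (pair_ring A B)"
  by (simp add: pair_ring_simps keys_frag_of)

lemma zero_pair_closed: "0 \<in> carrier (pair_ring A B)"
  by (simp add: pair_ring_simps)

lemma cring_pair_ring:
  assumes "cring A" "cring B"
  shows "cring (pair_ring A B)"
proof -
  interpret A: cring A by fact
  interpret B: cring B by fact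
  let ?P = "pair_ring A B"
  have add_closed: "p + q \<in> carrier ?P" if "p \<in> carrier ?P" "q \<in> carrier ?P" for p q
    using that keys_add[of p q] by (auto simp: pair_ring_simps)
  have mult_closed: "p \<otimes>\<^bsub>?P\<^esub> q \<in> carrier ?P" if p: "p \<in> carrier ?P" and q: "q \<in> carrier ?P" for p q
    using p
  proof (induction rule: pair_ring_induct)
    case (pure a b)
    show ?case using q
      by (induction rule: pair_ring_induct)
         (use pure in \<open>simp_all add: pair_mult_diff_right pair_ring_diff_closed pure_closed zero_pair_closed\<close>)
  qed (simp_all add: pair_mult_diff_left pair_ring_diff_closed zero_pair_closed)
  have comm: "p \<otimes>\<^bsub>?P\<^esub> q = q \<otimes>\<^bsub>?P\<^esub> p" if p: "p \<in> carrier ?P" and q: "q \<in> carrier ?P" for p q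
    using p
  proof (induction rule: pair_ring_induct)
    case (pure a b)
    show ?case using q
      by (induction rule: pair_ring_induct)
         (use pure in \<open>simp_all add: pair_mult_diff_right pair_mult_diff_left A.m_comm B.m_comm\<close>)
  qed (simp_all add: pair_mult_diff_left pair_mult_diff_right)
  have assoc: "(p \<otimes>\<^bsub>?P\<^esub> q) \<otimes>\<^bsub>?P\<^esub> r = p \<otimes>\<^bsub>?P\<^esub> (q \<otimes>\<^bsub>?P\<^esub> r)"
    if p: "p \<in> carrier ?P" and q: "q \<in> carrier ?P" and r: "r \<in> carrier ?P" for p q r
    using p
  proof (induction rule: pair_ring_induct)
    case pq: (pure a b)
    show ?case using q
    proof (induction rule: pair_ring_induct)
      case (pure a' b')
      show ?case using r
        by (induction rule: pair_ring_induct)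
           (use pq pure in \<open>simp_all add: pair_mult_diff_right A.m_assoc B.m_assoc\<close>)
    qed (simp_all add: pair_mult_diff_left pair_mult_diff_right)
  qed (simp_all add: pair_mult_diff_left)
  have one: "\<one>\<^bsub>?P\<^esub> \<otimes>\<^bsub>?P\<^esub> p = p" if "p \<in> carrier ?P" for p
    using that by (induction rule: pair_ring_induct) (simp_all add: pair_ring_simps(2) pair_mult_diff_right)
  show ?thesis
  proof (rule cringI)
    show "abelian_group ?P"
    proof (rule abelian_groupI)
      fix p assume "p \<in> carrier ?P"
      then show "\<exists>q\<in>carrier ?P. q \<oplus>\<^bsub>?P\<^esub> p = \<zero>\<^bsub>?P\<^esub>"
        by (intro bexI[of _ "- p"]) (auto simp: pair_ring_simps)
    qed (simp_all add: pair_ring_simps(2-4) add_closed zero_pair_closed add.assoc)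
    show "Group.comm_monoid ?P"
      by (intro comm_monoidI mult_closed assoc one comm) (simp_all add: pair_ring_simps(2) pure_closed)
  qed (simp add: pair_ring_simps(4) pair_mult_add_left)
qed

text \<open>The map \<open>\<int>[A \<times> B] \<rightarrow> C\<close> that becomes \<open>tensor_lift\<close> on the quotient.\<close>

definition frag_eval :: "('a \<Rightarrow> 'c) \<Rightarrow> ('b \<Rightarrow> 'c) \<Rightarrow> (('a \<times> 'b) \<Rightarrow>\<^sub>0 int) \<Rightarrow> 'c::comm_ring_1" where
  "frag_eval f g p = (\<Sum>x\<in>Poly_Mapping.keys p. of_int (Poly_Mapping.lookup p x) * (f (fst x) * g (snd x)))"

lemma frag_eval_superset:
  "finite M \<Longrightarrow> Poly_Mapping.keys p \<subseteq> M \<Longrightarrow>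
    frag_eval f g p = (\<Sum>x\<in>M. of_int (Poly_Mapping.lookup p x) * (f (fst x) * g (snd x)))"
  unfolding frag_eval_def by (rule sum.mono_neutral_left) (auto simp: in_keys_iff)

lemma frag_eval_diff: "frag_eval f g (p - q) = frag_eval f g p - frag_eval f g q"
  by (subst (1 2 3) frag_eval_superset[of "Poly_Mapping.keys p \<union> Poly_Mapping.keys q"])
     (use keys_diff[of p q] in \<open>auto simp: lookup_minus left_diff_distrib sum_subtractf\<close>)

lemma frag_eval_0 [simp]: "frag_eval f g 0 = 0"
  by (simp add: frag_eval_def)

lemma frag_eval_add: "frag_eval f g (p + q) = frag_eval f g p + frag_eval f g q"
  using frag_eval_diff[of f g p "- q"] frag_eval_diff[of f g 0 q] by simp

lemma frag_eval_sum: "frag_eval f g (sum h I) = (\<Sum>i\<in>I. frag_eval f g (h i))"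
  by (induction I rule: infinite_finite_induct) (simp_all add: frag_eval_add)

lemma frag_eval_of [simp]: "frag_eval f g (frag_of (a, b)) = f a * g b"
  by (simp add: frag_eval_def keys_frag_of)

lemma (in closed_under_ring_ops) of_int_in: "of_int k \<in> S"
proof -
  have "of_nat n \<in> S" for n by (induction n) (auto simp: zero_in one_in add_in)
  then show ?thesis by (cases k rule: int_cases2) (auto intro: uminus_in)
qed

lemma int_multiple_induced_ring:
  fixes k :: int
  assumes "closed_under_ring_ops S" and y: "y \<in> S"
  shows "[k] \<cdot>\<^bsub>induced_ring S\<^esub> y = of_int k * y"
proof -
  interpret closed_under_ring_ops S by fact
  interpret S: cring "induced_ring S" by (rule cring_induced_ring)
  have nat: "[n] \<cdot>\<^bsub>induced_ring S\<^esub> y = of_nat n * y" for n :: nat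
    using y by (induction n) (simp_all add: add_pow_def algebra_simps)
  have inv: "\<ominus>\<^bsub>induced_ring S\<^esub> x = - x" if "x \<in> S" for x
    by (rule S.minus_equality) (use that in \<open>simp_all add: uminus_in\<close>)
  have of_nat: "of_nat n * y \<in> S" for n
    using y by (induction n) (auto simp: zero_in add_in algebra_simps)
  show ?thesis
  proof (cases "k < 0")
    case True
    then have "[k] \<cdot>\<^bsub>induced_ring S\<^esub> y = \<ominus>\<^bsub>induced_ring S\<^esub> ([nat (- k)] \<cdot>\<^bsub>induced_ring S\<^esub> y)"
      by (simp add: add_pow_def int_pow_def a_inv_def)
    also have "\<dots> = - (of_nat (nat (- k)) * y)" by (simp add: nat inv of_nat)
    finally show ?thesis using True by simp
  next
    case False
    then have "[k] \<cdot>\<^bsub>induced_ring S\<^esub> y = [nat k] \<cdot>\<^bsub>induced_ring S\<^esub> y"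
      by (simp add: add_pow_def int_pow_def)
    also have "\<dots> = of_nat (nat k) * y" by (rule nat)
    finally show ?thesis using False by simp
  qed
qed

lemma finsum_induced_ring:
  assumes "closed_under_ring_ops S" and "finite M" "\<And>x. x \<in> M \<Longrightarrow> f x \<in> S"
  shows "finsum (induced_ring S) f M = sum f M"
proof -
  interpret closed_under_ring_ops S by fact
  interpret S: cring "induced_ring S" by (rule cring_induced_ring)
  show ?thesis using assms(2,3)
    by (induction M rule: finite_induct) (simp_all add: S.finsum_insert Pi_def)
qed

locale tensor_hom =
  R: cring R + A: cring A + B: cring B + S: closed_under_ring_ops S
  for R :: "('r, 'e) ring_scheme" and A :: "('a, 'm) ring_scheme" and B :: "('b, 'n) ring_scheme"
    and S :: "'c::comm_ring_1 set" +
  fixes \<alpha> :: "'r \<Rightarrow> 'a" and \<beta> :: "'r \<Rightarrow> 'b" and f :: "'a \<Rightarrow> 'c" and g :: "'b \<Rightarrow> 'c"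
  assumes \<alpha>: "\<alpha> \<in> carrier R \<rightarrow> carrier A" and \<beta>: "\<beta> \<in> carrier R \<rightarrow> carrier B"
    and f: "f \<in> ring_hom A (induced_ring S)" and g: "g \<in> ring_hom B (induced_ring S)"
    and agree: "\<And>r. r \<in> carrier R \<Longrightarrow> f (\<alpha> r) = g (\<beta> r)"
begin

abbreviation "P \<equiv> pair_ring A B"
abbreviation "rels \<equiv> tensor_relations R A \<alpha> B \<beta>"
definition "I = Idl\<^bsub>P\<^esub> rels"
abbreviation "T \<equiv> tensor_ring R A \<alpha> B \<beta>"
abbreviation "\<Phi> \<equiv> frag_eval f g"

sublocale P: cring P by (rule cring_pair_ring[OF A.is_cring B.is_cring])

lemma f_simps: "a \<in> carrier A \<Longrightarrow> f a \<in> S" "a \<in> carrier A \<Longrightarrow> a' \<in> carrier A \<Longrightarrow> f (a \<otimes>\<^bsub>A\<^esub> a') = f a * f a'"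
    "a \<in> carrier A \<Longrightarrow> a' \<in> carrier A \<Longrightarrow> f (a \<oplus>\<^bsub>A\<^esub> a') = f a + f a'" "f \<one>\<^bsub>A\<^esub> = 1"
  using ring_hom_closed[OF f] ring_hom_mult[OF f] ring_hom_add[OF f] ring_hom_one[OF f] by auto

lemma g_simps: "a \<in> carrier B \<Longrightarrow> g a \<in> S" "a \<in> carrier B \<Longrightarrow> a' \<in> carrier B \<Longrightarrow> g (a \<otimes>\<^bsub>B\<^esub> a') = g a * g a'"
    "a \<in> carrier B \<Longrightarrow> a' \<in> carrier B \<Longrightarrow> g (a \<oplus>\<^bsub>B\<^esub> a') = g a + g a'" "g \<one>\<^bsub>B\<^esub> = 1"
  using ring_hom_closed[OF g] ring_hom_mult[OF g] ring_hom_add[OF g] ring_hom_one[OF g] by auto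

lemma rels_subset: "rels \<subseteq> carrier P"
  using \<alpha> \<beta>
  by (auto simp: tensor_relations_def Pi_def intro!: pair_ring_diff_closed pure_closed)

sublocale I: ideal I P unfolding I_def by (rule P.genideal_ideal[OF rels_subset])

lemma rels_in_I: "x \<in> rels \<Longrightarrow> x \<in> I"
  unfolding I_def using P.genideal_self[OF rels_subset] by blast

lemma I_diff: "x \<in> I \<Longrightarrow> y \<in> I \<Longrightarrow> x - y \<in> I"
proof -
  assume x: "x \<in> I" and y: "y \<in> I"
  have "\<ominus>\<^bsub>P\<^esub> y = - y"
    by (rule P.minus_equality) (use I.Icarr[OF y] in \<open>simp_all add: pair_ring_simps\<close>)
  then have "- y \<in> I" using I.a_inv_closed[OF y] by simp
  then show "x - y \<in> I" using I.a_closed[OF x] by (force simp: pair_ring_simps(4))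
qed

lemma frag_eval_mult:
  assumes f': "\<And>a a'. a \<in> carrier A \<Longrightarrow> a' \<in> carrier A \<Longrightarrow> f' (a \<otimes>\<^bsub>A\<^esub> a') = f' a * (f' a' :: 'd::comm_ring_1)"
    and g': "\<And>b b'. b \<in> carrier B \<Longrightarrow> b' \<in> carrier B \<Longrightarrow> g' (b \<otimes>\<^bsub>B\<^esub> b') = g' b * g' b'"
    and p: "p \<in> carrier P" and q: "q \<in> carrier P"
  shows "frag_eval f' g' (p \<otimes>\<^bsub>P\<^esub> q) = frag_eval f' g' p * frag_eval f' g' q"
  using p
proof (induction rule: pair_ring_induct)
  case (pure a b)
  show ?case using q
    by (induction rule: pair_ring_induct)
       (use pure in \<open>simp_all add: pair_mult_diff_right frag_eval_diff f' g' algebra_simps\<close>)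
qed (simp_all add: pair_mult_diff_left frag_eval_diff left_diff_distrib)

lemma \<Phi>_in: "p \<in> carrier P \<Longrightarrow> \<Phi> p \<in> S"
  by (induction rule: pair_ring_induct)
     (simp_all add: frag_eval_diff S.zero_in S.diff_in S.mult_in f_simps g_simps)

lemma \<Phi>_hom: "\<Phi> \<in> ring_hom P (induced_ring S)"
  by (rule ring_hom_memI)
     (simp_all add: \<Phi>_in frag_eval_mult f_simps g_simps pair_ring_simps(2,4) frag_eval_add)

lemma \<Phi>_I: "x \<in> I \<Longrightarrow> \<Phi> x = 0"
proof -
  interpret \<Phi>: ring_hom_cring P "induced_ring S" \<Phi>
    by (intro ring_hom_cringI2 P.is_cring S.cring_induced_ring \<Phi>_hom)
  have "ideal (a_kernel P (induced_ring S) \<Phi>) P" by (rule \<Phi>.ring.kernel_is_ideal)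
  moreover have "rels \<subseteq> a_kernel P (induced_ring S) \<Phi>"
  proof
    fix x assume x: "x \<in> rels"
    have "\<Phi> x = 0"
    proof -
      have cl: "\<alpha> r \<in> carrier A" "\<beta> r \<in> carrier B" if "r \<in> carrier R" for r
        using \<alpha> \<beta> that by auto
      from x consider
        (left) a a' b where "x = frag_of (a \<oplus>\<^bsub>A\<^esub> a', b) - frag_of (a, b) - frag_of (a', b)"
          "a \<in> carrier A" "a' \<in> carrier A" "b \<in> carrier B"
        | (right) a b b' where "x = frag_of (a, b \<oplus>\<^bsub>B\<^esub> b') - frag_of (a, b) - frag_of (a, b')"
          "a \<in> carrier A" "b \<in> carrier B" "b' \<in> carrier B"
        | (scalar) r a b where "x = frag_of (\<alpha> r \<otimes>\<^bsub>A\<^esub> a, b) - frag_of (a, \<beta> r \<otimes>\<^bsub>B\<^esub> b)"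
          "r \<in> carrier R" "a \<in> carrier A" "b \<in> carrier B"
        unfolding tensor_relations_def by blast
      then show ?thesis
        by (cases; hypsubst) (simp_all add: frag_eval_diff frag_eval_add f_simps g_simps algebra_simps cl agree)
    qed
    then show "x \<in> a_kernel P (induced_ring S) \<Phi>"
      using x rels_subset unfolding a_kernel_def' by auto
  qed
  ultimately have "I \<subseteq> a_kernel P (induced_ring S) \<Phi>" unfolding I_def by (rule P.genideal_minimal)
  then show "x \<in> I \<Longrightarrow> \<Phi> x = 0" unfolding a_kernel_def' by auto
qed

lemma T_eq: "T = P Quot I" by (simp add: tensor_ring_def I_def)

lemma cring_T: "cring T"
  unfolding T_eq by (rule I.quotient_is_cring[OF P.is_cring])

lemma T_cases:
  assumes "t \<in> carrier T" obtains p where "p \<in> carrier P" "t = I +>\<^bsub>P\<^esub> p"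
  using assms unfolding T_eq FactRing_def A_RCOSETS_def' by auto

lemma coset_in_T: "p \<in> carrier P \<Longrightarrow> I +>\<^bsub>P\<^esub> p \<in> carrier T"
  unfolding T_eq by (rule ring_hom_closed[OF I.rcos_ring_hom])

lemma tensor_lift_coset:
  assumes p: "p \<in> carrier P"
  shows "tensor_lift (induced_ring S) f g (I +>\<^bsub>P\<^esub> p) = \<Phi> p"
proof -
  have eq: "(\<Oplus>\<^bsub>induced_ring S\<^esub>x\<in>Poly_Mapping.keys q.
      [Poly_Mapping.lookup q x] \<cdot>\<^bsub>induced_ring S\<^esub> (f (fst x) \<otimes>\<^bsub>induced_ring S\<^esub> g (snd x))) = \<Phi> q"
    if q: "q \<in> carrier P" for q
  proof -
    have in_S: "f (fst x) * g (snd x) \<in> S" if "x \<in> Poly_Mapping.keys q" for x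
      using q that by (auto simp: pair_ring_simps intro!: S.mult_in f_simps g_simps)
    have mult: "[Poly_Mapping.lookup q x] \<cdot>\<^bsub>induced_ring S\<^esub> (f (fst x) \<otimes>\<^bsub>induced_ring S\<^esub> g (snd x)) =
        of_int (Poly_Mapping.lookup q x) * (f (fst x) * g (snd x))" if "x \<in> Poly_Mapping.keys q" for x
      using int_multiple_induced_ring[OF S.closed_under_ring_ops_axioms in_S[OF that]] by simp
    have "[Poly_Mapping.lookup q x] \<cdot>\<^bsub>induced_ring S\<^esub> (f (fst x) \<otimes>\<^bsub>induced_ring S\<^esub> g (snd x)) \<in> S"
      if "x \<in> Poly_Mapping.keys q" for x
      using mult[OF that] in_S[OF that] S.mult_in[OF S.of_int_in] by simp
    then show ?thesis
      unfolding frag_eval_def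
      by (subst finsum_induced_ring[OF S.closed_under_ring_ops_axioms]) (simp_all only: finite_keys mult cong: sum.cong)
  qed
  let ?F = "\<lambda>q. \<Oplus>\<^bsub>induced_ring S\<^esub>x\<in>Poly_Mapping.keys q.
      [Poly_Mapping.lookup q x] \<cdot>\<^bsub>induced_ring S\<^esub> (f (fst x) \<otimes>\<^bsub>induced_ring S\<^esub> g (snd x))"
  have const: "?F q = \<Phi> p" if q: "q \<in> I +>\<^bsub>P\<^esub> p" for q
  proof -
    from q obtain i where i: "i \<in> I" "q = i + p"
      by (auto simp: a_r_coset_def' pair_ring_simps(4))
    then have "q \<in> carrier P" using P.a_closed[OF I.Icarr[OF i(1)] p] by (simp add: pair_ring_simps(4))
    then show ?thesis using eq \<Phi>_I[OF i(1)] i(2) by (simp add: frag_eval_add)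
  qed
  have "?F ` (I +>\<^bsub>P\<^esub> p) = (\<lambda>_. \<Phi> p) ` (I +>\<^bsub>P\<^esub> p)"
    by (rule image_cong[OF refl const])
  also have "\<dots> = {\<Phi> p}" by (rule image_constant[OF I.a_rcos_self[OF p]])
  finally have "?F ` (I +>\<^bsub>P\<^esub> p) = {\<Phi> p}" .
  then show ?thesis by (simp add: tensor_lift_def)
qed

lemma tensor_lift_hom: "tensor_lift (induced_ring S) f g \<in> ring_hom T (induced_ring S)"
proof (rule ring_hom_memI)
  fix x y assume "x \<in> carrier T" "y \<in> carrier T"
  then obtain p q where p: "p \<in> carrier P" "x = I +>\<^bsub>P\<^esub> p" and q: "q \<in> carrier P" "y = I +>\<^bsub>P\<^esub> q"
    by (elim T_cases)
  have "x \<otimes>\<^bsub>T\<^esub> y = I +>\<^bsub>P\<^esub> (p \<otimes>\<^bsub>P\<^esub> q)" "x \<oplus>\<^bsub>T\<^esub> y = I +>\<^bsub>P\<^esub> (p \<oplus>\<^bsub>P\<^esub> q)"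
    using ring_hom_mult[OF I.rcos_ring_hom p(1) q(1)] ring_hom_add[OF I.rcos_ring_hom p(1) q(1)]
    by (simp_all add: T_eq p q)
  then show "tensor_lift (induced_ring S) f g (x \<otimes>\<^bsub>T\<^esub> y) =
      tensor_lift (induced_ring S) f g x \<otimes>\<^bsub>induced_ring S\<^esub> tensor_lift (induced_ring S) f g y"
    and "tensor_lift (induced_ring S) f g (x \<oplus>\<^bsub>T\<^esub> y) =
      tensor_lift (induced_ring S) f g x \<oplus>\<^bsub>induced_ring S\<^esub> tensor_lift (induced_ring S) f g y"
    using p q ring_hom_mult[OF \<Phi>_hom p(1) q(1)] ring_hom_add[OF \<Phi>_hom p(1) q(1)]
    by (simp_all add: tensor_lift_coset P.m_closed P.a_closed)
next
  show "tensor_lift (induced_ring S) f g \<one>\<^bsub>T\<^esub> = \<one>\<^bsub>induced_ring S\<^esub>"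
    using ring_hom_one[OF I.rcos_ring_hom] tensor_lift_coset[OF P.one_closed] ring_hom_one[OF \<Phi>_hom]
    by (simp add: T_eq)
qed (auto elim!: T_cases simp: tensor_lift_coset \<Phi>_in)

lemma mult_span_image:
  assumes "s \<in> mult_span (f' ` carrier A) (g' ` carrier B)"
  shows "\<exists>p\<in>carrier P. frag_eval f' g' p = s"
  using assms
proof (induction rule: mult_span.induct)
  case zero
  show ?case by (rule bexI[of _ 0]) (simp_all add: zero_pair_closed)
next
  case (step x y s)
  then obtain a b p where "a \<in> carrier A" "x = f' a" "b \<in> carrier B" "y = g' b"
    "p \<in> carrier P" "frag_eval f' g' p = s" by blast
  then show ?case
    using P.a_closed[of "frag_of (a, b)" p] pure_closed[of a A b B]
    by (intro bexI[of _ "frag_of (a, b) + p"]) (simp_all add: frag_eval_add pair_ring_simps(4))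
qed

lemma coset_zero_power:
  assumes p: "p \<in> carrier P" and "p [^]\<^bsub>P\<^esub> (n::nat) \<in> I"
  shows "(I +>\<^bsub>P\<^esub> p) [^]\<^bsub>T\<^esub> n = \<zero>\<^bsub>T\<^esub>"
proof -
  interpret T: cring T by (rule cring_T)
  have "(I +>\<^bsub>P\<^esub> p) [^]\<^bsub>T\<^esub> k = I +>\<^bsub>P\<^esub> (p [^]\<^bsub>P\<^esub> k)" for k :: nat
  proof (induction k)
    case 0
    show ?case using ring_hom_one[OF I.rcos_ring_hom] by (simp add: T_eq)
  next
    case (Suc k)
    then show ?case
      using ring_hom_mult[OF I.rcos_ring_hom P.nat_pow_closed[OF p] p] by (simp add: T_eq)
  qed
  moreover have "I +>\<^bsub>P\<^esub> (p [^]\<^bsub>P\<^esub> n) = I" by (rule I.a_rcos_const[OF assms(2)])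
  ultimately show ?thesis by (simp add: T_eq FactRing_def)
qed

end

section \<open>The fibre product and its normalization\<close>

text \<open>The second factor \<open>B\<close> is a ring of polynomials in variables of its own; \<open>j\<close> identifies it with
  \<open>K[Y, V]\<^sup>G\<close>, and \<open>j'\<close> is the inverse of this isomorphism.\<close>

locale fibre_product = fibre_product_actions G U W V Y sX sW sV sY spec
  for G :: "('a, 'b) monoid_scheme" (structure)
    and U W V Y :: "nat set" and sX sW sV sY :: "'a \<Rightarrow> nat \<Rightarrow> 'k::field mpoly" and spec +
  fixes B :: "'k mpoly set" and j j' :: "nat \<Rightarrow> 'k mpoly" and pull :: "'k mpoly \<Rightarrow> 'k mpoly"
    and N :: nat
  assumes variables: "U \<union> W \<union> V = {..<N}"
    and B_closed: "closed_under_ring_ops B"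
    and j: "\<And>b. b \<in> B \<Longrightarrow> psubst j b \<in> B2'" "\<And>b. b \<in> B \<Longrightarrow> psubst j' (psubst j b) = b"
    and j': "\<And>y. y \<in> B2' \<Longrightarrow> psubst j' y \<in> B" "\<And>y. y \<in> B2' \<Longrightarrow> psubst j (psubst j' y) = y"
    and RX_B: "RX \<subseteq> B" "\<And>r. r \<in> RX \<Longrightarrow> psubst spec (psubst j r) = r"
    and RY_spec: "\<And>r. r \<in> RY \<Longrightarrow> psubst spec r \<in> RX" "\<And>r. r \<in> RY \<Longrightarrow> psubst j' r = psubst spec r"
    and pull: "\<And>b. b \<in> B \<Longrightarrow> pull b = psubst spec (psubst j b)" and pull_B: "pull ` B = B2"
begin

sublocale B: closed_under_ring_ops B by (rule B_closed)

lemma B1_subset_C: "B1 \<subseteq> C"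
proof
  fix a assume a: "a \<in> B1"
  then have "a \<in> polys (U \<union> W \<union> V)" by (intro polys_mono[OF _ B1_polys]) auto
  moreover have "psubst (sV g) a = a" if "g \<in> carrier G" for g
    by (rule fixes_other(3)[OF B1_polys[OF a] _ that]) (use disjoint in auto)
  ultimately show "a \<in> C" using a by (auto simp: C_def B1_def invariants_def psubst_compose(4))
qed

lemma B2_subset_C: "B2 \<subseteq> C"
proof
  fix b assume b: "b \<in> B2"
  then have b_polys: "b \<in> polys (U \<union> V)" by (simp add: B2_def invariants_def)
  then have "b \<in> polys (U \<union> W \<union> V)" by (rule polys_mono[rotated]) auto
  moreover have "psubst (sXWV g) b = b" if g: "g \<in> carrier G" for g
  proof -
    have "psubst (sV g) b \<in> polys (U \<union> V)"
      by (rule psubst_on(1)[OF substitution_on_mono[OF action_onD(1)[OF action(3) g]] b_polys]) simp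
    then have "psubst (sW g) (psubst (sV g) b) = psubst (sV g) b"
      by (rule fixes_other(2)) (use disjoint g in auto)
    then show ?thesis using b g by (auto simp: B2_def invariants_def psubst_compose)
  qed
  ultimately show "b \<in> C" by (auto simp: C_def invariants_def)
qed

lemma pull_in_B2: "b \<in> B \<Longrightarrow> pull b \<in> B2"
  using pull_B by auto

lemma RY_subset_B2': "RY \<subseteq> B2'" and KV_subset_B2': "KV \<subseteq> B2'"
proof
  fix r assume r: "r \<in> RY"
  then have Y: "r \<in> polys Y" by (simp add: RY_def invariants_def)
  then have "r \<in> polys (Y \<union> V)" by (rule polys_mono[rotated]) simp
  then show "r \<in> B2'"
    using r fixes_other(3)[OF Y disjoint(6)] by (auto simp: RY_def B2'_def invariants_def psubst_compose)
next
  show "KV \<subseteq> B2'"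
  proof
    fix w assume w: "w \<in> KV"
    then have V: "w \<in> polys V" by (simp add: KV_def invariants_def)
    have VY: "V \<inter> Y = {}" using disjoint by blast
    from V have "w \<in> polys (Y \<union> V)" by (rule polys_mono[rotated]) simp
    then show "w \<in> B2'"
      using w fixes_other(4)[OF V VY] by (auto simp: KV_def B2'_def invariants_def psubst_compose)
  qed
qed

lemma pconst_invariants: "pconst c \<in> invariants Z H"
  by (simp add: invariants_def pconst_in)

sublocale tensor: tensor_hom "induced_ring RX" "induced_ring B1" "induced_ring B" C
  "\<lambda>r. r" "\<lambda>r. r" pullback1 pull
proof (intro tensor_hom.intro tensor_hom_axioms.intro)
  show "cring (induced_ring RX)" "cring (induced_ring B1)" "cring (induced_ring B)"
    unfolding RX_def B1_def
    by (rule invariants.cring_induced_ring invariants.cring_induced_ring B.cring_induced_ring)+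
  show "closed_under_ring_ops C" unfolding C_def by (rule invariants_closed)
  show "(\<lambda>r. r) \<in> carrier (induced_ring RX) \<rightarrow> carrier (induced_ring B1)" using RX_subset_B1 by auto
  show "(\<lambda>r. r) \<in> carrier (induced_ring RX) \<rightarrow> carrier (induced_ring B)" using RX_B by auto
  show "pullback1 \<in> ring_hom (induced_ring B1) (induced_ring C)"
    using B1_subset_C by (auto simp: pullback1_def intro!: ring_hom_memI)
  show "pull \<in> ring_hom (induced_ring B) (induced_ring C)"
    using B2_subset_C pull_in_B2
    by (intro ring_hom_memI) (auto simp: pull B.one_in B.add_in B.mult_in psubst_hom)
  show "pullback1 r = pull r" if "r \<in> carrier (induced_ring RX)" for r
    using RX_B that by (auto simp: pullback1_def pull)
qed

abbreviation "T \<equiv> tensor_ring (induced_ring RX) (induced_ring B1) (\<lambda>r. r) (induced_ring B) (\<lambda>r. r)"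
abbreviation "\<phi> \<equiv> tensor_lift (induced_ring C) pullback1 pull"
abbreviation "ev \<equiv> frag_eval (\<lambda>a. a) (psubst j)"

lemma relations:
  "a \<in> B1 \<Longrightarrow> a' \<in> B1 \<Longrightarrow> b \<in> B \<Longrightarrow> frag_of (a + a', b) - frag_of (a, b) - frag_of (a', b) \<in> tensor.I"
  "a \<in> B1 \<Longrightarrow> b \<in> B \<Longrightarrow> b' \<in> B \<Longrightarrow> frag_of (a, b + b') - frag_of (a, b) - frag_of (a, b') \<in> tensor.I"
  "r \<in> RX \<Longrightarrow> a \<in> B1 \<Longrightarrow> b \<in> B \<Longrightarrow> frag_of (r * a, b) - frag_of (a, r * b) \<in> tensor.I"
  by (rule tensor.rels_in_I, unfold tensor_relations_def induced_ring_simps, blast)+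

lemma ev_in: "p \<in> carrier tensor.P \<Longrightarrow> ev p \<in> mult_span B1 B2'"
proof (induction rule: pair_ring_induct)
  case (diff p q)
  have "- ev q \<in> mult_span B1 B2'"
    using diff(2)
  proof (induction rule: mult_span.induct)
    case (step a b s)
    have "- a \<in> B1" using step(1) by (simp add: B1_def invariants.uminus_in)
    from mult_span.step[OF this step(2,4)] show ?case by simp
  qed (simp add: mult_span.zero)
  from mult_span_add[OF diff(1) this] show ?case by (simp add: frag_eval_diff)
qed (simp_all add: mult_span.zero mult_span_mult j(1))

lemma spec_ev: "p \<in> carrier tensor.P \<Longrightarrow> psubst spec (ev p) = tensor.\<Phi> p"
  by (induction rule: pair_ring_induct)
     (simp_all add: frag_eval_diff psubst_hom spec_B1 pull pullback1_def)

text \<open>Over a field, \<open>B1 \<otimes>\<^sub>K B\<close> is a subring of the polynomial ring in all variables. So an element of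
  the tensor product over the invariants \<open>RX\<close> in \<open>U\<close> is determined by a polynomial in \<open>U\<close>, \<open>W\<close>, \<open>Y\<close>, \<open>V\<close>. If this polynomial
  is even a sum of products of invariants in \<open>U, W\<close>, in \<open>Y\<close> and in \<open>V\<close>, then the invariants in \<open>Y\<close>
  can be moved across the tensor sign, and its value on the diagonal \<open>Y = U\<close> suffices.\<close>

lemma determined_on_diagonal:
  assumes p: "p \<in> carrier tensor.P" and ev_p: "ev p \<in> mult_span B1 (mult_span RY KV)"
    and zero: "psubst spec (ev p) = 0"
  shows "p \<in> tensor.I"
proof -
  obtain \<pi>1 where \<pi>1: "\<And>p. \<pi>1 p \<in> B1" "\<And>p. p \<in> B1 \<Longrightarrow> \<pi>1 p = p"
    "\<And>p q. \<pi>1 (p + q) = \<pi>1 p + \<pi>1 q" "\<And>c p. \<pi>1 (pconst c * p) = pconst c * \<pi>1 p"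
    unfolding B1_def using linear_projection_exists[OF linear_subspace_invariants] by blast
  obtain \<pi>2 where \<pi>2: "\<And>p. \<pi>2 p \<in> B2'" "\<And>p. p \<in> B2' \<Longrightarrow> \<pi>2 p = p"
    "\<And>p q. \<pi>2 (p + q) = \<pi>2 p + \<pi>2 q" "\<And>c p. \<pi>2 (pconst c * p) = pconst c * \<pi>2 p"
    unfolding B2'_def using linear_projection_exists[OF linear_subspace_invariants] by blast
  have pconst_RX: "pconst c \<in> RX" for c by (simp add: RX_def pconst_invariants)
  interpret M: balanced_map "U \<union> W" "Y \<union> V" tensor.I "\<lambda>a b. frag_of (\<pi>1 a, psubst j' (\<pi>2 b))"
  proof
    show "(U \<union> W) \<inter> (Y \<union> V) = {}" using disjoint by auto
    show "0 \<in> tensor.I" using tensor.I.zero_closed by (simp add: pair_ring_simps)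
    show "x - y \<in> tensor.I" if "x \<in> tensor.I" "y \<in> tensor.I" for x y
      using that by (rule tensor.I_diff)
    show "frag_of (\<pi>1 (a + a'), psubst j' (\<pi>2 b)) - frag_of (\<pi>1 a, psubst j' (\<pi>2 b)) -
        frag_of (\<pi>1 a', psubst j' (\<pi>2 b)) \<in> tensor.I" for a a' b
      unfolding \<pi>1(3) by (intro relations \<pi>1 j' \<pi>2)
    show "frag_of (\<pi>1 a, psubst j' (\<pi>2 (b + b'))) - frag_of (\<pi>1 a, psubst j' (\<pi>2 b)) -
        frag_of (\<pi>1 a, psubst j' (\<pi>2 b')) \<in> tensor.I" for a b b'
      unfolding \<pi>2(3) psubst_add by (intro relations \<pi>1 j' \<pi>2)
    show "frag_of (\<pi>1 (pconst c * a), psubst j' (\<pi>2 b)) -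
        frag_of (\<pi>1 a, psubst j' (\<pi>2 (pconst c * b))) \<in> tensor.I" for c a b
      unfolding \<pi>1(4) \<pi>2(4) psubst_mult psubst_pconst by (intro relations pconst_RX \<pi>1 j' \<pi>2)
  qed
  have bil_mult: "M.bil (a * b) - frag_of (a, psubst j' b) \<in> tensor.I" if "a \<in> B1" "b \<in> B2'" for a b
    using M.bil_mult[OF B1_polys[OF that(1)] B2'_polys[OF that(2)]] \<pi>1(2) \<pi>2(2) that by simp
  have bil_zero: "M.bil 0 = 0" by (simp add: M.bil_def)
  \<comment> \<open>\<open>ev\<close> is injective modulo the ideal, with inverse \<open>M.bil\<close>.\<close>
  have recover: "M.bil (ev q) - q \<in> tensor.I" if "q \<in> carrier tensor.P" for q
    using that
  proof (induction rule: pair_ring_induct)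
    case zero
    show ?case by (simp add: bil_zero M.J_zero)
  next
    case (pure a b)
    then show ?case using bil_mult[of a "psubst j b"] j by simp
  next
    case (diff q q')
    have "M.bil (ev q - ev q') - (M.bil (ev q) - M.bil (ev q')) \<in> tensor.I"
      using M.J_uminus[OF M.bil_add[of "ev q - ev q'" "ev q'"]] by (simp add: algebra_simps)
    moreover have "(M.bil (ev q) - M.bil (ev q')) - (q - q') \<in> tensor.I"
      using M.J_diff[OF diff] by (simp add: algebra_simps)
    ultimately show ?case unfolding frag_eval_diff by (rule M.J_trans)
  qed
  \<comment> \<open>Moving the invariant \<open>r\<close> in \<open>Y\<close> across the tensor sign.\<close>
  have inner: "M.bil (a * s) - M.bil (psubst spec (a * s)) \<in> tensor.I"
    if a: "a \<in> B1" and s: "s \<in> mult_span RY KV" for a s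
    using s
  proof (induction rule: mult_span.induct)
    case zero
    show ?case by (simp add: bil_zero M.J_zero)
  next
    case (step r w s)
    have w: "w \<in> B2'" and rw: "r * w \<in> B2'"
      using step RY_subset_B2' KV_subset_B2' by (auto simp: B2'_def intro!: invariants.mult_in)
    have spec_w: "psubst spec w = w"
      using step(2) disjoint by (intro spec_X[of _ V]) (auto simp: KV_def invariants_def)
    have r': "psubst spec r \<in> RX" by (rule RY_spec(1)[OF step(1)])
    have ar: "psubst spec r * a \<in> B1"
      using r' a RX_subset_B1 by (auto simp: B1_def intro!: invariants.mult_in)
    have "M.bil (a * (r * w)) - frag_of (a, psubst spec r * psubst j' w) \<in> tensor.I"
      using bil_mult[OF a rw] RY_spec(2)[OF step(1)] by (simp add: psubst_mult)
    moreover have "frag_of (a, psubst spec r * psubst j' w) - frag_of (psubst spec r * a, psubst j' w) \<in> tensor.I"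
      by (rule M.J_sym, rule relations(3)[OF r' a j'(1)[OF w]])
    moreover have "frag_of (psubst spec r * a, psubst j' w) - M.bil (psubst spec (a * (r * w))) \<in> tensor.I"
      using M.J_sym[OF bil_mult[OF ar w]] spec_B1[OF a] by (simp add: psubst_mult spec_w ac_simps)
    ultimately have 1: "M.bil (a * (r * w)) - M.bil (psubst spec (a * (r * w))) \<in> tensor.I"
      by (blast intro: M.J_trans)
    have "M.bil (a * (r * w) + a * s) - (M.bil (psubst spec (a * (r * w))) + M.bil (psubst spec (a * s))) \<in> tensor.I"
      by (rule M.J_trans[OF M.bil_add M.J_add_cong[OF 1 step(4)]])
    moreover have "(M.bil (psubst spec (a * (r * w))) + M.bil (psubst spec (a * s))) -
        M.bil (psubst spec (a * (r * w)) + psubst spec (a * s)) \<in> tensor.I"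
      by (rule M.J_sym[OF M.bil_add])
    ultimately have "M.bil (a * (r * w) + a * s) - M.bil (psubst spec (a * (r * w)) + psubst spec (a * s)) \<in> tensor.I"
      by (rule M.J_trans)
    then show ?case by (simp only: distrib_left psubst_add)
  qed
  have "M.bil s - M.bil (psubst spec s) \<in> tensor.I" if "s \<in> mult_span B1 (mult_span RY KV)" for s
    using that
  proof (induction rule: mult_span.induct)
    case zero
    show ?case by (simp add: bil_zero M.J_zero)
  next
    case (step a t s)
    have "M.bil (a * t + s) - (M.bil (psubst spec (a * t)) + M.bil (psubst spec s)) \<in> tensor.I"
      by (rule M.J_trans[OF M.bil_add M.J_add_cong[OF inner[OF step(1,2)] step(4)]])
    moreover have "(M.bil (psubst spec (a * t)) + M.bil (psubst spec s)) -
        M.bil (psubst spec (a * t) + psubst spec s) \<in> tensor.I"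
      by (rule M.J_sym[OF M.bil_add])
    ultimately have "M.bil (a * t + s) - M.bil (psubst spec (a * t) + psubst spec s) \<in> tensor.I"
      by (rule M.J_trans)
    then show ?case by (simp only: psubst_add)
  qed
  from this[OF ev_p] have "M.bil (ev p) \<in> tensor.I" by (simp add: zero bil_zero)
  from M.J_diff[OF this recover[OF p]] show ?thesis by simp
qed

lemma ev_mult: "p \<in> carrier tensor.P \<Longrightarrow> q \<in> carrier tensor.P \<Longrightarrow> ev (p \<otimes>\<^bsub>tensor.P\<^esub> q) = ev p * ev q"
  by (rule tensor.frag_eval_mult) (simp_all add: psubst_mult)

lemma ev_surj:
  assumes "s \<in> mult_span B1 B2'" shows "\<exists>p. p \<in> carrier tensor.P \<and> ev p = s"
proof -
  have "B2' \<subseteq> psubst j ` B"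
  proof
    fix y assume y: "y \<in> B2'"
    show "y \<in> psubst j ` B" by (rule image_eqI[of _ _ "psubst j' y"]) (simp_all add: j' y)
  qed
  then have "s \<in> mult_span ((\<lambda>a. a) ` carrier (induced_ring B1)) (psubst j ` carrier (induced_ring B))"
    by (intro mult_span_mono[OF assms]) auto
  from tensor.mult_span_image[OF this] show ?thesis by blast
qed

text \<open>For \<open>p\<close> in the kernel, the monic equation of \<open>ev p\<close> has all lower coefficients zero on the
  diagonal. They are determined by their values there, so a power of \<open>p\<close> vanishes in the tensor
  product.\<close>

lemma kernel_nilpotent:
  assumes p: "p \<in> carrier tensor.P" and zero: "tensor.\<Phi> p = 0"
  shows "\<exists>n::nat. p [^]\<^bsub>tensor.P\<^esub> n \<in> tensor.I"
proof -
  have ev_p: "ev p \<in> mult_span B1 B2'" and spec_p: "psubst spec (ev p) = 0"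
    using ev_in[OF p] spec_ev[OF p] zero by auto
  obtain E where E: "Polynomial.coeff E (Polynomial.degree E) = 1" "poly E (ev p) = 0"
    "\<And>i. Polynomial.coeff E i \<in> mult_span B1 (mult_span RY KV)"
    "\<And>i. i < Polynomial.degree E \<Longrightarrow> psubst spec (Polynomial.coeff E i) = 0"
    using kernel_element_equation[OF ev_p spec_p] by blast
  define n where "n = Polynomial.degree E"
  have sub: "mult_span RY KV \<subseteq> B2'"
  proof
    fix s assume "s \<in> mult_span RY KV"
    then show "s \<in> B2'"
      by (induction rule: mult_span.induct)
         (use RY_subset_B2' KV_subset_B2' in \<open>auto simp: B2'_def intro!: invariants.zero_in
            invariants.add_in invariants.mult_in\<close>)
  qed
  have "\<forall>i. \<exists>u. u \<in> carrier tensor.P \<and> ev u = Polynomial.coeff E i"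
  proof
    fix i
    have "Polynomial.coeff E i \<in> mult_span B1 B2'"
      by (rule mult_span_mono[OF E(3) subset_refl sub])
    then show "\<exists>u. u \<in> carrier tensor.P \<and> ev u = Polynomial.coeff E i" by (rule ev_surj)
  qed
  from choice[OF this] obtain u
    where u: "\<And>i. u i \<in> carrier tensor.P" "\<And>i. ev (u i) = Polynomial.coeff E i" by auto
  have u_I: "u i \<in> tensor.I" if "i < n" for i
    by (rule determined_on_diagonal) (use u E(3,4) that in \<open>simp_all add: n_def\<close>)
  have pow: "p [^]\<^bsub>tensor.P\<^esub> k \<in> carrier tensor.P" for k :: nat
    by (rule tensor.P.nat_pow_closed[OF p])
  have ev_pow: "ev (p [^]\<^bsub>tensor.P\<^esub> k) = ev p ^ k" for k :: nat
  proof (induction k)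
    case 0
    show ?case by (simp add: pair_ring_simps(2))
  next
    case (Suc k)
    then show ?case using ev_mult[OF pow p] by (simp add: mult.commute)
  qed
  define v where "v = (\<Sum>i<n. u i \<otimes>\<^bsub>tensor.P\<^esub> p [^]\<^bsub>tensor.P\<^esub> i)"
  have I_zero: "0 \<in> tensor.I" using tensor.I.zero_closed by (simp add: pair_ring_simps)
  have I_add: "x + y \<in> tensor.I" if "x \<in> tensor.I" "y \<in> tensor.I" for x y
    using tensor.I.a_closed[OF that] by (simp add: pair_ring_simps)
  have "(\<Sum>i\<in>M. u i \<otimes>\<^bsub>tensor.P\<^esub> p [^]\<^bsub>tensor.P\<^esub> i) \<in> tensor.I" if "finite M" "M \<subseteq> {..<n}" for M
    using that
    by (induction M rule: finite_induct) (simp_all add: I_zero I_add tensor.I.I_r_closed[OF u_I pow])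
  then have v: "v \<in> tensor.I" unfolding v_def by simp
  have "ev (p [^]\<^bsub>tensor.P\<^esub> n + v) = ev p ^ n + (\<Sum>i<n. Polynomial.coeff E i * ev p ^ i)"
    by (simp add: v_def frag_eval_add frag_eval_sum ev_mult u pow ev_pow)
  also have "\<dots> = poly E (ev p)"
    using E(1) by (simp add: poly_altdef n_def flip: lessThan_Suc_atMost)
  finally have ev_zero: "ev (p [^]\<^bsub>tensor.P\<^esub> n + v) = 0" using E(2) by simp
  have "p [^]\<^bsub>tensor.P\<^esub> n + v \<in> tensor.I"
  proof (rule determined_on_diagonal)
    show "p [^]\<^bsub>tensor.P\<^esub> n + v \<in> carrier tensor.P"
      using tensor.P.a_closed[OF pow tensor.I.Icarr[OF v]] by (simp add: pair_ring_simps(4))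
  qed (simp_all add: ev_zero mult_span.zero)
  from tensor.I_diff[OF this v] show ?thesis by auto
qed

lemma span_in_image:
  assumes "s \<in> mult_span B1 B2" shows "s \<in> \<phi> ` carrier T"
proof -
  have "s \<in> mult_span (pullback1 ` carrier (induced_ring B1)) (pull ` carrier (induced_ring B))"
    using assms pull_B by (simp add: pullback1_def[abs_def])
  from tensor.mult_span_image[OF this] obtain p where "p \<in> carrier tensor.P" "tensor.\<Phi> p = s" by blast
  then show ?thesis
    using tensor.coset_in_T tensor.tensor_lift_coset by (intro image_eqI[of _ _ "tensor.I +>\<^bsub>tensor.P\<^esub> p"]) auto
qed

lemma C_completely_integrally_closed:
  assumes f: "f \<in> C" and s: "s \<in> C" and d: "s \<noteq> 0" "d \<noteq> 0" "\<And>k. \<exists>g\<in>C. d * f ^ k = s ^ k * g"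
  shows "\<exists>g\<in>C. f = s * g"
proof -
  have "f \<in> polys {..<N}" "s \<in> polys {..<N}" using f s by (simp_all add: C_def invariants_def variables)
  then obtain g where g: "g \<in> polys {..<N}" "f = s * g"
    using polys_completely_integrally_closed[of f N s d] d by blast
  have "psubst \<sigma> g = g" if "\<sigma> \<in> sXWV ` carrier G" for \<sigma>
  proof -
    have "psubst \<sigma> f = f" "psubst \<sigma> s = s" using f s that by (auto simp: C_def invariants_def)
    then have "s * psubst \<sigma> g = s * g" using g(2) by (simp add: psubst_mult)
    then show ?thesis using d(1) by simp
  qed
  then show ?thesis using g by (auto simp: C_def invariants_def variables)
qed

theorem fibre_product_normalization:
  "is_normalization_of_Spec T (Spec (induced_ring C)) (Spec_map T (induced_ring C) \<phi>)"
proof -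
  have "normalization_data T C \<phi>"
  proof (intro normalization_data.intro normalization_data_axioms.intro)
    show "cring T" by (rule tensor.cring_T)
    show "closed_under_ring_ops C" unfolding C_def by (rule invariants_closed)
    show "\<phi> \<in> ring_hom T (induced_ring C)" by (rule tensor.tensor_lift_hom)
    show "\<exists>n::nat. t [^]\<^bsub>T\<^esub> n = \<zero>\<^bsub>T\<^esub>" if t: "t \<in> carrier T" "\<phi> t = 0" for t
    proof -
      obtain p where p: "p \<in> carrier tensor.P" "t = tensor.I +>\<^bsub>tensor.P\<^esub> p"
        using t(1) by (elim tensor.T_cases)
      then have "tensor.\<Phi> p = 0" using t(2) tensor.tensor_lift_coset by simp
      from kernel_nilpotent[OF p(1) this] show ?thesis using tensor.coset_zero_power[OF p(1)] p(2) by blast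
    qed
    obtain r where r: "r \<in> RX" "r \<noteq> 0" "\<And>c. c \<in> C \<Longrightarrow> r * c \<in> mult_span B1 B2"
      using common_denominator by blast
    have "1 \<in> B2" unfolding B2_def by (rule invariants.one_in)
    then have "r \<in> mult_span B1 B2" using mult_span_mult[of r B1 1 B2] r(1) RX_subset_B1 by auto
    then obtain s where s: "s \<in> carrier T" "\<phi> s = r" using span_in_image by blast
    show "\<exists>t\<in>carrier T. \<exists>s\<in>carrier T. \<phi> s \<noteq> 0 \<and> \<phi> t = \<phi> s * c" if c: "c \<in> C" for c
    proof -
      obtain t where "t \<in> carrier T" "\<phi> t = r * c" using span_in_image[OF r(3)[OF c]] by force
      then show ?thesis using s r(2) by blast
    qed
    show "\<exists>P. Polynomial.coeff P (Polynomial.degree P) = 1 \<and>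
        (\<forall>i. Polynomial.coeff P i \<in> \<phi> ` carrier T) \<and> poly P c = 0" if c: "c \<in> C" for c
    proof -
      obtain P where "Polynomial.coeff P (Polynomial.degree P) = 1"
        "\<And>i. Polynomial.coeff P i \<in> mult_span B1 B2" "poly P c = 0"
        using C_integral[OF c] by blast
      then show ?thesis by (intro exI[of _ P] conjI allI span_in_image)
    qed
    show "\<exists>g\<in>C. f = s * g"
      if "f \<in> C" "s \<in> C" "d \<in> C" "s \<noteq> 0" "d \<noteq> 0" "\<And>k. \<exists>g\<in>C. d * f ^ k = s ^ k * g" for f s d
      using C_completely_integrally_closed[OF that(1,2,4,5,6)] .
  qed
  then show ?thesis by (rule normalization_data.is_normalization)
qed

end

section \<open>Matrices acting on blocks of variables\<close>

definition block :: "nat \<Rightarrow> 'k::field mat \<Rightarrow> nat \<Rightarrow> 'k mpoly" where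
  "block k A i = (if k \<le> i \<and> i < k + dim_row A
     then \<Sum>j<dim_col A. pconst (A $$ (i - k, j)) * pvar (k + j) else pvar i)"

lemma block_in: "k \<le> i \<Longrightarrow> i < k + dim_row A \<Longrightarrow>
    block k A i = (\<Sum>j<dim_col A. pconst (A $$ (i - k, j)) * pvar (k + j))"
  and block_out: "\<not> (k \<le> i \<and> i < k + dim_row A) \<Longrightarrow> block k A i = pvar i"
  by (auto simp: block_def)

lemma substitution_on_block:
  "A \<in> carrier_mat n n \<Longrightarrow> substitution_on {k..<k + n} (block k A)"
  by (auto simp: substitution_on_def block_def intro!: polys.sum_in pconst_mult_in pvar_in)

lemma psubst_block_id:
  assumes "A \<in> carrier_mat n n" "p \<in> polys Z" "Z \<inter> {k..<k + n} = {}"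
  shows "psubst (block k A) p = p"
  by (rule psubst_on(2)[OF substitution_on_block]) (use assms in auto)

lemma block_mult:
  assumes A: "A \<in> carrier_mat n n" and B: "B \<in> carrier_mat n n"
  shows "psubst (block k A) (psubst (block k B) p) = psubst (block k (B * A)) p"
proof -
  have "psubst (block k A) (block k B i) = block k (B * A) i" for i
  proof (cases "k \<le> i \<and> i < k + n")
    case True
    then have i: "k \<le> i" "i < k + n" "i - k < n" by auto
    have "psubst (block k A) (block k B i) =
        (\<Sum>j<n. pconst (B $$ (i - k, j)) * (\<Sum>l<n. pconst (A $$ (j, l)) * pvar (k + l)))"
      using A B i by (simp add: block_in psubst_hom)
    also have "\<dots> = (\<Sum>l<n. \<Sum>j<n. pconst (B $$ (i - k, j)) * pconst (A $$ (j, l)) * pvar (k + l))"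
      unfolding sum_distrib_left by (subst sum.swap) (simp only: mult.assoc)
    also have "\<dots> = (\<Sum>l<n. pconst ((B * A) $$ (i - k, l)) * pvar (k + l))"
    proof (rule sum.cong[OF refl])
      fix l assume l: "l \<in> {..<n}"
      have pconst_sum: "pconst (sum f M) = (\<Sum>j\<in>M. pconst (f j))" for f :: "nat \<Rightarrow> 'a" and M
        by (induction M rule: infinite_finite_induct) (simp_all add: pconst_simps)
      have "(B * A) $$ (i - k, l) = (\<Sum>j<n. B $$ (i - k, j) * A $$ (j, l))"
        using A B i(3) l by (simp add: scalar_prod_def atLeast0LessThan)
      then show "(\<Sum>j<n. pconst (B $$ (i - k, j)) * pconst (A $$ (j, l)) * pvar (k + l)) =
          pconst ((B * A) $$ (i - k, l)) * pvar (k + l)"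
        by (simp add: pconst_sum pconst_simps sum_distrib_right)
    qed
    also have "\<dots> = block k (B * A) i" using A B i by (simp add: block_in)
    finally show ?thesis .
  next
    case False
    then show ?thesis using A B by (simp add: block_out)
  qed
  then show ?thesis by (simp add: psubst_comp)
qed

lemma block_one:
  fixes p :: "'k::field mpoly"
  shows "psubst (block k (1\<^sub>m n)) p = p"
proof -
  have "block k (1\<^sub>m n) i = (pvar i :: 'k mpoly)" for i
  proof (cases "k \<le> i \<and> i < k + n")
    case True
    then have i: "i - k < n" by auto
    have "block k (1\<^sub>m n) i = (\<Sum>j<n. pconst ((1\<^sub>m n :: 'k mat) $$ (i - k, j)) * pvar (k + j))"
      using True by (simp add: block_def)
    also have "\<dots> = (\<Sum>j<n. if j = i - k then pvar i else 0)"
      by (rule sum.cong) (use True i in \<open>auto simp: pconst_simps\<close>)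
    finally show ?thesis using i by simp
  qed (simp add: block_out)
  then show ?thesis using psubst_id[of p UNIV "block k (1\<^sub>m n)"] by simp
qed

lemma hom_GL:
  fixes \<rho> :: "'g \<Rightarrow> 'k::field mat"
  assumes "group G" and \<rho>: "\<rho> \<in> hom G (GL n)"
  shows "g \<in> carrier G \<Longrightarrow> \<rho> g \<in> carrier_mat n n"
    and "g \<in> carrier G \<Longrightarrow> h \<in> carrier G \<Longrightarrow> \<rho> (g \<otimes>\<^bsub>G\<^esub> h) = \<rho> g * \<rho> h"
    and "\<rho> \<one>\<^bsub>G\<^esub> = 1\<^sub>m n"
proof -
  have "ring (ring_mat TYPE('k) n ())" by (rule ring_mat)
  then have m: "Group.monoid (ring_mat TYPE('k) n ())" by (rule ring.axioms(2))
  show "g \<in> carrier G \<Longrightarrow> \<rho> g \<in> carrier_mat n n"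
    using \<rho> by (auto simp: hom_def GL_def units_of_def Units_def ring_mat_def)
  show "g \<in> carrier G \<Longrightarrow> h \<in> carrier G \<Longrightarrow> \<rho> (g \<otimes>\<^bsub>G\<^esub> h) = \<rho> g * \<rho> h"
    using \<rho> by (auto simp: hom_def GL_def units_of_def ring_mat_def)
  have GL: "group (GL n :: 'k mat monoid)" unfolding GL_def by (rule monoid.units_group[OF m])
  interpret group_hom G "GL n" \<rho> using assms GL by (simp add: group_hom_def group_hom_axioms_def)
  show "\<rho> \<one>\<^bsub>G\<^esub> = 1\<^sub>m n" using hom_one by (simp add: GL_def units_of_def ring_mat_def)
qed

lemma action_on_block:
  assumes "group G" and \<rho>: "\<rho> \<in> hom G (GL n)"
  shows "group.action_on G {k..<k + n} (\<lambda>g. block k (\<rho> g))"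
proof -
  interpret group G by fact
  note \<rho>' = hom_GL[OF assms]
  show ?thesis
    unfolding action_on_def
    by (simp add: \<rho>' substitution_on_block block_mult[OF \<rho>'(1) \<rho>'(1)] block_one)
qed

lemma diag_block:
  assumes A: "A \<in> carrier_mat a a" and B: "B \<in> carrier_mat b b"
  shows "diag_block_mat [A, B] \<in> carrier_mat (a + b) (a + b)"
    and "psubst (block k (diag_block_mat [A, B])) p = psubst (block k A) (psubst (block (k + a) B) p)"
proof -
  define D where "D = diag_block_mat [A, B]"
  have "four_block_mat B (0\<^sub>m b 0) (0\<^sub>m 0 b) (0\<^sub>m 0 0) = B"
    by (rule eq_matI) (use B in auto)
  then have D: "D = four_block_mat A (0\<^sub>m a b) (0\<^sub>m b a) B"
    using A B by (simp add: D_def Let_def)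
  have carrier: "D \<in> carrier_mat (a + b) (a + b)" unfolding D using A B by simp
  then show "diag_block_mat [A, B] \<in> carrier_mat (a + b) (a + b)" by (simp only: D_def)
  have split: "sum f {..<a + b} = sum f {..<a} + (\<Sum>j<b. f (a + j))" for f :: "nat \<Rightarrow> 'a mpoly"
    by (induction b) (simp_all add: add.assoc)
  have "block k D i = psubst (block k A) (block (k + a) B i)" for i
  proof -
    consider "k \<le> i" "i < k + a" | "k + a \<le> i" "i < k + a + b" | "\<not> (k \<le> i \<and> i < k + a + b)"
      by linarith
    then show ?thesis
    proof cases
      case 1
      then have "block k D i = (\<Sum>j<a + b. pconst (D $$ (i - k, j)) * pvar (k + j))"
        using carrier by (simp add: block_in)
      also have "\<dots> = (\<Sum>j<a. pconst (A $$ (i - k, j)) * pvar (k + j))"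
        unfolding split using 1 carrier_matD[OF A] carrier_matD[OF B] less_diff_conv2[of k i a]
        by (simp add: D pconst_simps add.commute)
      also have "\<dots> = psubst (block k A) (block (k + a) B i)"
        using 1 A B by (simp add: block_in block_out)
      finally show ?thesis .
    next
      case 2
      have entries: "j < a \<Longrightarrow> D $$ (i - k, j) = 0"
        "j < b \<Longrightarrow> D $$ (i - k, a + j) = B $$ (i - (k + a), j)" for j
        unfolding D using 2 A B by (subst index_mat_four_block; simp)+
      from 2 have "block k D i = (\<Sum>j<a + b. pconst (D $$ (i - k, j)) * pvar (k + j))"
        using carrier by (simp add: block_in)
      also have "\<dots> = (\<Sum>j<b. pconst (B $$ (i - (k + a), j)) * pvar (k + a + j))"
        unfolding split by (simp add: entries pconst_simps add.assoc)
      also have "\<dots> = psubst (block k A) (block (k + a) B i)"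
        using 2 A B by (simp add: block_in psubst_hom block_out)
      finally show ?thesis .
    next
      case 3
      then show ?thesis using A B carrier by (auto simp: block_out)
    qed
  qed
  then have "block k D = (\<lambda>i. psubst (block k A) (block (k + a) B i))" by (rule ext)
  then show "psubst (block k (diag_block_mat [A, B])) p = psubst (block k A) (psubst (block (k + a) B) p)"
    unfolding D_def[symmetric] psubst_comp by (simp only:)
qed

lemma linear_action_eq_block:
  assumes "A \<in> carrier_mat n n" "p \<in> polys {..<n}"
  shows "linear_action A p = psubst (block 0 A) p"
  unfolding linear_action_def by (rule psubst_cong[OF assms(2)]) (use assms(1) in \<open>auto simp: block_in\<close>)

lemma invariant_ring_eq:
  assumes "\<And>g. g \<in> carrier G \<Longrightarrow> \<sigma> g \<in> carrier_mat n n"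
    and "\<And>g p. g \<in> carrier G \<Longrightarrow> psubst (block 0 (\<sigma> g)) p = psubst (s g) p"
  shows "invariant_ring G n \<sigma> = induced_ring (invariants {..<n} (s ` carrier G))"
proof -
  have "{p. (\<forall>e\<in>Poly_Mapping.keys p. Poly_Mapping.keys e \<subseteq> {..<n}) \<and>
      (\<forall>g\<in>carrier G. linear_action (\<sigma> g) p = p)} = invariants {..<n} (s ` carrier G)"
    using linear_action_eq_block[OF assms(1)] assms(2) by (auto simp: invariants_def polys_def)
  then show ?thesis by (simp add: invariant_ring_def induced_ring_def)
qed

text \<open>The two blocks of variables of a direct sum can be moved to arbitrary places: renaming is
  equivariant.\<close>

lemma rename_invariants:
  fixes A B :: "'g \<Rightarrow> 'k::field mat" and a b k l :: nat
  assumes A: "\<And>g. g \<in> H \<Longrightarrow> A g \<in> carrier_mat a a" and B: "\<And>g. g \<in> H \<Longrightarrow> B g \<in> carrier_mat b b"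
    and disj: "{k..<k + a} \<inter> {l..<l + b} = {}"
  defines "r \<equiv> \<lambda>i. pvar (if i < a then k + i else l + (i - a)) :: 'k mpoly"
    and "r' \<equiv> \<lambda>i. pvar (if k \<le> i \<and> i < k + a then i - k else a + (i - l)) :: 'k mpoly"
    and "S \<equiv> invariants {..<a + b} ((\<lambda>g. block 0 (diag_block_mat [A g, B g])) ` H)"
    and "S' \<equiv> invariants ({k..<k + a} \<union> {l..<l + b})
      ((\<lambda>g i. psubst (block k (A g)) (block l (B g) i)) ` H)"
  shows "p \<in> S \<Longrightarrow> psubst r p \<in> S'" "p \<in> S \<Longrightarrow> psubst r' (psubst r p) = p"
    and "q \<in> S' \<Longrightarrow> psubst r' q \<in> S" "q \<in> S' \<Longrightarrow> psubst r (psubst r' q) = q"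
proof -
  let ?Z = "{k..<k + a} \<union> {l..<l + b}"
  have r_in: "psubst r p \<in> polys ?Z" if "p \<in> polys {..<a + b}" for p
    by (rule psubst_in[OF that]) (auto simp: r_def intro!: pvar_in)
  have r'_in: "psubst r' p \<in> polys {..<a + b}" if "p \<in> polys ?Z" for p
    by (rule psubst_in[OF that]) (auto simp: r'_def intro!: pvar_in)
  have r'r: "psubst r' (psubst r p) = p" if "p \<in> polys {..<a + b}" for p
  proof -
    have "psubst r' (r i) = pvar i" if "i \<in> {..<a + b}" for i
    proof (cases "i < a")
      case False
      then have "l + (i - a) \<in> {l..<l + b}" using that by auto
      then have "\<not> (k \<le> l + (i - a) \<and> l + (i - a) < k + a)" using disj by auto
      then have "r' (l + (i - a)) = pvar (a + (l + (i - a) - l))"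
        unfolding r'_def by (simp only: if_False)
      then show ?thesis using False by (simp add: r_def)
    qed (simp add: r_def r'_def)
    then show ?thesis unfolding psubst_comp by (rule psubst_id[OF that])
  qed
  have rr': "psubst r (psubst r' p) = p" if "p \<in> polys ?Z" for p
    unfolding psubst_comp by (rule psubst_id[OF that]) (auto simp: r_def r'_def)
  have equivariant: "psubst (\<lambda>i. psubst (block k (A g)) (block l (B g) i)) (psubst r p) =
      psubst r (psubst (block 0 (diag_block_mat [A g, B g])) p)"
    if p: "p \<in> polys {..<a + b}" and g: "g \<in> H" for g p
  proof -
    have "psubst (block k (A g)) (psubst (block l (B g)) (r i)) =
        psubst r (psubst (block 0 (A g)) (block a (B g) i))" if i: "i \<in> {..<a + b}" for i
    proof (cases "i < a")
      case True
      then have "k + i \<in> {k..<k + a}" by simp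
      then have "\<not> (l \<le> k + i \<and> k + i < l + b)" using disj by auto
      then show ?thesis using True A[OF g] B[OF g]
        by (simp add: r_def block_in block_out psubst_hom)
    next
      case False
      have "\<not> (k \<le> l + j \<and> l + j < k + a)" if "j < b" for j
      proof -
        have "l + j \<in> {l..<l + b}" using that by simp
        then show ?thesis using disj by auto
      qed
      then show ?thesis using False i A[OF g] B[OF g]
        by (simp add: r_def block_in block_out psubst_hom)
    qed
    then have "psubst (block k (A g)) (psubst (block l (B g)) (psubst r p)) =
        psubst r (psubst (block 0 (A g)) (psubst (block a (B g)) p))"
      unfolding psubst_comp by (intro psubst_cong[OF p]) (simp add: psubst_comp)
    then show ?thesis using diag_block(2)[OF A[OF g] B[OF g], of 0 p] by (simp add: psubst_comp)
  qed
  have D: "diag_block_mat [A g, B g] \<in> carrier_mat (a + b) (a + b)" if "g \<in> H" for g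
    by (rule diag_block(1)[OF A[OF that] B[OF that]])
  show "psubst r p \<in> S'" "psubst r' (psubst r p) = p" if "p \<in> S" for p
    using that r_in r'r equivariant by (auto simp: S_def S'_def invariants_def)
  show "psubst r (psubst r' q) = q" if "q \<in> S'" for q
    using that rr' by (auto simp: S'_def invariants_def)
  \<comment> \<open>Invariance is reflected because renaming is injective on the polynomials concerned.\<close>
  show "psubst r' q \<in> S" if q: "q \<in> S'" for q
  proof -
    have q': "q \<in> polys ?Z" using q by (simp add: S'_def invariants_def)
    note in_polys = r'_in[OF q']
    have "psubst (block 0 (diag_block_mat [A g, B g])) (psubst r' q) = psubst r' q" if g: "g \<in> H" for g
    proof -
      let ?d = "psubst (block 0 (diag_block_mat [A g, B g])) (psubst r' q)"
      have "substitution_on {..<a + b} (block 0 (diag_block_mat [A g, B g]))"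
        using substitution_on_block[OF D[OF g], of 0] by (simp add: atLeast0LessThan)
      then have d: "?d \<in> polys {..<a + b}" by (rule psubst_on(1)[OF _ in_polys])
      have "psubst r ?d = q"
        using equivariant[OF in_polys g] rr'[OF q'] q g by (auto simp: S'_def invariants_def)
      then show ?thesis using r'r[OF d] by simp
    qed
    then show ?thesis using in_polys by (auto simp: S_def invariants_def)
  qed
qed

lemma single_one_eq_iff: "Poly_Mapping.single i (Suc 0) = Poly_Mapping.single k (Suc 0) \<longleftrightarrow> i = k"
  by (metis lookup_single_eq lookup_single_not_eq nat.distinct(1))

lemma lookup_linear_form:
  fixes c :: "nat \<Rightarrow> 'k::field"
  assumes "k < n"
  shows "Poly_Mapping.lookup (\<Sum>j<n. pconst (c j) * pvar j) (Poly_Mapping.single k 1) = c k"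
proof -
  have "Poly_Mapping.lookup (pconst (c j) * pvar j) (Poly_Mapping.single k 1) = (if j = k then c k else 0)" for j
    by (auto simp: pconst_def pvar_def mult_single lookup_single when_def single_one_eq_iff)
  then show ?thesis using assms by (simp add: lookup_sum)
qed

lemma block_faithful:
  assumes A: "A \<in> carrier_mat d d" and "A \<noteq> 1\<^sub>m d"
  shows "\<exists>x\<in>polys {..<d}. psubst (block 0 A) x \<noteq> x"
proof (rule ccontr)
  assume "\<not> ?thesis"
  then have fixed: "block 0 A i = pvar i" if "i < d" for i
    using that pvar_in[of i "{..<d}"] by (metis lessThan_iff psubst_pvar)
  have "A = 1\<^sub>m d"
  proof (rule eq_matI)
    fix i k assume i: "i < dim_row (1\<^sub>m d :: 'a mat)" and k: "k < dim_col (1\<^sub>m d :: 'a mat)"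
    then have "(\<Sum>j<d. pconst (A $$ (i, j)) * pvar j) = pvar i" using fixed[of i] A by (simp add: block_def)
    then have "A $$ (i, k) = Poly_Mapping.lookup (pvar i) (Poly_Mapping.single k 1)"
      using lookup_linear_form[of k d "\<lambda>j. A $$ (i, j)"] k by simp
    then show "A $$ (i, k) = 1\<^sub>m d $$ (i, k)"
      using i k by (simp add: pvar_def lookup_single when_def single_one_eq_iff)
  qed (use A in auto)
  then show False using assms(2) by blast
qed

theorem corollary8p5:
  fixes G :: "('g, 'z) monoid_scheme"
    and d m1 m2 :: nat
    and \<beta> \<rho>1 \<rho>2 :: "'g \<Rightarrow> 'k::field mat"
  assumes "group G" and "finite (carrier G)"
    and "\<beta> \<in> hom G (GL d)" and "inj_on \<beta> (carrier G)"
    and "\<rho>1 \<in> hom G (GL m1)" and "\<rho>2 \<in> hom G (GL m2)"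
  shows "is_normalization_of_Spec
    (fibre_product_ring G d \<beta> m1 \<rho>1 m2 \<rho>2)
    (quotient_scheme G d \<beta> (m1 + m2) (rep_sum \<rho>1 \<rho>2))
    (natural_morphism G d \<beta> m1 \<rho>1 m2 \<rho>2)"
proof -
  interpret group G by fact
  note \<beta> = hom_GL[OF assms(1,3)] and \<rho>1 = hom_GL[OF assms(1,5)] and \<rho>2 = hom_GL[OF assms(1,6)]
  define N where "N = d + m1 + m2"
  define U where "U = {..<d}"
  define W where "W = {d..<d + m1}"
  define V where "V = {d + m1..<d + m1 + m2}"
  define Y where "Y = {N..<N + d}"
  define sX where "sX g = block 0 (\<beta> g)" for g
  define sW where "sW g = block d (\<rho>1 g)" for g
  define sV where "sV g = block (d + m1) (\<rho>2 g)" for g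
  define sY where "sY g = block N (\<beta> g)" for g
  define spec :: "nat \<Rightarrow> 'k mpoly" where "spec i = pvar (if i \<in> Y then i - N else i)" for i
  note vars = U_def W_def V_def Y_def N_def
  have action: "action_on U sX" "action_on W sW" "action_on V sV" "action_on Y sY"
    using action_on_block[OF assms(1,3), of 0] action_on_block[OF assms(1,5), of d]
      action_on_block[OF assms(1,6), of "d + m1"] action_on_block[OF assms(1,3), of N]
    by (simp_all add: sX_def[abs_def] sW_def[abs_def] sV_def[abs_def] sY_def[abs_def] vars atLeast0LessThan)
  interpret A: fibre_product_actions G U W V Y sX sW sV sY spec
  proof unfold_locales
    show "\<exists>x\<in>polys U. psubst (sX g) x \<noteq> x" if g: "g \<in> carrier G" "g \<noteq> \<one>\<^bsub>G\<^esub>" for g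
    proof -
      have "\<beta> g \<noteq> 1\<^sub>m d" using g assms(4) \<beta>(3) by (metis inj_onD one_closed)
      then show ?thesis unfolding sX_def U_def by (rule block_faithful[OF \<beta>(1)[OF g(1)]])
    qed
    show "psubst spec (sY g i) = psubst (sX g) (spec i)" if "i \<in> Y" "g \<in> carrier G" for i g
      using that \<beta>(1)[OF that(2)]
      by (auto simp: sY_def sX_def spec_def Y_def block_in psubst_hom intro!: sum.cong)
  qed (use assms(2) action in \<open>auto simp: vars spec_def intro!: pvar_in\<close>)

  define s2 where "s2 g = block 0 (rep_sum \<beta> \<rho>2 g)" for g
  define B where "B = invariants {..<d + m2} (s2 ` carrier G)"
  have sum2: "psubst (s2 g) p = psubst (block 0 (\<beta> g)) (psubst (block d (\<rho>2 g)) p)"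
    if "g \<in> carrier G" for g p
    using diag_block(2)[OF \<beta>(1)[OF that] \<rho>2(1)[OF that], of 0 p] by (simp add: s2_def rep_sum_def)
  have UW: "U \<union> W = {..<d + m1}" and UWV: "U \<union> W \<union> V = {..<N}" by (auto simp: vars)
  have ringX: "invariant_ring G d \<beta> = induced_ring A.RX"
    unfolding A.RX_def unfolding U_def by (rule invariant_ring_eq) (simp_all add: \<beta> sX_def)
  have ring1: "quotient_ring G d \<beta> m1 \<rho>1 = induced_ring A.B1"
    unfolding quotient_ring_def A.B1_def UW
    by (rule invariant_ring_eq)
       (use diag_block[OF \<beta>(1) \<rho>1(1)] in \<open>simp_all add: rep_sum_def A.psubst_compose sX_def sW_def\<close>)
  have ring2: "quotient_ring G d \<beta> m2 \<rho>2 = induced_ring B"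
    unfolding quotient_ring_def B_def
    by (rule invariant_ring_eq)
       (use diag_block(1)[OF \<beta>(1) \<rho>2(1)] in \<open>simp_all add: rep_sum_def s2_def\<close>)
  have ring12: "quotient_ring G d \<beta> (m1 + m2) (rep_sum \<rho>1 \<rho>2) = induced_ring A.C"
  proof -
    have c: "rep_sum \<rho>1 \<rho>2 g \<in> carrier_mat (m1 + m2) (m1 + m2)" if "g \<in> carrier G" for g
      unfolding rep_sum_def by (rule diag_block(1)[OF \<rho>1(1)[OF that] \<rho>2(1)[OF that]])
    have N: "N = d + (m1 + m2)" by (simp add: N_def)
    have "psubst (block 0 (rep_sum \<beta> (rep_sum \<rho>1 \<rho>2) g)) p = psubst (A.sXWV g) p"
      if g: "g \<in> carrier G" for g p
      using diag_block(2)[OF \<beta>(1)[OF g] c[OF g], of 0 p]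
        diag_block(2)[OF \<rho>1(1)[OF g] \<rho>2(1)[OF g], of d p]
      by (simp add: rep_sum_def A.psubst_compose sX_def sW_def sV_def)
    moreover have "rep_sum \<beta> (rep_sum \<rho>1 \<rho>2) g \<in> carrier_mat N N" if g: "g \<in> carrier G" for g
      unfolding N rep_sum_def[of \<beta>] by (rule diag_block(1)[OF \<beta>(1)[OF g] c[OF g]])
    ultimately show ?thesis
      unfolding quotient_ring_def A.C_def UWV N[symmetric] by (intro invariant_ring_eq)
  qed

  have UV: "{0..<0 + d} \<union> {d + m1..<d + m1 + m2} = U \<union> V"
    and YV: "{N..<N + d} \<union> {d + m1..<d + m1 + m2} = Y \<union> V" by (auto simp: vars)
  have disjUV: "{0..<0 + d} \<inter> {d + m1..<d + m1 + m2} = {}"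
    and disjYV: "{N..<N + d} \<inter> {d + m1..<d + m1 + m2} = {}" by (auto simp: vars)
  have imgB: "(\<lambda>g. block 0 (diag_block_mat [\<beta> g, \<rho>2 g])) ` carrier G = s2 ` carrier G"
    by (simp add: s2_def rep_sum_def)
  have imgY: "(\<lambda>g i. psubst (block N (\<beta> g)) (block (d + m1) (\<rho>2 g) i)) ` carrier G = A.sYV ` carrier G"
    by (simp add: A.sYV_def[abs_def] sY_def sV_def)
  have imgX: "(\<lambda>g i. psubst (block 0 (\<beta> g)) (block (d + m1) (\<rho>2 g) i)) ` carrier G = A.sXV ` carrier G"
    by (simp add: A.sXV_def[abs_def] sX_def sV_def)
  note renY = rename_invariants[of "carrier G" \<beta> d \<rho>2 m2, OF \<beta>(1) \<rho>2(1) disjYV,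
      unfolded imgB imgY YV, folded B_def A.B2'_def]
  note renX = rename_invariants[of "carrier G" \<beta> d \<rho>2 m2, OF \<beta>(1) \<rho>2(1) disjUV,
      unfolded imgB imgX UV, folded B_def A.B2_def]
  define j :: "nat \<Rightarrow> 'k mpoly" where "j = (\<lambda>i. pvar (if i < d then N + i else d + m1 + (i - d)))"
  define j' :: "nat \<Rightarrow> 'k mpoly"
    where "j' = (\<lambda>i. pvar (if N \<le> i \<and> i < N + d then i - N else d + (i - (d + m1))))"
  define pX :: "nat \<Rightarrow> 'k mpoly" where "pX = (\<lambda>i. pvar (if i < d then 0 + i else d + m1 + (i - d)))"
  define pX' :: "nat \<Rightarrow> 'k mpoly"
    where "pX' = (\<lambda>i. pvar (if 0 \<le> i \<and> i < 0 + d then i - 0 else d + (i - (d + m1))))"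
  note renY = renY[folded j_def j'_def] and renX = renX[folded pX_def pX'_def]
  have pX: "pullback2 d m1 = psubst pX"
    unfolding pullback2_def pX_def by (intro arg_cong[where f = psubst] ext) auto
  have B_polys: "b \<in> polys {..<d + m2}" if "b \<in> B" for b
    using that by (simp add: B_def invariants_def)

  have r_polys: "r \<in> polys U" if "r \<in> A.RX" for r
    using that by (simp add: A.RX_def invariants_def)
  have r_polysY: "r \<in> polys Y" if "r \<in> A.RY" for r
    using that by (simp add: A.RY_def invariants_def)

  interpret F: fibre_product G U W V Y sX sW sV sY spec B j j' "pullback2 d m1" N
  proof unfold_locales
    show "U \<union> W \<union> V = {..<N}" by (rule UWV)
    show "1 \<in> B" unfolding B_def by (rule invariants.one_in)
    show "x - y \<in> B" "x * y \<in> B" if "x \<in> B" "y \<in> B" for x y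
      using that by (auto simp: B_def intro: invariants.diff_in invariants.mult_in)
    show "psubst j b \<in> A.B2'" "psubst j' (psubst j b) = b" if "b \<in> B" for b
      by (rule renY(1,2)[OF _ _ that]; assumption)+
    show "psubst j' y \<in> B" "psubst j (psubst j' y) = y" if "y \<in> A.B2'" for y
      by (rule renY(3,4)[OF _ _ that]; assumption)+
    show "A.RX \<subseteq> B"
    proof
      fix r assume r: "r \<in> A.RX"
      have "psubst (s2 g) r = r" if g: "g \<in> carrier G" for g
      proof -
        have "psubst (block d (\<rho>2 g)) r = r"
          by (rule psubst_block_id[OF \<rho>2(1)[OF g] r_polys[OF r]]) (auto simp: vars)
        moreover have "psubst (block 0 (\<beta> g)) r = r"
          using r g by (auto simp: A.RX_def invariants_def sX_def)
        ultimately show ?thesis by (simp add: sum2[OF g])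
      qed
      moreover have "r \<in> polys {..<d + m2}"
        by (rule polys_mono[OF _ r_polys[OF r]]) (auto simp: vars)
      ultimately show "r \<in> B" by (auto simp: B_def invariants_def)
    qed
    show "psubst spec (psubst j r) = r" if "r \<in> A.RX" for r
      unfolding psubst_comp
      by (rule psubst_id[OF r_polys[OF that]]) (auto simp: j_def spec_def vars)
    show "psubst spec r \<in> A.RX" if r: "r \<in> A.RY" for r
    proof -
      have in_U: "psubst spec r \<in> polys U"
        by (rule psubst_in[OF r_polysY[OF r]]) (use A.spec_Y in auto)
      have "psubst (sX g) (psubst spec r) = psubst spec r" if g: "g \<in> carrier G" for g
      proof -
        have "psubst (sX g) (psubst spec r) = psubst spec (psubst (sY g) r)"
          unfolding psubst_comp
          by (rule psubst_cong[OF r_polysY[OF r]]) (use A.spec_equivariant g in auto)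
        then show ?thesis using r g by (auto simp: A.RY_def invariants_def)
      qed
      then show ?thesis using in_U by (auto simp: A.RX_def invariants_def)
    qed
    show "psubst j' r = psubst spec r" if "r \<in> A.RY" for r
      by (rule psubst_cong[OF r_polysY[OF that]]) (auto simp: j'_def spec_def vars)
    show "pullback2 d m1 b = psubst spec (psubst j b)" if "b \<in> B" for b
      unfolding pX psubst_comp
      by (rule psubst_cong[OF B_polys[OF that]]) (auto simp: pX_def j_def spec_def vars)
    show "pullback2 d m1 ` B = A.B2"
    proof
      show "pullback2 d m1 ` B \<subseteq> A.B2" using renX(1) by (auto simp: pX)
      show "A.B2 \<subseteq> pullback2 d m1 ` B"
      proof
        fix c assume c: "c \<in> A.B2"
        show "c \<in> pullback2 d m1 ` B"
          using c by (intro image_eqI[of _ _ "psubst pX' c"]) (simp_all add: pX renX(3,4))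
      qed
    qed
  qed
  show ?thesis
    using F.fibre_product_normalization
    unfolding fibre_product_ring_def quotient_scheme_def natural_morphism_def ringX ring1 ring2 ring12 Let_def .
qed

end
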